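(* Let $N\ge1$, $u_0,\ldots,u_N\in\mathbb{C}$ with all arguments below avoiding $\Lambda_\tau$, $u=u_0+\cdots+u_N$. Then (i) $[\delta_{jk}\zeta_N^{k}]_{j,k=0}^{N-1}M_N(u_0+1,u_1,\ldots,u_N;\tau)=-M_N(u_0,\ldots,u_N;\tau)$; (ii) $e^{-2\pi iu/N}q^{-1/(2N)}P\,M_N(u_0+\tau,u_1,\ldots,u_N;\tau)=-M_N(u_0,\ldots,u_N;\tau)-(-i)^Ne^{-\pi iu}q^{-N/8}\,{}^t(1,0,\ldots,0)$, where $P$ is the $N\times N$ cyclic permutation matrix with $(PV)_0=V_{N-1}$ and $(PV)_j=V_{j-1}$ for $1\le j\le N-1$; (iii) for $z$ with $z-u_0,z+u_1\notin\Lambda_\tau$: $M_N(u_0-z,u_1+z,u_2,\ldots,u_N;\tau)-M_N(u_0,\ldots,u_N;\tau)=\Phi_N(u_0,\ldots,u_N;z;\tau)$; (iv) $M_N(u_0,\ldots,u_N;\tau)=M_N(u_{\sigma(0)},\ldots,u_{\sigma(N)};\tau)$ for every permutation $\sigma$ of $\{0,\ldots,N\}$; (v) for $r\ne s$, $M_N(\ldots,u_r-\tau,\ldots,u_s+\tau,\ldots;\tau)=M_N(\ldots,u_r,\ldots,u_s,\ldots;\tau)$.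
   Context: Fix $\tau$ with $\operatorname{Im}\tau>0$, $q=e^{2\pi i\tau}$, $q^c:=e^{2\pi ic\tau}$, $\Lambda_\tau=\mathbb{Z}+\tau\mathbb{Z}$, $\zeta_N=e^{2\pi i/N}$. $\vartheta(u)=\vartheta(u;\tau)=\sum_{\nu\in\mathbb{Z}+1/2}e^{2\pi i\nu(u+1/2)}q^{\nu^2/2}$; $\eta(\tau)=q^{1/24}\prod_{j\ge1}(1-q^j)$. $|n|$ = sum of entries of $n$. Zwegers' multivariable $\mu$-function: $\mu_N(u_0,\ldots,u_N;\tau)=\sum_{n\in\mathbb{Z}^N}\frac{e^{\pi iu_0}}{1-e^{2\pi iu_0}q^{|n|}}\prod_{j=1}^N\frac{(-1)^{n_j}e^{-2\pi in_ju_j}q^{n_j(n_j+1)/2}}{\vartheta(u_j;\tau)}$. The column vector $M_N(u_0,\ldots,u_N;\tau)=\big[(-1)^ke^{-2\pi iku/N-\pi ik^2\tau/N}\mu_N(u_0+k\tau,u_1,\ldots,u_N;\tau)\big]_{k=0}^{N-1}$. $\widehat S$ is the $(N-1)\times(N-1)$ matrix with entries $1+\delta_{jk}$; $v_j=u_0+u_1-u_{j+1}$ ($1\le j\le N-1$), $v={}^t(v_1,\ldots,v_{N-1})$, $e_k={}^t(k/N,\ldots,k/N)\in\mathbb{Q}^{N-1}$, and $\nu_{N,k}(u_0,\ldots,u_N;\tau)=\sum_{n\in\mathbb{Z}^{N-1}+e_k}\exp(\pi i\,{}^tn\widehat Sn\,\tau+2\pi i(v,n))$ (equal to $1$ if $N=1$).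 Finally $\Phi_N(u_0,\ldots,u_N;z;\tau)=\frac{i\eta(\tau)^3\vartheta(z)\vartheta(z-u_0+u_1)}{\vartheta(z-u_0)\vartheta(z+u_1)\vartheta(u_0)\cdots\vartheta(u_N)}\big[\nu_{N,k}(u_0,\ldots,u_N;\tau)\big]_{k=0}^{N-1}$. *)

theory Defs
  imports "HOL-Analysis.Analysis" "HOL-Combinatorics.Permutations"
begin

definition lattice :: "complex \<Rightarrow> complex set" where
  "lattice \<tau> = {of_int a + of_int b * \<tau> | a b. True}"

definition qpow :: "complex \<Rightarrow> complex \<Rightarrow> complex" where
  "qpow \<tau> c = exp (2 * pi * \<i> * c * \<tau>)"

definition Zvec :: "nat set \<Rightarrow> (nat \<Rightarrow> int) set" where
  "Zvec A = {n. \<forall>j. j \<notin> A \<longrightarrow> n j = 0}"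

text \<open>Jacobi theta: sum over nu in Z+1/2, written nu = m + 1/2.\<close>
definition theta :: "complex \<Rightarrow> complex \<Rightarrow> complex" where
  "theta u \<tau> = (\<Sum>\<^sub>\<infinity>m\<in>(UNIV::int set).
      exp (2 * pi * \<i> * (of_int m + 1/2) * (u + 1/2)) * qpow \<tau> ((of_int m + 1/2)^2 / 2))"

definition eta :: "complex \<Rightarrow> complex" where
  "eta \<tau> = qpow \<tau> (1/24) * (\<Prod>j. (1 - qpow \<tau> 1 ^ Suc j))"

text \<open>Zwegers' multivariable mu-function; u j for j = 0..N are the arguments.\<close>
definition mu :: "nat \<Rightarrow> (nat \<Rightarrow> complex) \<Rightarrow> complex \<Rightarrow> complex" where
  "mu N u \<tau> = (\<Sum>\<^sub>\<infinity>n\<in>Zvec {1..N}.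
      exp (pi * \<i> * u 0) / (1 - exp (2 * pi * \<i> * u 0) * qpow \<tau> (of_int (\<Sum>j=1..N. n j)))
      * (\<Prod>j=1..N. (-1) powi (n j) * exp (- 2 * pi * \<i> * of_int (n j) * u j)
                     * qpow \<tau> (of_int (n j * (n j + 1)) / 2) / theta (u j) \<tau>))"

definition MN :: "nat \<Rightarrow> (nat \<Rightarrow> complex) \<Rightarrow> complex \<Rightarrow> nat \<Rightarrow> complex" where
  "MN N u \<tau> k = (let uu = (\<Sum>j=0..N. u j) in
      (-1)^k * exp (- 2 * pi * \<i> * of_nat k * uu / of_nat N - pi * \<i> * of_nat k ^ 2 * \<tau> / of_nat N)
      * mu N (u(0 := u 0 + of_nat k * \<tau>)) \<tau>)"

text \<open>nu_{N,k}: sum over n in Z^{N-1} + e_k, written n_j = m_j + k/N with m in Z^{N-1};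
  tn S n = sum_{j,l} (1 + delta_{jl}) n_j n_l; v_j = u_0 + u_1 - u_{j+1}.\<close>
definition nuN :: "nat \<Rightarrow> nat \<Rightarrow> (nat \<Rightarrow> complex) \<Rightarrow> complex \<Rightarrow> complex" where
  "nuN N k u \<tau> = (if N = 1 then 1 else
     (\<Sum>\<^sub>\<infinity>m\<in>Zvec {1..N-1}.
        (let n = (\<lambda>j. of_int (m j) + of_nat k / of_nat N :: complex);
             v = (\<lambda>j. u 0 + u 1 - u (j + 1))
         in exp (pi * \<i> * (\<Sum>j=1..N-1. \<Sum>l=1..N-1. (if j = l then 2 else 1) * n j * n l) * \<tau>
                 + 2 * pi * \<i> * (\<Sum>j=1..N-1. v j * n j)))))"

definition PhiN :: "nat \<Rightarrow> (nat \<Rightarrow> complex) \<Rightarrow> complex \<Rightarrow> complex \<Rightarrow> nat \<Rightarrow> complex" where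
  "PhiN N u z \<tau> k =
     \<i> * eta \<tau> ^ 3 * theta z \<tau> * theta (z - u 0 + u 1) \<tau>
     / (theta (z - u 0) \<tau> * theta (z + u 1) \<tau> * (\<Prod>j=0..N. theta (u j) \<tau>))
     * nuN N k u \<tau>"

end

theory Submission
  imports Defs "HOL-Complex_Analysis.Complex_Analysis"
begin

text \<open>
  Parts (i), (ii) and (v) come from shifting the summation vector and from the quasi-periodicity of
  the theta function; in (ii) one uses \<open>q\<^sup>-\<^sup>s / (1 - x q\<^sup>s) = q\<^sup>-\<^sup>s + x / (1 - x q\<^sup>s)\<close>, whose first
  summand turns the multiple sum into a product of theta functions.

  Summing over \<open>n\<^sub>1\<close> first writes \<open>\<mu>\<^sub>N\<close> as a sum of one-variable functions
  \<open>\<mu>\<^sub>1(u\<^sub>0 + s\<tau>, u\<^sub>1)\<close> with \<open>s = n\<^sub>2 + \<dots> + n\<^sub>N\<close>, so that (iii) reduces to \<open>N = 1\<close>; the quasi-periodicity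
  factors of theta then assemble into \<open>\<nu>\<^bsub>N,k\<^esub>\<close> after completing the square. For \<open>N = 1\<close>, the
  difference of the two sides, as a function of \<open>u\<^sub>0\<close>, changes sign under \<open>u\<^sub>0 + 1\<close> and is multiplied by
  \<open>- exp (2\<pi>\<i>(u\<^sub>0 + u\<^sub>1) + \<pi>\<i>\<tau>)\<close> under \<open>u\<^sub>0 + \<tau>\<close>, because the inhomogeneous terms of the two
  \<open>\<mu>\<^sub>1\<close> depend only on the sum of the arguments. Its poles cancel, since \<open>\<theta>'(0) = - 2\<pi>\<eta>\<^sup>3\<close> by the Jacobi
  triple product, and an entire function with these quasi-periods is bounded, hence zero.

  The exchange of \<open>u\<^sub>0\<close> and \<open>u\<^sub>1\<close> in (iv) is (iii) for \<open>z = u\<^sub>0 - u\<^sub>1\<close>, where \<open>\<theta>(z - u\<^sub>0 + u\<^sub>1) = \<theta>(0)\<close> vanishes.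
\<close>

section \<open>The Jacobi triple product\<close>

text \<open>The product form of theta serves for more than the derivative at 0: holomorphy and the
  exact zero set are read off it as well. For (ii), \<open>MN N u \<tau> k\<close> makes sense for
  every natural k, and a step of \<tau> in \<open>u 0\<close> merely turns k into k + 1, up to the
  stated factor; the inhomogeneous term enters only at the wrap from k = N to k = 0, because
  lowering all N summation indices by one changes the sum of the entries by exactly N. For (iii),
  residues are computed only at w = 0 and w = z; the functional equations carry the result to all
  lattice translates, and z in the lattice, where the two families of poles would collide, is
  treated apart. The multiplier in the first argument is that of a line bundle of degree -1, which
  is why a pole-free difference has to vanish. For (iv), \<open>mu\<close> is symmetric in the
  arguments 1, ..., N, and the transpositions (0 b) are conjugate to (0 1) under these
  symmetries.\<close>

fun qbinomial :: "'a::comm_ring_1 \<Rightarrow> nat \<Rightarrow> nat \<Rightarrow> 'a" where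
  "qbinomial q n 0 = 1"
| "qbinomial q 0 (Suc k) = 0"
| "qbinomial q (Suc n) (Suc k) = q ^ Suc k * qbinomial q n (Suc k) + qbinomial q n k"

lemma qbinomial_eq_0: "n < k \<Longrightarrow> qbinomial q n k = 0"
  by (induction q n k rule: qbinomial.induct) auto

lemma triangle_Suc: "k * (k - 1) div 2 + k = (k + 1) * k div (2::nat)"
  by (cases k) (auto simp: algebra_simps)

text \<open>Splitting off the factor with j = 0, not the last one, leaves the same product at
  \<open>x * q\<close>, hence the induction with x arbitrary. Comparing coefficients of x^(k+1)
  gives the recursion that defines \<open>qbinomial\<close>.\<close>

lemma qbinomial_theorem:
  fixes q x :: "'a::comm_ring_1"
  shows "(\<Prod>j<n. 1 + x * q ^ j) = (\<Sum>k\<le>n. qbinomial q n k * q ^ (k * (k - 1) div 2) * x ^ k)"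
proof (induction n arbitrary: x)
  case 0
  show ?case by simp
next
  case (Suc n)
  let ?c = "\<lambda>n k. qbinomial q n k * q ^ (k * (k - 1) div 2)"
  have "(\<Prod>j<Suc n. 1 + x * q ^ j) = (1 + x) * (\<Prod>j<n. 1 + (x * q) * q ^ j)"
    by (simp add: prod.lessThan_Suc_shift mult_ac del: prod.lessThan_Suc)
  also have "\<dots> = (1 + x) * (\<Sum>k\<le>n. ?c n k * (x * q) ^ k)"
    by (simp only: Suc.IH)
  also have "\<dots> = (\<Sum>k\<le>n. ?c n k * (x * q) ^ k) + (\<Sum>k\<le>n. x * (?c n k * (x * q) ^ k))"
    by (simp add: algebra_simps sum_distrib_left sum.distrib)
  also have "(\<Sum>k\<le>n. ?c n k * (x * q) ^ k) = (\<Sum>k\<le>Suc n. ?c n k * (x * q) ^ k)"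
    by (simp add: qbinomial_eq_0)
  also have "\<dots> = 1 + (\<Sum>k\<le>n. ?c n (Suc k) * (x * q) ^ Suc k)"
    by (subst sum.atMost_Suc_shift) simp
  also have "(1 + (\<Sum>k\<le>n. ?c n (Suc k) * (x * q) ^ Suc k)) + (\<Sum>k\<le>n. x * (?c n k * (x * q) ^ k))
      = 1 + (\<Sum>k\<le>n. ?c n (Suc k) * (x * q) ^ Suc k + x * (?c n k * (x * q) ^ k))"
    by (simp add: sum.distrib add_ac)
  also have "(\<Sum>k\<le>n. ?c n (Suc k) * (x * q) ^ Suc k + x * (?c n k * (x * q) ^ k))
      = (\<Sum>k\<le>n. ?c (Suc n) (Suc k) * x ^ Suc k)"
  proof (rule sum.cong)
    fix k
    have "q ^ (k * (k - 1) div 2) * q ^ k = q ^ (Suc k * (Suc k - 1) div 2)"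
      using triangle_Suc[of k] by (simp flip: power_add)
    hence *: "q ^ (Suc k * (Suc k - 1) div 2) = q ^ (k * (k - 1) div 2) * q ^ k" ..
    show "?c n (Suc k) * (x * q) ^ Suc k + x * (?c n k * (x * q) ^ k)
      = ?c (Suc n) (Suc k) * x ^ Suc k"
      unfolding * by (simp add: algebra_simps power_mult_distrib)
  qed simp
  also have "1 + \<dots> = (\<Sum>k\<le>Suc n. ?c (Suc n) k * x ^ k)"
    by (subst sum.atMost_Suc_shift) simp
  finally show ?case .
qed

definition qfact :: "'a::comm_ring_1 \<Rightarrow> nat \<Rightarrow> 'a" where
  "qfact q n = (\<Prod>i<n. 1 - q ^ Suc i)"

lemma qfact_Suc: "qfact q (Suc n) = qfact q n * (1 - q ^ Suc n)"
  by (simp add: qfact_def)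

text \<open>The classical quotient of q-factorials, cleared of denominators so that it makes sense
  in any commutative ring. After multiplication, the two terms of the recursion contribute q^(l+1) -
  q^(n+1) and 1 - q^(l+1), which telescope to 1 - q^(n+1).\<close>

lemma qbinomial_qfact:
  "k \<le> n \<Longrightarrow> qbinomial q n k * qfact q k * qfact q (n - k) = qfact q n"
proof (induction n arbitrary: k)
  case 0
  thus ?case by (simp add: qfact_def)
next
  case (Suc n)
  show ?case
  proof (cases k)
    case 0
    thus ?thesis by (simp add: qfact_def)
  next
    case [simp]: (Suc l)
    have 1: "qbinomial q n l * qfact q l * qfact q (n - l) = qfact q n"
      using Suc.prems by (intro Suc.IH) auto
    have 2: "qbinomial q n (Suc l) * qfact q (Suc l) * qfact q (n - l) = qfact q n * (1 - q ^ (n - l))"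
    proof (cases "l = n")
      \<comment> \<open>At the boundary both sides are zero: \<open>qbinomial q n (Suc n)\<close> on
        the left, 1 - q^0 on the right.\<close>
      case True
      thus ?thesis by (simp add: qbinomial_eq_0)
    next
      case False
      hence "Suc l \<le> n" using Suc.prems by simp
      hence *: "n - l = Suc (n - Suc l)" by simp
      show ?thesis unfolding * qfact_Suc[of q "n - Suc l"]
        using Suc.IH[OF \<open>Suc l \<le> n\<close>] by (simp add: algebra_simps)
    qed
    have "qbinomial q (Suc n) k * qfact q k * qfact q (Suc n - k)
      = q ^ Suc l * (qbinomial q n (Suc l) * qfact q (Suc l) * qfact q (n - l))
        + qbinomial q n l * qfact q l * qfact q (n - l) * (1 - q ^ Suc l)"
      by (simp add: qfact_Suc[of q l] algebra_simps)
    also have "\<dots> = qfact q n * (1 - q ^ Suc l * q ^ (n - l))"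
      unfolding 1 2 by (simp add: algebra_simps)
    also have "q ^ Suc l * q ^ (n - l) = q ^ Suc n"
      using Suc.prems by (subst power_add [symmetric]) simp
    finally show ?thesis by (simp add: qfact_Suc)
  qed
qed

text \<open>Completing the square with m = k - n: k(k-1)/2 + (1-n)k = m(m+1)/2 - n(n-1)/2. This
  recentres the sum over 0..2n as a sum over -n..n.\<close>

lemma triangle_powi:
  fixes q :: "'a::field"
  assumes "q \<noteq> 0"
  shows "q ^ (k * (k - 1) div 2) * (q powi (1 - int n)) ^ k
    = q powi ((int k - int n) * (int k - int n + 1) div 2) * q powi (- (int n * (int n - 1) div 2))"
proof -
  have k: "int (k * (k - 1) div 2) = int k * (int k - 1) div 2"
    by (cases k) (auto simp: zdiv_int algebra_simps)
  define a b c where "a = int k * (int k - 1) div 2" and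
    "b = (int k - int n) * (int k - int n + 1) div 2" and "c = int n * (int n - 1) div 2"
  have "2 * a = int k * (int k - 1)" "2 * b = (int k - int n) * (int k - int n + 1)"
    "2 * c = int n * (int n - 1)"
    unfolding a_def b_def c_def by (intro dvd_mult_div_cancel; auto)+
  hence "2 * (a + (1 - int n) * int k) = 2 * (b - c)"
    by (simp only: distrib_left right_diff_distrib) (simp add: algebra_simps)
  hence e: "a + (1 - int n) * int k = b - c" by simp
  have "q ^ (k * (k - 1) div 2) * (q powi (1 - int n)) ^ k = q powi a * q powi ((1 - int n) * int k)"
    by (simp add: a_def power_int_mult flip: k)
  also have "\<dots> = q powi (b + (-c))"
    using assms e by (simp flip: power_int_add)
  also have "\<dots> = q powi b * q powi (- c)"
    using assms by (subst power_int_add) auto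
  finally show ?thesis unfolding b_def c_def .
qed

lemma finite_jacobi_triple_product:
  fixes q w :: "'a::field"
  assumes "q \<noteq> 0" "w \<noteq> 0"
  shows "(\<Prod>i<n. (1 - w * q ^ Suc i) * (1 - inverse w * q ^ i))
    = (\<Sum>m\<in>{-int n..int n}. qbinomial q (2 * n) (nat (int n + m)) *
          ((- w) powi m * q powi (m * (m + 1) div 2)))"
proof -
  \<comment> \<open>This is the \<open>q\<close>-binomial theorem of order \<open>2n\<close> at \<open>x = - w q\<^sup>1\<^sup>-\<^sup>n\<close>, divided by \<open>D\<close>.\<close>
  define D where "D = (- w) ^ n * q powi (- (int n * (int n - 1) div 2))"
  have D0: "D \<noteq> 0" using assms by (simp add: D_def)
  have pr: "(\<Prod>i<2*n. 1 + (- w * q powi (1 - int n)) * q ^ i)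
    = (\<Prod>i<n. (1 - w * q ^ Suc i)) * (\<Prod>i<n. 1 - w * q powi (- int i))"
  proof -
    have "(\<Prod>i<2*n. 1 + (- w * q powi (1 - int n)) * q ^ i) = (\<Prod>i<2*n. 1 - w * q powi (1 + int i - int n))"
    proof (rule prod.cong)
      fix i
      have "q powi (1 - int n) * q ^ i = q powi ((1 - int n) + int i)"
        using assms by (subst power_int_add) auto
      also have "(1 - int n) + int i = 1 + int i - int n" by simp
      finally show "1 + (- w * q powi (1 - int n)) * q ^ i = 1 - w * q powi (1 + int i - int n)"
        by simp
    qed simp
    \<comment> \<open>The 2n exponents 1 + i - n are cut at i = n: the upper half gives q^1, ...,
      q^n, the lower half in reverse order q^0, ..., q^(1-n).\<close>
    also have "\<dots> = prod (\<lambda>i. 1 - w * q powi (1 + int i - int n)) ({..<n} \<union> {n..<2*n})"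
      by (rule prod.cong) auto
    also have "prod (\<lambda>i. 1 - w * q powi (1 + int i - int n)) ({..<n} \<union> {n..<2*n})
      = (\<Prod>i<n. 1 - w * q powi (1 + int i - int n)) * (\<Prod>i\<in>{n..<2*n}. 1 - w * q powi (1 + int i - int n))"
      by (rule prod.union_disjoint) auto
    also have "(\<Prod>i<n. 1 - w * q powi (1 + int i - int n)) = (\<Prod>i<n. 1 - w * q powi (- int i))"
      by (rule prod.reindex_bij_witness[of _ "\<lambda>i. n - 1 - i" "\<lambda>i. n - 1 - i"]) (auto simp: of_nat_diff)
    also have "(\<Prod>i\<in>{n..<2*n}. 1 - w * q powi (1 + int i - int n)) = (\<Prod>i<n. 1 - w * q ^ Suc i)"
    proof (rule prod.reindex_bij_witness[of _ "\<lambda>i. i + n" "\<lambda>i. i - n"])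
      fix i assume "i \<in> {n..<2*n}"
      hence "1 + int i - int n = int (Suc (i - n))" by auto
      thus "1 - w * q ^ Suc (i - n) = 1 - w * q powi (1 + int i - int n)"
        by (simp only: power_int_of_nat)
    qed auto
    finally show ?thesis by (simp only: mult.commute)
  qed
  have "(\<Prod>i<n. 1 - w * q powi (- int i)) = D * (\<Prod>i<n. 1 - inverse w * q ^ i)"
    unfolding D_def
  proof (induction n)
    case (Suc n)
    define c where "c = int n * (int n - 1) div 2"
    have "2 * c = int n * (int n - 1)" unfolding c_def by (intro dvd_mult_div_cancel) simp
    hence "int (Suc n) * (int (Suc n) - 1) = 2 * (c + int n)" by (simp add: algebra_simps)
    hence e: "int (Suc n) * (int (Suc n) - 1) div 2 = c + int n" by simp
    \<comment> \<open>Reflecting a factor with a negative power of q leaves behind -w q^(-n), the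
      quotient of two consecutive values of the prefactor.\<close>
    have "1 - w * q powi (- int n) = - w * q powi (- int n) * (1 - inverse w * q ^ n)"
      using assms by (simp add: field_simps power_int_minus)
    moreover have "q powi (- (c + int n)) = q powi (- c) * q powi (- int n)"
      using assms by (simp flip: power_int_add)
    ultimately show ?case unfolding e using Suc by (simp add: c_def mult_ac)
  qed simp
  hence "D * (\<Prod>i<n. (1 - w * q ^ Suc i) * (1 - inverse w * q ^ i))
     = (\<Prod>i<2*n. 1 + (- w * q powi (1 - int n)) * q ^ i)"
    unfolding pr by (simp add: prod.distrib mult_ac)
  also have "\<dots> = (\<Sum>k\<le>2*n. qbinomial q (2*n) k * q ^ (k * (k - 1) div 2) * (- w * q powi (1 - int n)) ^ k)"
    by (rule qbinomial_theorem)
  also have "\<dots> = (\<Sum>m\<in>{-int n..int n}. D * (qbinomial q (2 * n) (nat (int n + m)) *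
          ((- w) powi m * q powi (m * (m + 1) div 2))))"
  proof (rule sum.reindex_bij_witness[of _ "\<lambda>m. nat (int n + m)" "\<lambda>k. int k - int n"])
    fix k assume "k \<in> {..2*n}"
    have w: "(- w) ^ k = (- w) ^ n * (- w) powi (int k - int n)"
      using assms by (simp add: power_int_diff)
    have "(- w * q powi (1 - int n)) ^ k * q ^ (k * (k - 1) div 2)
       = (- w) ^ k * (q ^ (k * (k - 1) div 2) * (q powi (1 - int n)) ^ k)"
      by (subst power_mult_distrib) (simp only: mult_ac)
    also have "\<dots> = D * ((- w) powi (int k - int n) * q powi ((int k - int n) * (int k - int n + 1) div 2))"
      unfolding triangle_powi[OF assms(1)] w D_def by (simp add: mult_ac)
    finally show "D * (qbinomial q (2 * n) (nat (int n + (int k - int n))) *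
          ((- w) powi (int k - int n) * q powi ((int k - int n) * ((int k - int n) + 1) div 2)))
       = qbinomial q (2*n) k * q ^ (k * (k - 1) div 2) * (- w * q powi (1 - int n)) ^ k"
      by (simp add: mult_ac)
  qed auto
  finally show ?thesis using D0 by (simp flip: sum_distrib_left)
qed

section \<open>Passage to the limit in the finite triple product\<close>

lemma infsum_dominated_convergence:
  fixes f :: "nat \<Rightarrow> 'a \<Rightarrow> 'b::banach"
  assumes lim: "\<And>x. x \<in> A \<Longrightarrow> (\<lambda>n. f n x) \<longlonglongrightarrow> g x"
    and bound: "\<And>n x. x \<in> A \<Longrightarrow> norm (f n x) \<le> M x"
    and M: "M summable_on A"
  shows "(\<lambda>n. infsum (f n) A) \<longlonglongrightarrow> infsum g A"
proof (rule swap_uniform_limit'[where S = UNIV and F = "finite_subsets_at_top A"])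
  \<comment> \<open>Tannery's theorem: by the M-test the finite partial sums converge uniformly in
    n, which is what allows the two limits to be interchanged.\<close>
  show "uniform_limit UNIV (\<lambda>X n. \<Sum>x\<in>X. f n x) (\<lambda>n. infsum (f n) A) (finite_subsets_at_top A)"
    by (rule Weierstrass_m_test_general[OF bound M])
  show "\<forall>\<^sub>F X in finite_subsets_at_top A. (\<lambda>n. \<Sum>x\<in>X. f n x) \<longlonglongrightarrow> (\<Sum>x\<in>X. g x)"
    by (rule eventually_finite_subsets_at_top_weakI) (auto intro!: tendsto_sum lim)
  have "norm (g x) \<le> M x" if "x \<in> A" for x
    by (rule Lim_bounded[OF tendsto_norm[OF lim[OF that]], of 0]) (use bound that in auto)
  hence "(\<lambda>x. norm (g x)) summable_on A"
    by (intro summable_on_comparison_test[OF M]) auto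
  hence "g summable_on A" by (rule abs_summable_summable)
  thus "(sum g \<longlongrightarrow> infsum g A) (finite_subsets_at_top A)"
    by (rule infsum_tendsto)
qed auto

lemma summable_on_gaussian_int:
  fixes a b :: real
  assumes "a < 0"
  shows "(\<lambda>n::int. exp (a * of_int n ^ 2 + b * of_int n)) summable_on UNIV"
proof -
  \<comment> \<open>The maximum over real t of a t^2 + (|b| + 1) t; the extra 1 in the slope leaves
    room for the summable bound exp (C - |n|).\<close>
  define C where "C = (\<bar>b\<bar> + 1) ^ 2 / (- 4 * a)"
  have bnd: "a * x ^ 2 + b * x \<le> C - \<bar>x\<bar>" for x
  proof -
    have "a * x ^ 2 + (\<bar>b\<bar> + 1) * \<bar>x\<bar> - C = a * (\<bar>x\<bar> + (\<bar>b\<bar> + 1) / (2 * a)) ^ 2"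
      using assms by (simp add: C_def field_simps power2_eq_square)
    also have "\<dots> \<le> 0" using assms by (simp add: mult_nonpos_nonneg)
    finally have "a * x ^ 2 + (\<bar>b\<bar> + 1) * \<bar>x\<bar> \<le> C" by simp
    moreover have "b * x \<le> \<bar>b\<bar> * \<bar>x\<bar>" by (metis abs_ge_self abs_mult)
    ultimately show ?thesis by (simp add: algebra_simps)
  qed
  have nat: "(\<lambda>n::nat. exp C * exp (- 1) ^ n) summable_on UNIV"
    by (rule norm_summable_imp_summable_on) (auto intro!: summable_mult summable_geometric simp: norm_mult norm_power)
  have eq: "exp C * exp (- 1) ^ n = exp (C - real n)" for n
    by (simp add: exp_diff exp_minus field_simps flip: exp_of_nat_mult)
  have 1: "(\<lambda>n::int. exp (C - \<bar>of_int n\<bar>)) summable_on (range int)"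
    using nat unfolding eq by (subst summable_on_reindex) (auto simp: o_def)
  have 2: "(\<lambda>n::int. exp (C - \<bar>of_int n\<bar>)) summable_on (range (\<lambda>n. - int n))"
    using nat unfolding eq by (subst summable_on_reindex) (auto simp: o_def inj_on_def)
  have "range int \<union> range (\<lambda>n. - int n) = UNIV"
  proof (intro set_eqI iffI UNIV_I)
    fix x :: int show "x \<in> range int \<union> range (\<lambda>n. - int n)"
      by (cases x rule: int_cases2) auto
  qed
  with summable_on_union[OF 1 2] have "(\<lambda>n::int. exp (C - \<bar>of_int n\<bar>)) summable_on UNIV" by simp
  thus ?thesis by (rule summable_on_comparison_test) (use bnd in auto)
qed

lemma power_Suc_neq_1:
  fixes q :: "'a::real_normed_field"
  assumes "norm q < 1"
  shows "q ^ Suc i \<noteq> 1"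
proof
  assume "q ^ Suc i = 1"
  hence "norm q ^ Suc i = 1" by (metis norm_one norm_power)
  moreover have "norm q ^ Suc i < 1" using assms by (subst power_less_one_iff) auto
  ultimately show False by simp
qed

lemma
  fixes q :: "'a::{real_normed_field,banach}"
  assumes "norm q < 1"
  shows qfact_LIMSEQ: "qfact q \<longlonglongrightarrow> (\<Prod>i. 1 - q ^ Suc i)"
    and prodinf_qfact_nonzero: "(\<Prod>i. 1 - q ^ Suc i) \<noteq> 0"
proof -
  have "summable (\<lambda>i. norm (q * q ^ i))"
    using assms by (simp add: norm_mult norm_power summable_mult summable_geometric)
  hence "abs_convergent_prod (\<lambda>i. 1 - q ^ Suc i)"
    by (intro summable_imp_abs_convergent_prod) simp
  hence cv: "convergent_prod (\<lambda>i. 1 - q ^ Suc i)"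
    by (rule abs_convergent_prod_imp_convergent_prod)
  from convergent_prod_LIMSEQ[OF this] show "qfact q \<longlonglongrightarrow> (\<Prod>i. 1 - q ^ Suc i)"
    unfolding qfact_def by (subst (asm) LIMSEQ_lessThan_iff_atMost [symmetric])
  have "q ^ Suc i \<noteq> 1" for i
    using power_Suc_neq_1[OF assms] .
  thus "(\<Prod>i. 1 - q ^ Suc i) \<noteq> 0"
    using cv by (intro prodinf_nonzero) auto
qed

lemma qfact_nonzero:
  fixes q :: "'a::real_normed_field"
  assumes "norm q < 1"
  shows "qfact q n \<noteq> 0"
proof -
  have "q ^ Suc i \<noteq> 1" for i
    using power_Suc_neq_1[OF assms] .
  thus ?thesis by (auto simp: qfact_def)
qed

text \<open>For fixed m the q-binomial coefficient in the finite identity tends to P / (P P) = 1 /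
  P, where P is the product of all 1 - q^i, i > 0. It is bounded uniformly in n and m because
  \<open>qfact q\<close> and its reciprocal are bounded sequences, so dominated convergence
  applies.\<close>

lemma jacobi_triple_product:
  fixes q w :: complex
  assumes q: "q \<noteq> 0" "norm q < 1" and w: "w \<noteq> 0"
    and sum: "(\<lambda>m::int. norm ((- w) powi m * q powi (m * (m + 1) div 2))) summable_on UNIV"
  shows "(\<lambda>n. (\<Prod>i<n. (1 - w * q ^ Suc i) * (1 - inverse w * q ^ i)))
    \<longlonglongrightarrow> (\<Sum>\<^sub>\<infinity>m::int. (- w) powi m * q powi (m * (m + 1) div 2)) / (\<Prod>i. 1 - q ^ Suc i)"
proof -
  define t where "t = (\<lambda>m::int. (- w) powi m * q powi (m * (m + 1) div 2))"
  define P where "P = (\<Prod>i. 1 - q ^ Suc i)"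
  define f where "f = (\<lambda>n m. if m \<in> {-int n..int n} then qbinomial q (2 * n) (nat (int n + m)) * t m else 0)"
  have lim: "qfact q \<longlonglongrightarrow> P" and P0: "P \<noteq> 0"
    unfolding P_def using q by (auto intro: qfact_LIMSEQ simp: prodinf_qfact_nonzero simp del: power_Suc)
  have qb: "qbinomial q n k = qfact q n * inverse (qfact q k) * inverse (qfact q (n - k))" if "k \<le> n" for n k
    using qbinomial_qfact[OF that, of q] qfact_nonzero[OF q(2)] by (simp add: field_simps)
  from lim have "Bseq (qfact q)" by (intro convergent_imp_Bseq convergentI)
  then obtain C where C: "C > 0" "\<And>n. norm (qfact q n) \<le> C" by (auto elim: BseqE)
  from lim P0 have "(\<lambda>n. inverse (qfact q n)) \<longlonglongrightarrow> inverse P" by (rule tendsto_inverse)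
  hence "Bseq (\<lambda>n. inverse (qfact q n))" by (intro convergent_imp_Bseq convergentI)
  then obtain D where D: "D > 0" "\<And>n. norm (inverse (qfact q n)) \<le> D" by (auto elim: BseqE)
  have "(\<lambda>n. infsum (f n) UNIV) \<longlonglongrightarrow> (\<Sum>\<^sub>\<infinity>m. inverse P * t m)"
  proof (rule infsum_dominated_convergence)
    fix m :: int
    have f1: "filterlim (\<lambda>n. 2 * n) sequentially (sequentially :: nat filter)"
      by (rule filterlim_subseq) (auto simp: strict_mono_def)
    have f2: "filterlim (\<lambda>n. nat (int n + k)) sequentially sequentially" for k :: int
      unfolding filterlim_at_top
    proof
      fix Z :: nat
      show "\<forall>\<^sub>F n in sequentially. Z \<le> nat (int n + k)"
        using eventually_ge_at_top[of "Z + nat \<bar>k\<bar>"] by eventually_elim auto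
    qed
    have "(\<lambda>n. qfact q (2 * n) * inverse (qfact q (nat (int n + m))) * inverse (qfact q (nat (int n + (- m)))) * t m)
      \<longlonglongrightarrow> P * inverse P * inverse P * t m"
      by (intro tendsto_intros filterlim_compose[OF lim] f1 f2 P0)
    moreover have "\<forall>\<^sub>F n in sequentially. qfact q (2 * n) * inverse (qfact q (nat (int n + m))) * inverse (qfact q (nat (int n + (- m)))) * t m = f n m"
      using eventually_ge_at_top[of "nat \<bar>m\<bar>"]
    proof eventually_elim
      case (elim n)
      hence "2 * n - nat (int n + m) = nat (int n + (- m))" "nat (int n + m) \<le> 2 * n" by auto
      with elim show ?case unfolding f_def by (subst qb) auto
    qed
    ultimately show "(\<lambda>n. f n m) \<longlonglongrightarrow> inverse P * t m"
      using P0 by (auto intro: Lim_transform_eventually)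
  next
    fix n and m :: int
    have "norm (qbinomial q (2 * n) (nat (int n + m))) \<le> C * D * D" if "m \<in> {-int n..int n}"
      using that C D by (subst qb) (auto simp: norm_mult intro!: mult_mono)
    thus "norm (f n m) \<le> C * D * D * norm (t m)"
      using C D unfolding f_def by (auto simp: norm_mult intro!: mult_right_mono)
  next
    show "(\<lambda>m. C * D * D * norm (t m)) summable_on UNIV"
      using sum unfolding t_def by (rule summable_on_cmult_right)
  qed
  moreover have "infsum (f n) UNIV = (\<Prod>i<n. (1 - w * q ^ Suc i) * (1 - inverse w * q ^ i))" for n
  proof -
    have "infsum (f n) UNIV = infsum (f n) {-int n..int n}"
      by (rule infsum_cong_neutral) (auto simp: f_def)
    also have "\<dots> = (\<Prod>i<n. (1 - w * q ^ Suc i) * (1 - inverse w * q ^ i))"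
      unfolding finite_jacobi_triple_product[OF q(1) w] by (simp add: f_def t_def)
    finally show ?thesis .
  qed
  ultimately show ?thesis
    unfolding infsum_cmult_right' by (simp only: t_def P_def divide_inverse mult.commute)
qed

section \<open>The theta function\<close>

lemma exp_powi_int: "exp z powi n = exp (of_int n * z :: complex)"
  by (cases n rule: int_cases2) (simp_all add: power_int_minus exp_minus flip: exp_of_nat_mult)

lemma exp_pi_i_int: "exp (of_int n * (of_real pi * \<i>)) = (-1) powi n"
  by (subst exp_powi_int [symmetric]) simp

lemma exp_2pi_i_int: "exp (2 * of_real pi * \<i> * of_int n) = 1"
  by (subst exp_eq_1) (auto intro!: exI[of _ n])

lemma of_int_triangle: "of_int (n * (n + 1) div 2) = (of_int n * (of_int n + 1) / 2 :: 'a::field_char_0)"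
proof -
  define k where "k = n * (n + 1) div 2"
  have "2 * k = n * (n + 1)"
    unfolding k_def by (intro dvd_mult_div_cancel) auto
  hence "of_int (2 * k) = (of_int (n * (n + 1)) :: 'a)" by (simp only:)
  thus ?thesis unfolding k_def [symmetric] by (simp add: field_simps)
qed

lemma qpow_add: "qpow \<tau> (a + b) = qpow \<tau> a * qpow \<tau> b"
  by (simp add: qpow_def ring_distribs flip: exp_add)

lemma qpow_power: "qpow \<tau> a ^ n = qpow \<tau> (of_nat n * a)"
  by (simp add: qpow_def mult_ac flip: exp_of_nat_mult)

lemma qpow_nonzero [simp]: "qpow \<tau> a \<noteq> 0"
  by (simp add: qpow_def)

lemma theta_altdef:
  "theta u \<tau> = (\<Sum>\<^sub>\<infinity>m::int. exp (2 * pi * \<i> * (of_int m + 1/2) * (u + 1/2) + pi * \<i> * (of_int m + 1/2)\<^sup>2 * \<tau>))"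
  unfolding theta_def qpow_def by (intro infsum_cong) (simp add: algebra_simps exp_add)

lemma exp_half_odd: "exp (2 * of_real pi * \<i> * (of_int m + 1/2)) = (-1::complex)"
proof -
  have "exp (2 * of_real pi * \<i> * (of_int m + 1/2)) = exp (2 * of_real pi * \<i> * of_int m) * exp (of_real pi * \<i>)"
    by (simp add: algebra_simps flip: exp_add)
  thus ?thesis by (simp add: exp_2pi_i_int)
qed

lemma theta_add_1: "theta (u + 1) \<tau> = - theta u \<tau>"
proof -
  have "exp (2 * pi * \<i> * (of_int m + 1/2) * (u + 1 + 1/2) + pi * \<i> * (of_int m + 1/2)\<^sup>2 * \<tau>)
    = - exp (2 * pi * \<i> * (of_int m + 1/2) * (u + 1/2) + pi * \<i> * (of_int m + 1/2)\<^sup>2 * \<tau>)" for m :: int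
  proof -
    have "2 * pi * \<i> * (of_int m + 1/2) * (u + 1 + 1/2) + pi * \<i> * (of_int m + 1/2)\<^sup>2 * \<tau>
      = 2 * pi * \<i> * (of_int m + 1/2) + (2 * pi * \<i> * (of_int m + 1/2) * (u + 1/2) + pi * \<i> * (of_int m + 1/2)\<^sup>2 * \<tau>)"
      by (simp add: algebra_simps)
    thus ?thesis using exp_half_odd[of m] by (simp only: exp_add[of "2 * pi * \<i> * (of_int m + 1/2)"]) simp
  qed
  thus ?thesis by (simp only: theta_altdef infsum_uminus)
qed

text \<open>The substitution m -> -m - 1 negates m + 1/2. The sign arises because the series is
  written in u + 1/2, whose second summand is not negated along with u.\<close>

lemma theta_minus: "theta (- u) \<tau> = - theta u \<tau>"
proof -
  have "theta (- u) \<tau> = (\<Sum>\<^sub>\<infinity>m::int. - exp (2 * pi * \<i> * (of_int m + 1/2) * (u + 1/2) + pi * \<i> * (of_int m + 1/2)\<^sup>2 * \<tau>))"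
    unfolding theta_altdef
  proof (rule infsum_reindex_bij_witness[of _ "\<lambda>m. - m - 1" "\<lambda>m. - m - 1"])
    fix m :: int
    have n: "of_int (- m - 1) + 1/2 = - (of_int m + 1/2 :: complex)" by simp
    have "2 * pi * \<i> * (of_int m + 1/2) * (- u + 1/2) + pi * \<i> * (of_int m + 1/2)\<^sup>2 * \<tau>
      = 2 * pi * \<i> * (of_int m + 1/2) + (2 * pi * \<i> * (of_int (- m - 1) + 1/2) * (u + 1/2) + pi * \<i> * (of_int (- m - 1) + 1/2)\<^sup>2 * \<tau>)"
      unfolding n power2_minus by (simp add: algebra_simps)
    thus "- exp (2 * pi * \<i> * (of_int (- m - 1) + 1/2) * (u + 1/2) + pi * \<i> * (of_int (- m - 1) + 1/2)\<^sup>2 * \<tau>)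
      = exp (2 * pi * \<i> * (of_int m + 1/2) * (- u + 1/2) + pi * \<i> * (of_int m + 1/2)\<^sup>2 * \<tau>)"
      using exp_half_odd[of m] by (simp only: exp_add[of "2 * pi * \<i> * (of_int m + 1/2)"]) simp
  qed auto
  thus ?thesis by (simp only: theta_altdef infsum_uminus)
qed

lemma theta_0 [simp]: "theta 0 \<tau> = 0"
  using theta_minus[of 0 \<tau>] by simp

text \<open>Completing the square: (m + 1/2)^2 + 2n(m + 1/2) = (m + n + 1/2)^2 - n^2, so the shifted
  series is the original one with index m + n.\<close>

lemma theta_add_int_tau:
  "theta (u + of_int n * \<tau>) \<tau>
     = exp (- (pi * \<i> * of_int n) - pi * \<i> * (of_int n)\<^sup>2 * \<tau> - 2 * pi * \<i> * of_int n * u) * theta u \<tau>"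
  unfolding theta_altdef infsum_cmult_right' [symmetric]
  by (rule infsum_reindex_bij_witness[of _ "\<lambda>m. m - n" "\<lambda>m. m + n"])
     (auto simp: field_simps power2_eq_square simp flip: exp_add)

lemma theta_add_tau:
  "theta (u + \<tau>) \<tau> = - exp (- (pi * \<i> * \<tau>) - 2 * pi * \<i> * u) * theta u \<tau>"
proof -
  have "exp (- (of_real pi * \<i>) - pi * \<i> * \<tau> - 2 * pi * \<i> * u) = - exp (- (pi * \<i> * \<tau>) - 2 * pi * \<i> * u)"
    by (simp add: exp_diff exp_minus divide_inverse)
  thus ?thesis using theta_add_int_tau[of u 1 \<tau>] by simp
qed

section \<open>The q-Pochhammer product (wq; q) and the product expansion of theta\<close>

definition euler_prod :: "complex \<Rightarrow> complex \<Rightarrow> complex" where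
  "euler_prod q w = (\<Prod>i. 1 - w * q ^ Suc i)"

lemma
  fixes q w :: complex
  assumes "norm q < 1"
  shows euler_prod_LIMSEQ: "(\<lambda>n. \<Prod>i<n. 1 - w * q ^ Suc i) \<longlonglongrightarrow> euler_prod q w"
    and euler_prod_nonzero: "(\<And>i. w * q ^ Suc i \<noteq> 1) \<Longrightarrow> euler_prod q w \<noteq> 0"
proof -
  have "summable (\<lambda>i. norm (w * q * q ^ i))"
    using assms by (simp add: norm_mult norm_power summable_mult summable_geometric)
  hence "abs_convergent_prod (\<lambda>i. 1 - w * q ^ Suc i)"
    by (intro summable_imp_abs_convergent_prod) (simp add: mult_ac)
  hence cv: "convergent_prod (\<lambda>i. 1 - w * q ^ Suc i)"
    by (rule abs_convergent_prod_imp_convergent_prod)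
  from convergent_prod_LIMSEQ[OF this] show "(\<lambda>n. \<Prod>i<n. 1 - w * q ^ Suc i) \<longlonglongrightarrow> euler_prod q w"
    unfolding euler_prod_def by (subst (asm) LIMSEQ_lessThan_iff_atMost [symmetric])
  show "euler_prod q w \<noteq> 0" if "\<And>i. w * q ^ Suc i \<noteq> 1"
    unfolding euler_prod_def using cv that by (intro prodinf_nonzero) auto
qed

lemma holomorphic_euler_prod:
  fixes q :: complex
  assumes q: "norm q < 1"
  shows "euler_prod q holomorphic_on UNIV"
proof (rule holomorphic_on_subset)
  show "euler_prod q holomorphic_on (\<Union>R. ball 0 R)"
  proof (rule holomorphic_on_UN_open)
    fix R :: real
    have "uniformly_convergent_on (cball 0 R) (\<lambda>N w. \<Prod>i<N. 1 - w * q ^ Suc i)"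
    proof (rule uniformly_convergent_on_prod')
      show "uniformly_convergent_on (cball 0 R) (\<lambda>N w. \<Sum>n<N. norm (1 - w * q ^ Suc n - 1))"
      proof (rule Weierstrass_m_test')
        fix n :: nat and w :: complex assume "w \<in> cball 0 R"
        hence "norm w * (norm q * norm q ^ n) \<le> R * (norm q * norm q ^ n)"
          by (intro mult_right_mono) auto
        thus "norm (norm (1 - w * q ^ Suc n - 1)) \<le> R * norm q * norm q ^ n"
          by (simp add: norm_mult norm_power mult_ac)
      next
        show "summable (\<lambda>n. R * norm q * norm q ^ n)"
          using q by (intro summable_mult summable_geometric) auto
      qed
    qed (auto intro!: continuous_intros)
    then obtain l where l: "uniform_limit (cball 0 R) (\<lambda>N w. \<Prod>i<N. 1 - w * q ^ Suc i) l sequentially"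
      by (auto simp: uniformly_convergent_on_def)
    have "l w = euler_prod q w" if "w \<in> cball 0 R" for w
      using tendsto_uniform_limitI[OF l that] euler_prod_LIMSEQ[OF q] LIMSEQ_unique by blast
    with l have "uniform_limit (cball 0 R) (\<lambda>N w. \<Prod>i<N. 1 - w * q ^ Suc i) (euler_prod q) sequentially"
      by (subst (asm) uniform_limit_cong') auto
    thus "euler_prod q holomorphic_on ball 0 R"
      by (rule holomorphic_uniform_limit[rotated]) (auto intro!: always_eventually continuous_intros holomorphic_intros)
  qed auto
  show "UNIV \<subseteq> (\<Union>R. ball (0::complex) R)"
    by (auto intro: gt_ex)
qed

text \<open>The parameters a and b absorb every constant and linear exponent, so that the series in
  the triple product and the coefficients of \<open>mu\<close> are both instances.\<close>

lemma summable_theta_terms: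
  assumes "Im \<tau> > 0"
  shows "(\<lambda>m::int. norm (exp (a + of_int m * b + of_int m * (of_int m + 1) / 2 * (2 * pi * \<i> * \<tau>)))) summable_on UNIV"
proof -
  have "(\<lambda>m::int. exp (Re a) * exp ((- pi * Im \<tau>) * of_int m ^ 2 + (Re b - pi * Im \<tau>) * of_int m)) summable_on UNIV"
    using assms by (intro summable_on_cmult_right summable_on_gaussian_int) simp
  also have "(\<lambda>m::int. exp (Re a) * exp ((- pi * Im \<tau>) * of_int m ^ 2 + (Re b - pi * Im \<tau>) * of_int m))
    = (\<lambda>m::int. norm (exp (a + of_int m * b + of_int m * (of_int m + 1) / 2 * (2 * pi * \<i> * \<tau>))))"
    by (rule ext) (simp add: field_simps power2_eq_square flip: exp_add)
  finally show ?thesis .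
qed

context
  fixes \<tau> :: complex
  assumes tau: "Im \<tau> > 0"
begin

lemma norm_qpow_1_less_1: "norm (qpow \<tau> 1) < 1"
  using tau by (simp add: qpow_def)

lemma theta_eq_euler_prod:
  fixes u :: complex
  shows "theta u \<tau> = - 2 * sin (pi * u) * qpow \<tau> (1/8) * euler_prod (qpow \<tau> 1) 1 *
     euler_prod (qpow \<tau> 1) (exp (2 * pi * \<i> * u)) * euler_prod (qpow \<tau> 1) (exp (- (2 * pi * \<i> * u)))"
proof -
  define w q where "w = exp (2 * pi * \<i> * u)" and "q = qpow \<tau> 1"
  have [simp]: "w \<noteq> 0" "q \<noteq> 0" by (simp_all add: w_def q_def)
  have q: "norm q < 1" using norm_qpow_1_less_1 by (simp add: q_def)
  have mw: "- w = exp (2 * pi * \<i> * u + pi * \<i>)"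
    by (simp add: w_def exp_add)
  have t: "(- w) powi m * q powi (m * (m + 1) div 2)
    = exp (0 + of_int m * (2 * pi * \<i> * u + pi * \<i>) + of_int m * (of_int m + 1) / 2 * (2 * pi * \<i> * \<tau>))" for m
    unfolding mw q_def qpow_def exp_powi_int of_int_triangle by (simp add: exp_add)
  have E1: "euler_prod q 1 \<noteq> 0" and E1': "(\<Prod>i. 1 - q ^ Suc i) = euler_prod q 1"
    using prodinf_qfact_nonzero[OF q] by (simp_all add: euler_prod_def)
  have sm: "(\<lambda>m::int. norm ((- w) powi m * q powi (m * (m + 1) div 2))) summable_on UNIV"
    unfolding t by (rule summable_theta_terms[OF tau])
  have lim: "(\<lambda>n. (\<Prod>i<n. (1 - w * q ^ Suc i) * (1 - inverse w * q ^ i)))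
    \<longlonglongrightarrow> (\<Sum>\<^sub>\<infinity>m::int. (- w) powi m * q powi (m * (m + 1) div 2)) / euler_prod q 1"
    unfolding E1' [symmetric]
    by (rule jacobi_triple_product[OF _ q _ sm]) auto
  \<comment> \<open>The limit above pairs w q^(i+1) with q^i / w. To obtain two Euler products, the
    factor 1 - 1/w at i = 0 is split off, and the product with w runs one factor further.\<close>
  have "(\<lambda>n. (1 - inverse w) * (\<Prod>i<Suc n. 1 - w * q ^ Suc i) * (\<Prod>i<n. 1 - inverse w * q ^ Suc i))
     \<longlonglongrightarrow> (1 - inverse w) * euler_prod q w * euler_prod q (inverse w)"
    by (intro tendsto_intros filterlim_compose[OF euler_prod_LIMSEQ[OF q] filterlim_Suc] euler_prod_LIMSEQ q)
  also have "(\<lambda>n. (1 - inverse w) * (\<Prod>i<Suc n. 1 - w * q ^ Suc i) * (\<Prod>i<n. 1 - inverse w * q ^ Suc i))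
      = (\<lambda>n. \<Prod>i<Suc n. (1 - w * q ^ Suc i) * (1 - inverse w * q ^ i))"
    unfolding prod.distrib prod.lessThan_Suc_shift[of "\<lambda>i. 1 - inverse w * q ^ i"] by (simp add: mult_ac)
  finally have eq: "(1 - inverse w) * euler_prod q w * euler_prod q (inverse w)
     = (\<Sum>\<^sub>\<infinity>m::int. (- w) powi m * q powi (m * (m + 1) div 2)) / euler_prod q 1"
    using LIMSEQ_Suc[OF lim] LIMSEQ_unique by blast
  \<comment> \<open>The prefactor is the term m = 0 of the theta series.\<close>
  have "theta u \<tau> = (\<Sum>\<^sub>\<infinity>m::int. (\<i> * exp (pi * \<i> * u) * qpow \<tau> (1/8)) * ((- w) powi m * q powi (m * (m + 1) div 2)))"
    unfolding theta_altdef
  proof (rule infsum_cong)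
    fix m :: int
    have "\<i> = exp (pi * \<i> / 2)"
      using cis_pi_half by (simp add: cis_conv_exp mult.commute)
    hence "(\<i> * exp (pi * \<i> * u) * qpow \<tau> (1/8)) * ((- w) powi m * q powi (m * (m + 1) div 2))
      = exp (pi * \<i> / 2) * exp (pi * \<i> * u) * exp (2 * pi * \<i> * (1/8) * \<tau>) * exp (0 + of_int m * (2 * pi * \<i> * u + pi * \<i>) + of_int m * (of_int m + 1) / 2 * (2 * pi * \<i> * \<tau>))"
      unfolding t qpow_def by (simp only:)
    also have "\<dots> = exp (2 * pi * \<i> * (of_int m + 1/2) * (u + 1/2) + pi * \<i> * (of_int m + 1/2)\<^sup>2 * \<tau>)"
      unfolding exp_add [symmetric]
      by (rule arg_cong[of _ _ exp]) (simp add: field_simps power2_eq_square)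
    finally show "exp (2 * pi * \<i> * (of_int m + 1/2) * (u + 1/2) + pi * \<i> * (of_int m + 1/2)\<^sup>2 * \<tau>) =
       (\<i> * exp (pi * \<i> * u) * qpow \<tau> (1/8)) * ((- w) powi m * q powi (m * (m + 1) div 2))" ..
  qed
  also have "\<dots> = (\<i> * exp (pi * \<i> * u) * (1 - inverse w)) * qpow \<tau> (1/8) * euler_prod q 1 * euler_prod q w * euler_prod q (inverse w)"
  proof -
    have "(\<Sum>\<^sub>\<infinity>m::int. (- w) powi m * q powi (m * (m + 1) div 2))
      = (1 - inverse w) * euler_prod q w * euler_prod q (inverse w) * euler_prod q 1"
      unfolding eq using E1 by simp
    thus ?thesis unfolding infsum_cmult_right' by (simp only: mult_ac)
  qed
  \<comment> \<open>The prefactor and the split-off factor 1 - 1/w combine to a sine, which isolates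
    the simple zero at u = 0.\<close>
  also have "\<i> * exp (pi * \<i> * u) * (1 - inverse w) = - 2 * sin (pi * u)"
  proof -
    define E where "E = exp (pi * \<i> * u)"
    have "w = E * E" unfolding w_def E_def exp_add [symmetric] by (rule arg_cong[of _ _ exp]) simp
    moreover have "sin (pi * u) = (E - inverse E) / (2 * \<i>)"
      by (simp add: sin_exp_eq E_def mult_ac flip: exp_minus)
    moreover have "\<i> * E * (1 - inverse (E * E)) = \<i> * (E - inverse E)"
      by (simp add: E_def field_simps)
    moreover have "- 2 * (x / (2 * \<i>)) = \<i> * x" for x
      by (simp add: field_simps)
    ultimately show ?thesis unfolding E_def [symmetric] by metis
  qed
  also have "inverse w = exp (- (2 * pi * \<i> * u))" by (simp add: w_def exp_minus)
  finally show ?thesis by (simp add: w_def q_def)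
qed

lemma holomorphic_theta:
  assumes "f holomorphic_on A"
  shows "(\<lambda>z. theta (f z) \<tau>) holomorphic_on A"
proof -
  have 1: "(\<lambda>z. euler_prod (qpow \<tau> 1) (g z)) holomorphic_on A" if "g holomorphic_on A" for g
    using holomorphic_on_compose_gen[OF that holomorphic_euler_prod[OF norm_qpow_1_less_1]] by (simp add: o_def)
  show ?thesis unfolding theta_eq_euler_prod
    by (intro 1 holomorphic_intros assms)
qed

text \<open>Serves twice: for the factors of the theta product and for the denominators of
  \<open>mu\<close>.\<close>

lemma exp_times_qpow_neq_1:
  assumes "u \<notin> lattice \<tau>"
  shows "exp (2 * pi * \<i> * u) * qpow \<tau> (of_int n) \<noteq> 1"
proof
  assume "exp (2 * pi * \<i> * u) * qpow \<tau> (of_int n) = 1"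
  hence "exp (2 * pi * \<i> * (u + of_int n * \<tau>)) = 1"
    by (simp add: qpow_def ring_distribs mult_ac flip: exp_add)
  then obtain k :: int where "Re (2 * pi * \<i> * (u + of_int n * \<tau>)) = 0"
      "Im (2 * pi * \<i> * (u + of_int n * \<tau>)) = of_int (2 * k) * pi"
    by (auto simp: exp_eq_1)
  hence "Im (u + of_int n * \<tau>) = 0" "Re (u + of_int n * \<tau>) = of_int k"
    by auto
  hence "u + of_int n * \<tau> = of_int k" by (simp add: complex_eq_iff)
  hence "u = of_int k + of_int (- n) * \<tau>" by (simp add: algebra_simps)
  thus False using assms unfolding lattice_def by blast
qed

text \<open>Each factor of the product is nonzero: the sine accounts for the lattice points on the
  line of integers, the two Euler products for those with a positive or negative multiple of
  \<tau>.\<close>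

lemma theta_nonzero:
  assumes "u \<notin> lattice \<tau>"
  shows "theta u \<tau> \<noteq> 0"
proof -
  have q: "qpow \<tau> 1 ^ Suc i = qpow \<tau> (of_int (int (Suc i)))" for i
    by (simp add: qpow_power del: of_nat_Suc power_Suc)
  have m: "- u \<notin> lattice \<tau>"
  proof
    assume "- u \<in> lattice \<tau>"
    then obtain a b where "- u = of_int a + of_int b * \<tau>" by (auto simp: lattice_def)
    hence "u = of_int (- a) + of_int (- b) * \<tau>" by (simp add: algebra_simps minus_equation_iff[of u])
    thus False using assms unfolding lattice_def by blast
  qed
  have "sin (pi * u) \<noteq> 0"
  proof
    assume "sin (pi * u) = 0"
    then obtain k :: int where "of_real pi * u = of_real (of_int k * pi)" by (auto simp: Complex_Transcendental.sin_eq_0)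
    hence "u = of_int k + of_int 0 * \<tau>" by simp
    thus False using assms unfolding lattice_def by blast
  qed
  moreover have nz: "euler_prod (qpow \<tau> 1) w \<noteq> 0" if "\<And>n. w * qpow \<tau> (of_int n) \<noteq> 1" for w
    using that by (intro euler_prod_nonzero norm_qpow_1_less_1) (simp only: q not_False_eq_True)
  moreover have "euler_prod (qpow \<tau> 1) 1 \<noteq> 0"
    using prodinf_qfact_nonzero[OF norm_qpow_1_less_1] by (simp add: euler_prod_def)
  ultimately show ?thesis unfolding theta_eq_euler_prod
    using norm_qpow_1_less_1 exp_times_qpow_neq_1[OF assms] exp_times_qpow_neq_1[OF m] by simp
qed

lemma theta_over_arg_tendsto: "((\<lambda>u. theta u \<tau> / u) \<longlongrightarrow> - 2 * pi * eta \<tau> ^ 3) (at 0)"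
proof -
  define E where "E = euler_prod (qpow \<tau> 1)"
  have "isCont E z" for z
    using holomorphic_on_imp_continuous_on[OF holomorphic_euler_prod[OF norm_qpow_1_less_1]]
    by (simp add: E_def continuous_on_eq_continuous_at)
  hence E: "((\<lambda>u. E (g u)) \<longlongrightarrow> E c) F" if "(g \<longlongrightarrow> c) F" for g :: "complex \<Rightarrow> complex" and c F
    using that by (rule isCont_tendsto_compose)
  have "((\<lambda>u. sin (of_real pi * u)) has_field_derivative of_real pi) (at (0::complex))"
    by (auto intro!: derivative_eq_intros)
  hence s: "((\<lambda>u. sin (of_real pi * u) / u) \<longlongrightarrow> of_real pi) (at (0::complex))"
    by (simp add: has_field_derivative_iff)
  have "((\<lambda>u::complex. - 2 * (sin (pi * u) / u) * qpow \<tau> (1/8) * E 1 * E (exp (2 * pi * \<i> * u)) * E (exp (- (2 * pi * \<i> * u))))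
     \<longlongrightarrow> - 2 * of_real pi * qpow \<tau> (1/8) * E 1 * E (exp (2 * pi * \<i> * 0)) * E (exp (- (2 * pi * \<i> * 0)))) (at 0)"
    by (intro tendsto_intros E s)
  also have "- 2 * of_real pi * qpow \<tau> (1/8) * E 1 * E (exp (2 * pi * \<i> * 0)) * E (exp (- (2 * pi * \<i> * 0))) = - 2 * pi * eta \<tau> ^ 3"
  proof -
    \<comment> \<open>At u = 0 the three Euler products all become the one in \<open>eta\<close>,
      and q^(3/24) = q^(1/8); hence the cube.\<close>
    have "qpow \<tau> (1/24) ^ 3 = qpow \<tau> (1/8)" by (simp add: qpow_power)
    thus ?thesis
      by (simp add: eta_def E_def euler_prod_def power_mult_distrib) (simp add: power3_eq_cube)
  qed
  finally show ?thesis by (simp add: theta_eq_euler_prod E_def)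
qed

end

section \<open>Sums over integer vectors\<close>

text \<open>Prepends an entry to a vector indexed from 1. Position 0 lies outside the index set, so
  it has to be 0 for the result to belong to \<open>Zvec {1..Suc N}\<close>.\<close>

definition Zcons :: "int \<Rightarrow> (nat \<Rightarrow> int) \<Rightarrow> nat \<Rightarrow> int" where
  "Zcons a m = (\<lambda>j. if j = 0 then 0 else if j = 1 then a else m (j - 1))"

lemma Zcons_simps [simp]: "Zcons a m (Suc 0) = a" "j > 0 \<Longrightarrow> Zcons a m (Suc j) = m j"
  by (auto simp: Zcons_def)

lemma bij_betw_Zcons: "bij_betw (\<lambda>(a, m). Zcons a m) (UNIV \<times> Zvec {1..N}) (Zvec {1..Suc N})"
proof (rule bij_betwI[where g = "\<lambda>n. (n 1, \<lambda>j. if j = 0 then 0 else n (Suc j))"])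
  show "(\<lambda>(a, m). Zcons a m) \<in> UNIV \<times> Zvec {1..N} \<rightarrow> Zvec {1..Suc N}"
    by (auto simp: Zvec_def Zcons_def Suc_le_eq less_diff_conv)
  show "(\<lambda>n. (n 1, \<lambda>j. if j = 0 then 0 else n (Suc j))) \<in> Zvec {1..Suc N} \<rightarrow> UNIV \<times> Zvec {1..N}"
    by (auto simp: Zvec_def)
next
  fix x assume "x \<in> (UNIV :: int set) \<times> Zvec {1..N}"
  show "((case x of (a, m) \<Rightarrow> Zcons a m) 1, \<lambda>j. if j = 0 then 0 else (case x of (a, m) \<Rightarrow> Zcons a m) (Suc j)) = x"
    using \<open>x \<in> _\<close> by (auto simp: Zvec_def Zcons_def fun_eq_iff)
next
  fix n assume "n \<in> Zvec {1..Suc N}"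
  thus "(case (n 1, \<lambda>j. if j = 0 then 0 else n (Suc j)) of (a, m) \<Rightarrow> Zcons a m) = n"
    by (auto simp: Zvec_def Zcons_def fun_eq_iff)
qed

lemma Zvec_0: "Zvec {1..0} = {\<lambda>_. 0}"
  by (auto simp: Zvec_def)

lemma prod_Zcons: "(\<Prod>j=1..Suc N. f j (Zcons a m j)) = f 1 a * (\<Prod>j=1..N. f (Suc j) (m j))"
proof -
  have "(\<Prod>j=1..Suc N. f j (Zcons a m j)) = f 1 a * (\<Prod>j=Suc 1..Suc N. f j (Zcons a m j))"
    by (subst prod.atLeast_Suc_atMost) auto
  also have "(\<Prod>j=Suc 1..Suc N. f j (Zcons a m j)) = (\<Prod>j=1..N. f (Suc j) (m j))"
    by (subst prod.shift_bounds_cl_Suc_ivl) (auto intro!: prod.cong)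
  finally show ?thesis .
qed

lemma sum_Zcons: "(\<Sum>j=1..Suc N. f j (Zcons a m j)) = f 1 a + (\<Sum>j=1..N. f (Suc j) (m j))"
proof -
  have "(\<Sum>j=1..Suc N. f j (Zcons a m j)) = f 1 a + (\<Sum>j=Suc 1..Suc N. f j (Zcons a m j))"
    by (subst sum.atLeast_Suc_atMost) auto
  also have "(\<Sum>j=Suc 1..Suc N. f j (Zcons a m j)) = (\<Sum>j=1..N. f (Suc j) (m j))"
    by (subst sum.shift_bounds_cl_Suc_ivl) (auto intro!: sum.cong)
  finally show ?thesis .
qed

lemma infsum_Zcons:
  "infsum f (Zvec {1..Suc N}) = (\<Sum>\<^sub>\<infinity>(a, m)\<in>UNIV \<times> Zvec {1..N}. f (Zcons a m))"
  using infsum_reindex_bij_betw[OF bij_betw_Zcons, of f N] by (simp add: case_prod_unfold)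

lemma summable_on_Zcons:
  "f summable_on (Zvec {1..Suc N}) \<longleftrightarrow> (\<lambda>(a, m). f (Zcons a m)) summable_on (UNIV \<times> Zvec {1..N})"
  using summable_on_reindex_bij_betw[OF bij_betw_Zcons, of f N] by (simp add: case_prod_unfold)

lemma summable_on_prod_Zvec:
  fixes f :: "nat \<Rightarrow> int \<Rightarrow> complex"
  assumes "\<And>j. j \<in> {1..N} \<Longrightarrow> (\<lambda>k. norm (f j k)) summable_on UNIV"
  shows "(\<lambda>n. norm (\<Prod>j=1..N. f j (n j))) summable_on Zvec {1..N}"
  using assms
proof (induction N arbitrary: f)
  case 0
  show ?case unfolding Zvec_0 by simp
next
  case (Suc N)
  define P where "P = (\<lambda>m. norm (\<Prod>j=1..N. f (Suc j) (m j)))"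
  have P: "P summable_on Zvec {1..N}"
    unfolding P_def using Suc.prems by (intro Suc.IH) auto
  have f: "(\<lambda>k. norm (f 1 k)) summable_on UNIV"
    using Suc.prems by simp
  have "(\<lambda>(a, m). norm (f 1 a) * P m) summable_on (UNIV \<times> Zvec {1..N})"
    using f by (intro summable_on_SigmaI[where g = "\<lambda>a. norm (f 1 a) * infsum P (Zvec {1..N})"]
        summable_on_cmult_left)
      (use P has_sum_infsum in \<open>auto intro!: has_sum_cmult_right simp: P_def\<close>)
  thus ?case
    unfolding summable_on_Zcons prod_Zcons by (simp add: P_def norm_mult case_prod_unfold)
qed

text \<open>Induction on the dimension: absolute summability of the product turns the sum over pairs
  (first entry, remaining vector) into an iterated sum, which factors.\<close>

lemma infsum_prod_Zvec:
  fixes f :: "nat \<Rightarrow> int \<Rightarrow> complex"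
  assumes "\<And>j. j \<in> {1..N} \<Longrightarrow> (\<lambda>k. norm (f j k)) summable_on UNIV"
  shows "(\<Sum>\<^sub>\<infinity>n\<in>Zvec {1..N}. \<Prod>j=1..N. f j (n j)) = (\<Prod>j=1..N. \<Sum>\<^sub>\<infinity>k. f j k)"
  using assms
proof (induction N arbitrary: f)
  case 0
  show ?case unfolding Zvec_0 by simp
next
  case (Suc N)
  have "(\<lambda>n. \<Prod>j=1..Suc N. f j (n j)) summable_on Zvec {1..Suc N}"
    using Suc.prems by (rule abs_summable_summable[OF summable_on_prod_Zvec]) auto
  hence "(\<lambda>(a, m). f 1 a * (\<Prod>j=1..N. f (Suc j) (m j))) summable_on (UNIV \<times> Zvec {1..N})"
    unfolding summable_on_Zcons prod_Zcons .
  from infsum_Sigma'_banach[OF this]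
  have "(\<Sum>\<^sub>\<infinity>(a, m)\<in>UNIV \<times> Zvec {1..N}. f 1 a * (\<Prod>j=1..N. f (Suc j) (m j)))
    = (\<Sum>\<^sub>\<infinity>k. f 1 k) * (\<Sum>\<^sub>\<infinity>m\<in>Zvec {1..N}. \<Prod>j=1..N. f (Suc j) (m j))"
    by (simp only: infsum_cmult_right' infsum_cmult_left')
  also have "(\<Sum>\<^sub>\<infinity>m\<in>Zvec {1..N}. \<Prod>j=1..N. f (Suc j) (m j)) = (\<Prod>j=1..N. \<Sum>\<^sub>\<infinity>k. f (Suc j) k)"
    using Suc.prems by (intro Suc.IH[of "\<lambda>j. f (Suc j)"]) auto
  also have "(\<Sum>\<^sub>\<infinity>k. f 1 k) * \<dots> = (\<Prod>j=1..Suc N. \<Sum>\<^sub>\<infinity>k. f j k)"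
    by (subst (2) prod.atLeast_Suc_atMost) (simp_all del: prod.cl_ivl_Suc add: prod.shift_bounds_cl_Suc_ivl)
  finally show ?case unfolding infsum_Zcons prod_Zcons .
qed

text \<open>The share of one coordinate in the summand of \<open>mu\<close>. What remains besides
  exp (pi i \<open>u 0\<close>) is the denominator, which couples the coordinates only through the
  sum of the entries.\<close>

definition mu_coeff :: "complex \<Rightarrow> complex \<Rightarrow> int \<Rightarrow> complex" where
  "mu_coeff \<tau> v k = (-1) powi k * exp (- 2 * pi * \<i> * of_int k * v) * qpow \<tau> (of_int (k * (k + 1)) / 2) / theta v \<tau>"

lemma mu_altdef:
  "mu N u \<tau> = (\<Sum>\<^sub>\<infinity>n\<in>Zvec {1..N}.
      exp (pi * \<i> * u 0) / (1 - exp (2 * pi * \<i> * u 0) * qpow \<tau> (of_int (\<Sum>j=1..N. n j)))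
      * (\<Prod>j=1..N. mu_coeff \<tau> (u j) (n j)))"
  by (simp add: mu_def mu_coeff_def)

lemma mu_coeff_exp:
  "mu_coeff \<tau> v k = exp (of_int k * (of_real pi * \<i> - 2 * pi * \<i> * v) + of_int k * (of_int k + 1) / 2 * (2 * pi * \<i> * \<tau>)) / theta v \<tau>"
proof -
  have "exp (of_int k * (of_real pi * \<i>)) * exp (- 2 * pi * \<i> * of_int k * v) * exp (2 * pi * \<i> * (of_int (k * (k + 1)) / 2) * \<tau>)
    = exp (of_int k * (of_real pi * \<i> - 2 * pi * \<i> * v) + of_int k * (of_int k + 1) / 2 * (2 * pi * \<i> * \<tau>))"
    unfolding exp_add [symmetric] by (rule arg_cong[of _ _ exp]) (simp add: field_simps)
  thus ?thesis unfolding mu_coeff_def qpow_def exp_pi_i_int [symmetric] by (simp only:)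
qed

lemma mu_coeff_add_1: "mu_coeff \<tau> (v + 1) k = - mu_coeff \<tau> v k"
proof -
  have "exp (- 2 * pi * \<i> * of_int k * (v + 1)) = exp (- 2 * pi * \<i> * of_int k * v) * exp (2 * of_real pi * \<i> * of_int (- k))"
    unfolding exp_add [symmetric] by (rule arg_cong[of _ _ exp]) (simp add: algebra_simps)
  thus ?thesis unfolding mu_coeff_def theta_add_1 exp_2pi_i_int by simp
qed

text \<open>The multiplier of theta in the denominator matches the quadratic change of the exponent
  in the numerator. A shift of v by b periods is therefore an index shift up to a factor free of v
  and k.\<close>

lemma mu_coeff_add_int_tau:
  "mu_coeff \<tau> (v + of_int b * \<tau>) (k + b) = exp (pi * \<i> * of_int b * \<tau>) * mu_coeff \<tau> v k"
proof -
  define A where "A = - (pi * \<i> * of_int b) - pi * \<i> * (of_int b)\<^sup>2 * \<tau> - 2 * pi * \<i> * of_int b * v"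
  define B where "B = of_int (k + b) * (of_real pi * \<i> - 2 * pi * \<i> * (v + of_int b * \<tau>)) + of_int (k + b) * (of_int (k + b) + 1) / 2 * (2 * pi * \<i> * \<tau>)"
  define C where "C = of_int k * (of_real pi * \<i> - 2 * pi * \<i> * v) + of_int k * (of_int k + 1) / 2 * (2 * pi * \<i> * \<tau>)"
  define m where "m = 2 * pi * \<i> * of_int b"
  \<comment> \<open>The exponents agree only up to m, a multiple of 2 pi i.\<close>
  have "B - A = (pi * \<i> * of_int b * \<tau> + C) + m"
    unfolding A_def B_def C_def m_def by (simp add: field_simps power2_eq_square)
  hence "exp (B - A) = exp (pi * \<i> * of_int b * \<tau> + C) * exp m"
    by (simp only: exp_add)
  also have "exp m = 1" unfolding m_def using exp_2pi_i_int[of b] by simp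
  finally show ?thesis
    unfolding mu_coeff_exp theta_add_int_tau A_def [symmetric] B_def [symmetric] C_def [symmetric]
    by (simp add: exp_add exp_diff flip: divide_divide_eq_left)
qed

text \<open>Meant for the shift of \<open>u 0\<close> by N periods, where every index is lowered by
  one: the product over the coordinates then produces q to the power minus the sum of the
  entries.\<close>

lemma mu_coeff_pred: "mu_coeff \<tau> v (k - 1) = - exp (2 * pi * \<i> * v) * (qpow \<tau> (- of_int k) * mu_coeff \<tau> v k)"
proof -
  define B where "B = of_int (k - 1) * (of_real pi * \<i> - 2 * pi * \<i> * v) + of_int (k - 1) * (of_int (k - 1) + 1) / 2 * (2 * pi * \<i> * \<tau>)"
  define C where "C = of_int k * (of_real pi * \<i> - 2 * pi * \<i> * v) + of_int k * (of_int k + 1) / 2 * (2 * pi * \<i> * \<tau>)"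
  have "B + of_real pi * \<i> = 2 * pi * \<i> * v + (2 * pi * \<i> * (- of_int k) * \<tau> + C)"
    unfolding B_def C_def by (simp add: field_simps power2_eq_square)
  hence "exp B * exp (of_real pi * \<i>) = exp (2 * pi * \<i> * v) * (exp (2 * pi * \<i> * (- of_int k) * \<tau>) * exp C)"
    by (simp only: exp_add [symmetric])
  hence "exp B = - exp (2 * pi * \<i> * v) * (exp (2 * pi * \<i> * (- of_int k) * \<tau>) * exp C)"
    by (simp add: minus_equation_iff[of "exp B"])
  thus ?thesis unfolding mu_coeff_exp B_def [symmetric] C_def [symmetric] qpow_def by simp
qed

lemma summable_mu_coeff:
  assumes "Im \<tau> > 0"
  shows "(\<lambda>k. norm (mu_coeff \<tau> v k)) summable_on UNIV"
proof -
  have eq: "mu_coeff \<tau> v k = exp (0 + of_int k * (of_real pi * \<i> - 2 * pi * \<i> * v) + of_int k * (of_int k + 1) / 2 * (2 * pi * \<i> * \<tau>)) / theta v \<tau>" for k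
    by (simp only: mu_coeff_exp add_0_left)
  show ?thesis
    unfolding eq norm_divide divide_inverse[of "norm (_ :: complex)"]
    by (rule summable_on_cmult_left[OF summable_theta_terms[OF assms]])
qed

lemma summable_qpow_mu_coeff:
  assumes "Im \<tau> > 0"
  shows "(\<lambda>k. norm (qpow \<tau> (- of_int k) * mu_coeff \<tau> v k)) summable_on UNIV"
proof -
  have "qpow \<tau> (- of_int k) * mu_coeff \<tau> v k = - exp (- (2 * pi * \<i> * v)) * mu_coeff \<tau> v (k - 1)" for k
    unfolding mu_coeff_pred by (simp add: exp_minus)
  hence eq: "norm (qpow \<tau> (- of_int k) * mu_coeff \<tau> v k) = norm (exp (- (2 * pi * \<i> * v))) * norm (mu_coeff \<tau> v (k - 1))" for k
    by (simp only: norm_mult norm_minus_cancel)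
  have "bij_betw (\<lambda>k::int. k - 1) UNIV UNIV"
    by (rule bij_betwI[where g = "\<lambda>k. k + 1"]) auto
  from summable_on_reindex_bij_betw[OF this, of "\<lambda>k. norm (mu_coeff \<tau> v k)"] summable_mu_coeff[OF assms]
  have "(\<lambda>k. norm (mu_coeff \<tau> v (k - 1))) summable_on UNIV" by blast
  thus ?thesis unfolding eq by (rule summable_on_cmult_right)
qed

text \<open>With m = -k the exponent becomes k(k-1)/2 = (m + 1/2)^2 / 2 - 1/8, so the numerators
  form the theta series itself and cancel the denominator. The constants -i and exp (-pi i v) undo
  the half-integral index in 2 pi i (m + 1/2)(v + 1/2).\<close>

lemma infsum_qpow_mu_coeff:
  assumes "theta v \<tau> \<noteq> 0"
  shows "(\<Sum>\<^sub>\<infinity>k. qpow \<tau> (- of_int k) * mu_coeff \<tau> v k) = - \<i> * exp (- pi * \<i> * v) * qpow \<tau> (- 1 / 8)"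
proof -
  define c where "c = - \<i> * exp (- pi * \<i> * v) * qpow \<tau> (- 1 / 8)"
  have "(\<Sum>\<^sub>\<infinity>k. qpow \<tau> (- of_int k) * mu_coeff \<tau> v k)
     = (\<Sum>\<^sub>\<infinity>m::int. c / theta v \<tau> * exp (2 * pi * \<i> * (of_int m + 1/2) * (v + 1/2) + pi * \<i> * (of_int m + 1/2)\<^sup>2 * \<tau>))"
  proof (rule infsum_reindex_bij_witness[of _ uminus uminus])
    fix k :: int
    have i: "- \<i> = exp (- (pi * \<i> / 2))"
      using cis_pi_half by (simp add: cis_conv_exp mult.commute exp_minus)
    have "c * exp (2 * pi * \<i> * (of_int (-k) + 1/2) * (v + 1/2) + pi * \<i> * (of_int (-k) + 1/2)\<^sup>2 * \<tau>)
      = exp (- (pi * \<i> / 2) + - pi * \<i> * v + 2 * pi * \<i> * (- 1 / 8) * \<tau> + (2 * pi * \<i> * (of_int (-k) + 1/2) * (v + 1/2) + pi * \<i> * (of_int (-k) + 1/2)\<^sup>2 * \<tau>))"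
      unfolding c_def qpow_def exp_add i ..
    also have "\<dots> = exp (2 * pi * \<i> * (- of_int k) * \<tau> + (of_int k * (of_real pi * \<i> - 2 * pi * \<i> * v) + of_int k * (of_int k + 1) / 2 * (2 * pi * \<i> * \<tau>)) + 2 * of_real pi * \<i> * of_int (-k))"
      by (rule arg_cong[of _ _ exp]) (simp add: field_simps power2_eq_square)
    also have "\<dots> = exp (2 * pi * \<i> * (- of_int k) * \<tau>) * exp (of_int k * (of_real pi * \<i> - 2 * pi * \<i> * v) + of_int k * (of_int k + 1) / 2 * (2 * pi * \<i> * \<tau>))"
      unfolding exp_add exp_2pi_i_int by simp
    finally show "c / theta v \<tau> * exp (2 * pi * \<i> * (of_int (-k) + 1/2) * (v + 1/2) + pi * \<i> * (of_int (-k) + 1/2)\<^sup>2 * \<tau>)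
       = qpow \<tau> (- of_int k) * mu_coeff \<tau> v k"
      unfolding mu_coeff_exp qpow_def by (simp only: times_divide_eq_left times_divide_eq_right)
  qed auto
  also have "\<dots> = c / theta v \<tau> * theta v \<tau>"
    unfolding theta_altdef infsum_cmult_right' ..
  finally show ?thesis using assms by (simp add: c_def)
qed

section \<open>Translations of the summation vector\<close>

lemma Zvec_shift:
  assumes "d \<in> Zvec A"
  shows "infsum f (Zvec A) = (\<Sum>\<^sub>\<infinity>n\<in>Zvec A. f (\<lambda>j. n j + d j))"
  by (rule infsum_reindex_bij_witness[of _ "\<lambda>n j. n j + d j" "\<lambda>n j. n j - d j"])
     (use assms in \<open>auto simp: Zvec_def\<close>)

text \<open>Translating the summation vector by d changes the sum of its entries by that of d, which
  the shift of \<open>u 0\<close> undoes in the denominator. The factors exp (pi i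
  \<open>d j\<close> \<tau>) of the coordinates are absorbed by exp (pi i
  \<open>u 0\<close>).\<close>

lemma mu_shift:
  assumes d: "d \<in> Zvec {1..N}"
    and u0: "u' 0 = u 0 - of_int (\<Sum>j=1..N. d j) * \<tau>"
    and uj: "\<And>j. j \<in> {1..N} \<Longrightarrow> u' j = u j + of_int (d j) * \<tau>"
  shows "mu N u' \<tau> = mu N u \<tau>"
  unfolding mu_altdef
proof (subst Zvec_shift[OF d], rule infsum_cong)
  fix n assume "n \<in> Zvec {1..N}"
  define s where "s = (\<Sum>j=1..N. d j)"
  have "(\<Prod>j=1..N. mu_coeff \<tau> (u' j) (n j + d j)) = (\<Prod>j=1..N. exp (pi * \<i> * of_int (d j) * \<tau>) * mu_coeff \<tau> (u j) (n j))"
    by (rule prod.cong) (simp_all add: uj mu_coeff_add_int_tau)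
  also have "\<dots> = exp (\<Sum>j=1..N. pi * \<i> * of_int (d j) * \<tau>) * (\<Prod>j=1..N. mu_coeff \<tau> (u j) (n j))"
    by (simp add: prod.distrib exp_sum)
  also have "(\<Sum>j=1..N. pi * \<i> * of_int (d j) * \<tau>) = pi * \<i> * of_int s * \<tau>"
    by (simp add: s_def sum_distrib_left sum_distrib_right)
  finally have 1: "(\<Prod>j=1..N. mu_coeff \<tau> (u' j) (n j + d j)) = exp (pi * \<i> * of_int s * \<tau>) * (\<Prod>j=1..N. mu_coeff \<tau> (u j) (n j))" .
  have 2: "exp (pi * \<i> * u' 0) * exp (pi * \<i> * of_int s * \<tau>) = exp (pi * \<i> * u 0)"
    unfolding exp_add [symmetric] u0 s_def by (simp add: algebra_simps)
  have 3: "(\<Sum>j=1..N. n j + d j) = (\<Sum>j=1..N. n j) + s" by (simp add: s_def sum.distrib)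
  have 4: "exp (2 * pi * \<i> * u' 0) * qpow \<tau> (of_int (x + s)) = exp (2 * pi * \<i> * u 0) * qpow \<tau> (of_int x)" for x
    unfolding qpow_def exp_add [symmetric] u0 s_def by (simp add: algebra_simps)
  show "exp (pi * \<i> * u' 0) / (1 - exp (2 * pi * \<i> * u' 0) * qpow \<tau> (of_int (\<Sum>j=1..N. n j + d j)))
      * (\<Prod>j=1..N. mu_coeff \<tau> (u' j) (n j + d j))
     = exp (pi * \<i> * u 0) / (1 - exp (2 * pi * \<i> * u 0) * qpow \<tau> (of_int (\<Sum>j=1..N. n j)))
      * (\<Prod>j=1..N. mu_coeff \<tau> (u j) (n j))"
    unfolding 1 3 4 2 [symmetric] by simp
qed

lemma mu_add_1:
  assumes "u' 0 = u 0 + 1" "\<And>j. j \<in> {1..N} \<Longrightarrow> u' j = u j"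
  shows "mu N u' \<tau> = - mu N u \<tau>"
proof -
  have "exp (pi * \<i> * u' 0) = - exp (pi * \<i> * u 0)" "exp (2 * pi * \<i> * u' 0) = exp (2 * pi * \<i> * u 0)"
    unfolding assms using exp_2pi_i_int[of 1] by (simp_all add: ring_distribs exp_add)
  thus ?thesis unfolding mu_altdef by (simp add: assms(2) infsum_uminus)
qed

section \<open>Convergence of the multivariable series and the shift by N periods\<close>

context
  fixes \<tau> :: complex
  assumes tau: "Im \<tau> > 0"
begin

text \<open>The subtracted term has modulus exp (-2 pi t) with t = Im w + n Im \<tau>. The
  hypothesis forces |t| to be at least 1, so this modulus is at most 1/2 or at least 2. The bound R
  on w makes the estimate uniform on discs.\<close>

lemma appell_denominator_far:
  assumes "norm w \<le> R" "\<bar>of_int n\<bar> * Im \<tau> \<ge> R + 1"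
  shows "norm (1 - exp (2 * pi * \<i> * w) * qpow \<tau> (of_int n)) \<ge> 1/2"
proof -
  define t where "t = Im w + of_int n * Im \<tau>"
  have n: "norm (exp (2 * pi * \<i> * w) * qpow \<tau> (of_int n)) = exp (- (2 * pi * t))"
    by (simp add: qpow_def norm_mult t_def algebra_simps flip: exp_add)
  have e: "exp (2 * pi * s) \<ge> 2" if "s \<ge> 1" for s :: real
  proof -
    have "2 \<le> 1 + 2 * 3 * (1::real)" by simp
    also have "\<dots> \<le> 1 + 2 * pi * s" using that pi_gt3 by (intro add_left_mono mult_mono) auto
    also have "\<dots> \<le> exp (2 * pi * s)" by (rule exp_ge_add_one_self)
    finally show ?thesis .
  qed
  have "\<bar>Im w\<bar> \<le> R" using assms(1) abs_Im_le_cmod order_trans by blast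
  moreover have "\<bar>of_int n * Im \<tau>\<bar> \<ge> R + 1" using assms(2) tau by (simp add: abs_mult)
  ultimately have "t \<ge> 1 \<or> - t \<ge> 1" unfolding t_def by linarith
  thus ?thesis
  proof
    assume "t \<ge> 1"
    hence "exp (- (2 * pi * t)) \<le> 1 / 2" using e[of t] by (simp add: exp_minus field_simps)
    thus ?thesis using norm_triangle_ineq2[of 1 "exp (2 * pi * \<i> * w) * qpow \<tau> (of_int n)"] n by simp
  next
    assume "- t \<ge> 1"
    hence "exp (- (2 * pi * t)) \<ge> 2" using e[of "- t"] by simp
    thus ?thesis using norm_triangle_ineq3[of 1 "exp (2 * pi * \<i> * w) * qpow \<tau> (of_int n)"] n by simp
  qed
qed

text \<open>Far indices are bounded below by 1/2; the finitely many others contribute a minimum of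
  nonzero moduli.\<close>

lemma appell_denominator_bound:
  assumes "w \<notin> lattice \<tau>"
  obtains c where "c > 0" "\<And>n. norm (1 - exp (2 * pi * \<i> * w) * qpow \<tau> (of_int n)) \<ge> c"
proof -
  obtain M :: nat where M: "real M * Im \<tau> \<ge> norm w + 1"
    using tau by (metis reals_Archimedean3 less_eq_real_def)
  define f where "f n = norm (1 - exp (2 * pi * \<i> * w) * qpow \<tau> (of_int n))" for n
  define c where "c = min (1/2) (Min (f ` {- int M..int M}))"
  have "f n > 0" for n
    unfolding f_def using exp_times_qpow_neq_1[OF tau assms, of n] by simp
  hence "c > 0" unfolding c_def by (subst min_less_iff_conj, subst Min_gr_iff) auto
  moreover have "f n \<ge> c" for n
  proof (cases "n \<in> {- int M..int M}")
    case True
    hence "Min (f ` {- int M..int M}) \<le> f n" by (intro Min_le) auto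
    thus ?thesis unfolding c_def by linarith
  next
    case False
    hence "\<bar>of_int n\<bar> \<ge> real M" by auto
    hence "\<bar>of_int n\<bar> * Im \<tau> \<ge> norm w + 1"
      using M tau by (meson mult_right_mono less_imp_le order_trans)
    from appell_denominator_far[OF order_refl this] show ?thesis unfolding c_def f_def by linarith
  qed
  ultimately show ?thesis using that unfolding f_def by blast
qed

lemma summable_mu:
  assumes "w \<notin> lattice \<tau>"
  shows "(\<lambda>n. 1 / (1 - exp (2 * pi * \<i> * w) * qpow \<tau> (of_int (\<Sum>j=1..N. n j)))
      * (\<Prod>j=1..N. mu_coeff \<tau> (v j) (n j))) summable_on Zvec {1..N}"
proof -
  obtain c where c: "c > 0" "\<And>n. norm (1 - exp (2 * pi * \<i> * w) * qpow \<tau> (of_int n)) \<ge> c"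
    using appell_denominator_bound[OF assms] by blast
  have "(\<lambda>n. 1 / c * norm (\<Prod>j=1..N. mu_coeff \<tau> (v j) (n j))) summable_on Zvec {1..N}"
    by (intro summable_on_cmult_right summable_on_prod_Zvec summable_mu_coeff tau)
  thus ?thesis
    by (rule abs_summable_summable[OF summable_on_comparison_test])
       (use c exp_times_qpow_neq_1[OF tau assms] in \<open>auto simp: norm_mult norm_divide simp del: of_int_sum intro!: mult_right_mono divide_left_mono mult_pos_pos\<close>)
qed

text \<open>The shift is by N periods since lowering all N indices by one changes the sum of the
  entries by N and so restores the denominator. The extra summand is a product of N one-dimensional
  theta sums, each contributing -i exp (-pi i \<open>u j\<close>) q^(-1/8).\<close>

lemma mu_add_nat_tau:
  assumes u: "u 0 \<notin> lattice \<tau>" "\<And>j. j \<in> {1..N} \<Longrightarrow> theta (u j) \<tau> \<noteq> 0"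
    and u': "u' 0 = u 0 + of_nat N * \<tau>" "\<And>j. j \<in> {1..N} \<Longrightarrow> u' j = u j"
  defines "S \<equiv> \<Sum>j=0..N. u j"
  shows "mu N u' \<tau> = (-1) ^ N * qpow \<tau> (of_nat N / 2) * exp (2 * pi * \<i> * S) *
     (mu N u \<tau> + (- \<i>) ^ N * exp (- pi * \<i> * S) * qpow \<tau> (- of_nat N / 8))"
proof -
  define x where "x = exp (2 * pi * \<i> * u 0)"
  define P where "P n = (\<Prod>j=1..N. mu_coeff \<tau> (u j) (n j))" for n
  define s where "s n = (\<Sum>j=1..N. n j)" for n :: "nat \<Rightarrow> int"
  define d where "d = (\<lambda>j. if j \<in> {1..N} then -1 else 0 :: int)"
  define S' where "S' = (\<Sum>j=1..N. u j)"
  have S: "S = u 0 + S'" by (simp add: S_def S'_def sum.atLeast_Suc_atMost)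
  define C where "C = exp (pi * \<i> * (u 0 + of_nat N * \<tau>)) * ((-1) ^ N * exp (2 * pi * \<i> * S'))"
  have "(\<Sum>j=1..N. d j) = (\<Sum>j=1..N. - 1)" by (rule sum.cong) (auto simp: d_def)
  hence s: "s (\<lambda>j. n j + d j) = s n - int N" for n
    by (simp add: s_def sum.distrib)
  have qP: "(\<Prod>j=1..N. qpow \<tau> (- of_int (n j)) * mu_coeff \<tau> (u j) (n j)) = qpow \<tau> (- of_int (s n)) * P n" for n
  proof -
    have "(\<Prod>j=1..N. qpow \<tau> (- of_int (n j))) = exp (\<Sum>j=1..N. 2 * pi * \<i> * (- of_int (n j)) * \<tau>)"
      by (simp only: exp_sum finite_atLeastAtMost qpow_def)
    also have "\<dots> = qpow \<tau> (- of_int (s n))"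
      by (simp add: s_def qpow_def sum_distrib_left sum_distrib_right sum_negf)
    finally show ?thesis by (simp add: prod.distrib P_def)
  qed
  have "mu N u' \<tau> = (\<Sum>\<^sub>\<infinity>n\<in>Zvec {1..N}. exp (pi * \<i> * u' 0) /
         (1 - exp (2 * pi * \<i> * u' 0) * qpow \<tau> (of_int (s (\<lambda>j. n j + d j)))) *
         (\<Prod>j=1..N. mu_coeff \<tau> (u' j) (n j + d j)))"
    unfolding mu_altdef s_def by (rule Zvec_shift) (simp add: d_def Zvec_def)
  also have "\<dots> = (\<Sum>\<^sub>\<infinity>n\<in>Zvec {1..N}. C * (qpow \<tau> (- of_int (s n)) * P n + x * (1 / (1 - x * qpow \<tau> (of_int (s n))) * P n)))"
  proof (rule infsum_cong)
    fix n
    have "(\<Prod>j=1..N. mu_coeff \<tau> (u' j) (n j + d j))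
      = (\<Prod>j=1..N. - exp (2 * pi * \<i> * u j) * (qpow \<tau> (- of_int (n j)) * mu_coeff \<tau> (u j) (n j)))"
      by (rule prod.cong) (auto simp: u' d_def mu_coeff_pred)
    also have "\<dots> = (\<Prod>j=1..N. - 1) * (\<Prod>j=1..N. exp (2 * pi * \<i> * u j)) * (\<Prod>j=1..N. qpow \<tau> (- of_int (n j)) * mu_coeff \<tau> (u j) (n j))"
      unfolding prod.distrib [symmetric] by (rule prod.cong) auto
    also have "(\<Prod>j=1..N. exp (2 * pi * \<i> * u j)) = exp (2 * pi * \<i> * S')"
      by (simp add: S'_def exp_sum sum_distrib_left)
    also note qP
    also have "(\<Prod>j=1..N. - 1) = (- 1 :: complex) ^ N" by simp
    finally have 1: "(\<Prod>j=1..N. mu_coeff \<tau> (u' j) (n j + d j)) = (-1) ^ N * exp (2 * pi * \<i> * S') * (qpow \<tau> (- of_int (s n)) * P n)" .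
    have 2: "exp (2 * pi * \<i> * u' 0) * qpow \<tau> (of_int (s (\<lambda>j. n j + d j))) = x * qpow \<tau> (of_int (s n))"
      unfolding s u' x_def qpow_def exp_add [symmetric] by (simp add: algebra_simps)
    have "x * qpow \<tau> (of_int (s n)) \<noteq> 1"
      unfolding x_def by (rule exp_times_qpow_neq_1[OF tau u(1)])
    moreover have "qpow \<tau> (- of_int (s n)) * qpow \<tau> (of_int (s n)) = 1"
      by (simp flip: qpow_add) (simp add: qpow_def)
    hence "qpow \<tau> (- of_int (s n)) = qpow \<tau> (- of_int (s n)) * (1 - x * qpow \<tau> (of_int (s n))) + x"
      by (simp add: right_diff_distrib)
    hence "qpow \<tau> (- of_int (s n)) / (1 - x * qpow \<tau> (of_int (s n)))
      = (qpow \<tau> (- of_int (s n)) * (1 - x * qpow \<tau> (of_int (s n))) + x) / (1 - x * qpow \<tau> (of_int (s n)))"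
      by (rule arg_cong)
    ultimately have 3: "qpow \<tau> (- of_int (s n)) / (1 - x * qpow \<tau> (of_int (s n))) = qpow \<tau> (- of_int (s n)) + x * (1 / (1 - x * qpow \<tau> (of_int (s n))))"
      by (simp add: add_divide_distrib)
    have "exp (pi * \<i> * u' 0) / (1 - exp (2 * pi * \<i> * u' 0) * qpow \<tau> (of_int (s (\<lambda>j. n j + d j)))) *
         (\<Prod>j=1..N. mu_coeff \<tau> (u' j) (n j + d j))
       = C * (qpow \<tau> (- of_int (s n)) / (1 - x * qpow \<tau> (of_int (s n))) * P n)"
      unfolding 1 2 unfolding C_def u' by simp
    thus "exp (pi * \<i> * u' 0) / (1 - exp (2 * pi * \<i> * u' 0) * qpow \<tau> (of_int (s (\<lambda>j. n j + d j)))) *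
         (\<Prod>j=1..N. mu_coeff \<tau> (u' j) (n j + d j))
       = C * (qpow \<tau> (- of_int (s n)) * P n + x * (1 / (1 - x * qpow \<tau> (of_int (s n))) * P n))"
      unfolding 3 by (simp add: algebra_simps)
  qed
  also have "\<dots> = C * ((\<Sum>\<^sub>\<infinity>n\<in>Zvec {1..N}. qpow \<tau> (- of_int (s n)) * P n) + x * (\<Sum>\<^sub>\<infinity>n\<in>Zvec {1..N}. 1 / (1 - x * qpow \<tau> (of_int (s n))) * P n))"
  proof -
    have "(\<lambda>n. \<Prod>j=1..N. qpow \<tau> (- of_int (n j)) * mu_coeff \<tau> (u j) (n j)) summable_on Zvec {1..N}"
      by (rule abs_summable_summable) (intro summable_on_prod_Zvec summable_qpow_mu_coeff tau)
    hence 1: "(\<lambda>n. qpow \<tau> (- of_int (s n)) * P n) summable_on Zvec {1..N}"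
      unfolding qP .
    have 2: "(\<lambda>n. 1 / (1 - x * qpow \<tau> (of_int (s n))) * P n) summable_on Zvec {1..N}"
      unfolding x_def s_def P_def by (rule summable_mu[OF u(1)])
    show ?thesis
      unfolding infsum_cmult_right' infsum_add[OF 1 summable_on_cmult_right[OF 2]] ..
  qed
  also have "(\<Sum>\<^sub>\<infinity>n\<in>Zvec {1..N}. qpow \<tau> (- of_int (s n)) * P n) = (- \<i>) ^ N * exp (- pi * \<i> * S') * qpow \<tau> (- of_nat N / 8)"
  proof -
    have "(\<Sum>\<^sub>\<infinity>n\<in>Zvec {1..N}. qpow \<tau> (- of_int (s n)) * P n) = (\<Prod>j=1..N. \<Sum>\<^sub>\<infinity>k. qpow \<tau> (- of_int k) * mu_coeff \<tau> (u j) k)"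
      unfolding qP [symmetric] by (intro infsum_prod_Zvec summable_qpow_mu_coeff tau)
    also have "\<dots> = (\<Prod>j=1..N. - \<i> * exp (- pi * \<i> * u j) * qpow \<tau> (- 1 / 8))"
      by (intro prod.cong refl infsum_qpow_mu_coeff u)
    also have "\<dots> = (- \<i>) ^ N * exp (\<Sum>j=1..N. - pi * \<i> * u j) * qpow \<tau> (- 1 / 8) ^ N"
      by (simp only: prod.distrib exp_sum finite_atLeastAtMost prod_constant card_atLeastAtMost diff_Suc_1)
    also have "(\<Sum>j=1..N. - pi * \<i> * u j) = - pi * \<i> * S'"
      unfolding S'_def by (simp add: sum_distrib_left)
    finally show ?thesis by (simp add: qpow_power)
  qed
  also have "(\<Sum>\<^sub>\<infinity>n\<in>Zvec {1..N}. 1 / (1 - x * qpow \<tau> (of_int (s n))) * P n) = exp (- pi * \<i> * u 0) * mu N u \<tau>"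
  proof -
    have "mu N u \<tau> = exp (pi * \<i> * u 0) * (\<Sum>\<^sub>\<infinity>n\<in>Zvec {1..N}. 1 / (1 - x * qpow \<tau> (of_int (s n))) * P n)"
      unfolding mu_altdef infsum_cmult_right' [symmetric] x_def s_def P_def by (rule infsum_cong) simp
    moreover have "exp (- pi * \<i> * u 0) * exp (pi * \<i> * u 0) = 1"
      by (simp flip: exp_add)
    ultimately show ?thesis by (simp only: mult.assoc [symmetric] mult_1_left)
  qed
  also have "C * ((- \<i>) ^ N * exp (- pi * \<i> * S') * qpow \<tau> (- of_nat N / 8) + x * (exp (- pi * \<i> * u 0) * mu N u \<tau>))
    = (-1) ^ N * qpow \<tau> (of_nat N / 2) * exp (2 * pi * \<i> * S) *
     (mu N u \<tau> + (- \<i>) ^ N * exp (- pi * \<i> * S) * qpow \<tau> (- of_nat N / 8))"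
  proof -
    \<comment> \<open>All exponentials of the arguments are monomials in a and b, which reduces the
      claim to polynomial algebra.\<close>
    define a b where "a = exp (pi * \<i> * u 0)" and "b = exp (pi * \<i> * S')"
    have [simp]: "a \<noteq> 0" "b \<noteq> 0" by (simp_all add: a_def b_def)
    have sq: "exp (2 * pi * \<i> * y) = (exp (pi * \<i> * y))\<^sup>2" for y
      unfolding power2_eq_square exp_add [symmetric] by (rule arg_cong[of _ _ exp]) simp
    have "exp (pi * \<i> * (u 0 + of_nat N * \<tau>)) = a * qpow \<tau> (of_nat N / 2)"
      unfolding a_def qpow_def exp_add [symmetric] by (rule arg_cong[of _ _ exp]) (simp add: algebra_simps)
    hence C: "C = a * qpow \<tau> (of_nat N / 2) * ((-1) ^ N * b\<^sup>2)"
      by (simp only: C_def b_def sq)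
    have e: "x = a\<^sup>2" "exp (- pi * \<i> * S') = inverse b" "exp (- pi * \<i> * u 0) = inverse a"
      "exp (2 * pi * \<i> * S) = (a * b)\<^sup>2" "exp (- pi * \<i> * S) = inverse a * inverse b"
      unfolding x_def sq S a_def b_def exp_minus [symmetric] exp_add [symmetric]
      by (simp_all add: algebra_simps)
    have "C * (A * inverse b * D + x * (inverse a * E)) = (-1) ^ N * qpow \<tau> (of_nat N / 2) * (a * b)\<^sup>2 * (E + A * (inverse a * inverse b) * D)" for A D E
    proof -
      have "C * (A * inverse b * D + x * (inverse a * E))
        = (-1) ^ N * qpow \<tau> (of_nat N / 2) * ((a * b) * (b * inverse b) * A * D + (a * inverse a) * a\<^sup>2 * b\<^sup>2 * E)"
        unfolding C e by (simp only: power2_eq_square ring_distribs mult_ac)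
      also have "\<dots> = (-1) ^ N * qpow \<tau> (of_nat N / 2) * ((a * b)\<^sup>2 * E + (a * inverse a) * (b * inverse b) * (a * b) * A * D)"
        by (simp add: power_mult_distrib)
      also have "\<dots> = (-1) ^ N * qpow \<tau> (of_nat N / 2) * (a * b)\<^sup>2 * (E + A * (inverse a * inverse b) * D)"
        by (simp only: power2_eq_square ring_distribs mult_ac)
      finally show ?thesis .
    qed
    thus ?thesis unfolding e .
  qed
  finally show ?thesis .
qed

end

section \<open>The function \<open>\<mu>\<^sub>1\<close>\<close>

text \<open>An Appell-Lerch sum: up to the sign and the substitution v -> -v this is Zwegers'
  two-variable \<mu>-function.\<close>

definition mu1 :: "complex \<Rightarrow> complex \<Rightarrow> complex \<Rightarrow> complex" where
  "mu1 \<tau> w v = (\<Sum>\<^sub>\<infinity>k::int. exp (pi * \<i> * w) / (1 - exp (2 * pi * \<i> * w) * qpow \<tau> (of_int k)) * mu_coeff \<tau> v k)"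

lemma mu_1_eq_mu1: "mu (Suc 0) u \<tau> = mu1 \<tau> (u 0) (u 1)"
proof -
  have bij: "bij_betw (\<lambda>a. (a, \<lambda>_. 0)) (UNIV :: int set) (UNIV \<times> Zvec {1..0})"
    unfolding Zvec_0 by (rule bij_betwI[where g = fst]) auto
  show ?thesis
    unfolding mu_altdef infsum_Zcons case_prod_unfold
    by (subst infsum_reindex_bij_betw[OF bij, symmetric]) (simp add: mu1_def)
qed

lemma mu1_add_1: "mu1 \<tau> (w + 1) v = - mu1 \<tau> w v"
  using mu_add_1[of "\<lambda>j. if j = 0 then w + 1 else v" "\<lambda>j. if j = 0 then w else v" "Suc 0" \<tau>]
  by (simp add: mu_1_eq_mu1)

lemma mu1_add_1_right: "mu1 \<tau> w (v + 1) = - mu1 \<tau> w v"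
  unfolding mu1_def by (simp add: mu_coeff_add_1 infsum_uminus)

lemma mu1_shift_int_tau: "mu1 \<tau> (w - of_int b * \<tau>) (v + of_int b * \<tau>) = mu1 \<tau> w v"
  using mu_shift[of "\<lambda>j. if j = 1 then b else 0" "Suc 0"
      "\<lambda>j. if j = 0 then w - of_int b * \<tau> else v + of_int b * \<tau>" "\<lambda>j. if j = 0 then w else v" \<tau>]
  by (simp add: mu_1_eq_mu1 Zvec_def)

text \<open>Stated for arbitrary predicates because it transports zeros of theta, values of
  functions and the existence of limits along periods alike.\<close>

lemma int_shift_invariant:
  fixes \<omega> :: "'a::ring_1"
  assumes "\<And>p. P p \<longleftrightarrow> P (p + \<omega>)"
  shows "P p \<longleftrightarrow> P (p + of_int a * \<omega>)"
proof (induction a rule: int_induct[where k = 0])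
  case (step1 i)
  thus ?case using assms[of "p + of_int i * \<omega>"] by (simp add: algebra_simps)
next
  case (step2 i)
  thus ?case using assms[of "p + of_int (i - 1) * \<omega>"] by (simp add: algebra_simps)
qed auto

section \<open>The period lattice\<close>

lemma lattice_uminus [simp]: "- x \<in> lattice \<tau> \<longleftrightarrow> x \<in> lattice \<tau>"
proof -
  have "- x \<in> lattice \<tau>" if "x \<in> lattice \<tau>" for x
  proof -
    from that obtain a b where "x = of_int a + of_int b * \<tau>" by (auto simp: lattice_def)
    hence "- x = of_int (- a) + of_int (- b) * \<tau>" by simp
    thus ?thesis unfolding lattice_def by blast
  qed
  from this[of x] this[of "- x"] show ?thesis by auto
qed

lemma lattice_add_iff:
  assumes "y \<in> lattice \<tau>"
  shows "x + y \<in> lattice \<tau> \<longleftrightarrow> x \<in> lattice \<tau>"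
proof -
  have add: "x + y \<in> lattice \<tau>" if "x \<in> lattice \<tau>" "y \<in> lattice \<tau>" for x y
  proof -
    from that obtain a b c d where "x = of_int a + of_int b * \<tau>" "y = of_int c + of_int d * \<tau>"
      by (auto simp: lattice_def)
    hence "x + y = of_int (a + c) + of_int (b + d) * \<tau>" by (simp add: algebra_simps)
    thus ?thesis unfolding lattice_def by blast
  qed
  from add[of x y] add[of "x + y" "- y"] assms show ?thesis by auto
qed

lemma int_tau_in_lattice [simp]: "of_int b * \<tau> \<in> lattice \<tau>" "\<tau> \<in> lattice \<tau>"
  and int_in_lattice [simp]: "of_int b \<in> lattice \<tau>" "1 \<in> lattice \<tau>"
proof -
  have *: "of_int a + of_int b * \<tau> \<in> lattice \<tau>" for a b unfolding lattice_def by blast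
  from *[of 0 b] *[of 0 1] *[of b 0] *[of 1 0]
  show "of_int b * \<tau> \<in> lattice \<tau>" "\<tau> \<in> lattice \<tau>" "of_int b \<in> lattice \<tau>" "1 \<in> lattice \<tau>" by simp_all
qed

lemma theta_lattice:
  assumes "u \<in> lattice \<tau>"
  shows "theta u \<tau> = 0"
proof -
  from assms obtain a b where u: "u = of_int a + of_int b * \<tau>" by (auto simp: lattice_def)
  have "theta 0 \<tau> = 0 \<longleftrightarrow> theta (0 + of_int a * 1) \<tau> = 0"
    by (rule int_shift_invariant) (simp add: theta_add_1)
  thus ?thesis unfolding u theta_add_int_tau by simp
qed

context
  fixes \<tau> :: complex
  assumes tau: "Im \<tau> > 0"
begin

lemma theta_eq_0_iff: "theta u \<tau> = 0 \<longleftrightarrow> u \<in> lattice \<tau>"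
  using theta_nonzero[OF tau] theta_lattice by blast

text \<open>Provides a point where theta does not vanish, so that its zeros, the lattice points, are
  isolated.\<close>

lemma half_not_in_lattice: "1/2 \<notin> lattice \<tau>"
proof
  assume "1/2 \<in> lattice \<tau>"
  then obtain a b where ab: "1/2 = of_int a + of_int b * \<tau>" by (auto simp: lattice_def)
  from arg_cong[OF ab, of Im] tau have "b = 0" by simp
  with arg_cong[OF ab, of Re] have "2 * real_of_int a = 1" by simp
  hence "of_int (2 * a) = (of_int 1 :: real)" by simp
  hence "2 * a = 1" by (simp only: of_int_eq_iff)
  thus False by presburger
qed

lemma eventually_not_in_lattice: "eventually (\<lambda>w. w - c \<notin> lattice \<tau>) (at p)"
proof -
  have "\<forall>\<^sub>F w in at p. theta (w - c) \<tau> \<noteq> 0 \<and> w \<in> UNIV"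
    by (rule non_zero_neighbour_alt[where \<beta> = "c + 1/2"])
       (auto intro!: holomorphic_theta[OF tau] holomorphic_intros simp: theta_eq_0_iff half_not_in_lattice)
  thus ?thesis by eventually_elim (simp add: theta_eq_0_iff)
qed

section \<open>Quasi-periodicity and poles of \<mu>_1\<close>

lemma mu1_add_tau:
  assumes "w \<notin> lattice \<tau>" "v \<notin> lattice \<tau>"
  shows "mu1 \<tau> (w + \<tau>) v = - exp (2 * pi * \<i> * (w + v) + pi * \<i> * \<tau>) *
    (mu1 \<tau> w v - \<i> * exp (- pi * \<i> * (w + v)) * qpow \<tau> (- 1 / 8))"
proof -
  have "mu1 \<tau> (w + \<tau>) v = - (qpow \<tau> (1 / 2) * exp (2 * pi * \<i> * (w + v))) *
    (mu1 \<tau> w v - \<i> * exp (- pi * \<i> * (w + v)) * qpow \<tau> (- 1 / 8))"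
    using mu_add_nat_tau[OF tau, of "\<lambda>j. if j = 0 then w else v" "Suc 0" "\<lambda>j. if j = 0 then w + \<tau> else v"] assms
    by (simp add: mu_1_eq_mu1 theta_eq_0_iff)
  also have "qpow \<tau> (1 / 2) * exp (2 * pi * \<i> * (w + v)) = exp (2 * pi * \<i> * (w + v) + pi * \<i> * \<tau>)"
    unfolding qpow_def exp_add [symmetric] by (rule arg_cong[of _ _ exp]) simp
  finally show ?thesis by simp
qed

text \<open>On a given disc all but finitely many denominators are at least 1/2 in modulus, so the
  tail converges uniformly to a holomorphic function and every pole sits in the finite part. The
  index 0 is kept there because it carries the pole at w = 0.\<close>

lemma mu1_local:
  obtains A g where "finite A" "(0::int) \<in> A" "g holomorphic_on ball 0 R"
    "\<And>w. w \<in> ball 0 R \<Longrightarrow> mu1 \<tau> w v = (\<Sum>k\<in>A. exp (pi * \<i> * w) /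
        (1 - exp (2 * pi * \<i> * w) * qpow \<tau> (of_int k)) * mu_coeff \<tau> v k) + g w"
proof -
  define t where "t = (\<lambda>k w. exp (pi * \<i> * w) / (1 - exp (2 * pi * \<i> * w) * qpow \<tau> (of_int k)) * mu_coeff \<tau> v k)"
  obtain M :: nat where M: "real M * Im \<tau> \<ge> R + 1"
    using tau by (metis reals_Archimedean3 less_eq_real_def)
  define A where "A = {- int M..int M}"
  define g where "g w = infsum (\<lambda>k. t k w) (- A)" for w
  have far: "norm (1 - exp (2 * pi * \<i> * w) * qpow \<tau> (of_int k)) \<ge> 1/2" if "k \<in> - A" "w \<in> cball 0 R" for k w
  proof (rule appell_denominator_far[OF tau])
    from that have "\<bar>of_int k\<bar> \<ge> real M" by (auto simp: A_def)
    thus "\<bar>of_int k\<bar> * Im \<tau> \<ge> R + 1"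
      using M tau by (meson mult_right_mono less_imp_le order_trans)
    show "norm w \<le> R" using that by simp
  qed
  have bound: "norm (t k w) \<le> exp (pi * R) / (1/2) * norm (mu_coeff \<tau> v k)" if "k \<in> - A" "w \<in> cball 0 R" for k w
  proof -
    have "norm (exp (pi * \<i> * w)) \<le> exp (pi * R)"
    proof -
      have "- Im w \<le> R" using that(2) abs_Im_le_cmod[of w] by simp
      from mult_left_mono[OF this pi_ge_zero] show ?thesis by simp
    qed
    thus ?thesis unfolding t_def norm_mult norm_divide
      using far[OF that] by (intro mult_right_mono frac_le) auto
  qed
  have sm: "(\<lambda>k. exp (pi * R) / (1/2) * norm (mu_coeff \<tau> v k)) summable_on UNIV"
    by (intro summable_on_cmult_right summable_mu_coeff tau)
  hence sm': "(\<lambda>k. exp (pi * R) / (1/2) * norm (mu_coeff \<tau> v k)) summable_on - A"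
    by (rule summable_on_subset_banach) auto
  have summ: "(\<lambda>k. t k w) summable_on - A" if "w \<in> cball 0 R" for w
    by (rule abs_summable_summable, rule summable_on_comparison_test[OF sm']) (use bound that in auto)
  have ul: "uniform_limit (cball 0 R) (\<lambda>X w. \<Sum>k\<in>X. t k w) g (finite_subsets_at_top (- A))"
    unfolding g_def by (rule Weierstrass_m_test_general[OF bound sm'])
  have ev: "\<forall>\<^sub>F X in finite_subsets_at_top (- A). continuous_on (cball 0 R) (\<lambda>w. \<Sum>k\<in>X. t k w) \<and>
      (\<lambda>w. \<Sum>k\<in>X. t k w) holomorphic_on ball 0 R"
  proof (rule eventually_finite_subsets_at_top_weakI)
    fix X assume "finite X" "X \<subseteq> - A"
    hence nz: "1 - exp (2 * pi * \<i> * w) * qpow \<tau> (of_int k) \<noteq> 0" if "k \<in> X" "w \<in> cball 0 R" for k w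
      using far[of k w] that by auto
    have "(\<lambda>w. \<Sum>k\<in>X. t k w) holomorphic_on cball 0 R"
      unfolding t_def by (intro holomorphic_intros) (use nz in auto)
    thus "continuous_on (cball 0 R) (\<lambda>w. \<Sum>k\<in>X. t k w) \<and> (\<lambda>w. \<Sum>k\<in>X. t k w) holomorphic_on ball 0 R"
      by (auto intro: holomorphic_on_imp_continuous_on holomorphic_on_subset)
  qed
  have "g holomorphic_on ball 0 R"
    by (rule holomorphic_uniform_limit[OF ev ul]) auto
  moreover have "mu1 \<tau> w v = (\<Sum>k\<in>A. t k w) + g w" if "w \<in> ball 0 R" for w
  proof -
    have "mu1 \<tau> w v = infsum (\<lambda>k. t k w) (A \<union> - A)"
      unfolding mu1_def t_def by simp
    also have "\<dots> = infsum (\<lambda>k. t k w) A + g w"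
      unfolding g_def by (rule infsum_Un_disjoint) (use that summ in \<open>auto simp: A_def\<close>)
    finally show ?thesis by (simp add: A_def)
  qed
  ultimately show ?thesis
    by (intro that[of A g]) (auto simp: A_def t_def)
qed

lemma mu1_analytic:
  assumes "w \<notin> lattice \<tau>"
  shows "(\<lambda>w. mu1 \<tau> w v) analytic_on {w}"
proof -
  obtain A g where A: "finite A" "(0::int) \<in> A" "g holomorphic_on ball 0 (norm w + 1)"
    "\<And>x. x \<in> ball 0 (norm w + 1) \<Longrightarrow> mu1 \<tau> x v = (\<Sum>k\<in>A. exp (pi * \<i> * x) /
        (1 - exp (2 * pi * \<i> * x) * qpow \<tau> (of_int k)) * mu_coeff \<tau> v k) + g x"
    by (rule mu1_local) (rule that)
  have "g analytic_on {w}"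
    using A(3) by (rule holomorphic_on_imp_analytic_at) auto
  hence h: "(\<lambda>x. (\<Sum>k\<in>A. exp (pi * \<i> * x) /
        (1 - exp (2 * pi * \<i> * x) * qpow \<tau> (of_int k)) * mu_coeff \<tau> v k) + g x) analytic_on {w}"
    by (intro analytic_intros) (use exp_times_qpow_neq_1[OF tau assms] in auto)
  have "\<forall>\<^sub>F x in nhds w. x \<in> ball 0 (norm w + 1)"
    by (rule eventually_nhds_in_open) auto
  hence ev: "\<forall>\<^sub>F x in nhds w. mu1 \<tau> x v = (\<Sum>k\<in>A. exp (pi * \<i> * x) /
        (1 - exp (2 * pi * \<i> * x) * qpow \<tau> (of_int k)) * mu_coeff \<tau> v k) + g x"
    by eventually_elim (rule A(4))
  show ?thesis using h unfolding analytic_at_cong[OF ev refl] .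
qed

lemma mu1_meromorphic: "(\<lambda>w. mu1 \<tau> w v) meromorphic_on UNIV"
proof -
  have "(\<lambda>w. mu1 \<tau> w v) meromorphic_on {w}" for w
  proof -
    obtain A g where A: "finite A" "(0::int) \<in> A" "g holomorphic_on ball 0 (norm w + 1)"
      "\<And>x. x \<in> ball 0 (norm w + 1) \<Longrightarrow> mu1 \<tau> x v = (\<Sum>k\<in>A. exp (pi * \<i> * x) /
          (1 - exp (2 * pi * \<i> * x) * qpow \<tau> (of_int k)) * mu_coeff \<tau> v k) + g x"
      by (rule mu1_local) (rule that)
    have "g analytic_on {w}"
      using A(3) by (rule holomorphic_on_imp_analytic_at) auto
    hence h: "(\<lambda>x. (\<Sum>k\<in>A. exp (pi * \<i> * x) /
          (1 - exp (2 * pi * \<i> * x) * qpow \<tau> (of_int k)) * mu_coeff \<tau> v k) + g x) meromorphic_on {w}"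
      by (intro meromorphic_intros analytic_on_imp_meromorphic_on[of "\<lambda>x. exp (f x)" for f]
          analytic_on_imp_meromorphic_on[of g] analytic_intros)
    have "\<forall>\<^sub>F x in at w. x \<in> ball 0 (norm w + 1)"
      by (rule eventually_at_in_open') auto
    hence ev: "\<forall>\<^sub>F x in at w. mu1 \<tau> x v = (\<Sum>k\<in>A. exp (pi * \<i> * x) /
          (1 - exp (2 * pi * \<i> * x) * qpow \<tau> (of_int k)) * mu_coeff \<tau> v k) + g x"
      by eventually_elim (rule A(4))
    show ?thesis
      by (rule iffD2[OF meromorphic_on_cong[OF _ refl] h]) (use ev in auto)
  qed
  from meromorphic_on_UN[of UNIV _ "\<lambda>w. {w}", OF this] show ?thesis by simp
qed

text \<open>Only the term k = 0 has a pole at 0, because |q^k| differs from 1 for other k. Its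
  residue is -1 / (2 pi i theta(v)).\<close>

lemma mu1_residue_0: "((\<lambda>w. w * mu1 \<tau> w v) \<longlongrightarrow> \<i> / (2 * pi * theta v \<tau>)) (at 0)"
proof -
  obtain A g where A: "finite A" "(0::int) \<in> A" "g holomorphic_on ball 0 1"
    "\<And>x. x \<in> ball 0 1 \<Longrightarrow> mu1 \<tau> x v = (\<Sum>k\<in>A. exp (pi * \<i> * x) /
        (1 - exp (2 * pi * \<i> * x) * qpow \<tau> (of_int k)) * mu_coeff \<tau> v k) + g x"
    by (rule mu1_local) (rule that)
  define t where "t = (\<lambda>k w. exp (pi * \<i> * w) / (1 - exp (2 * pi * \<i> * w) * qpow \<tau> (of_int k)) * mu_coeff \<tau> v k)"
  have "isCont g 0" using A(3) by (meson centre_in_ball continuous_on_eq_continuous_at holomorphic_on_imp_continuous_on open_ball zero_less_one)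
  hence g: "(g \<longlongrightarrow> g 0) (at 0)" by (simp add: isCont_def)
  have "((\<lambda>w. 1 - exp (2 * pi * \<i> * w)) has_field_derivative - (2 * pi * \<i>)) (at 0)"
    by (auto intro!: derivative_eq_intros)
  hence d: "((\<lambda>w. (1 - exp (2 * pi * \<i> * w)) / w) \<longlongrightarrow> - (2 * pi * \<i>)) (at 0)"
    by (simp add: has_field_derivative_iff)
  have "((\<lambda>w. exp (pi * \<i> * w) * mu_coeff \<tau> v 0 / ((1 - exp (2 * pi * \<i> * w)) / w)) \<longlongrightarrow>
     exp (pi * \<i> * 0) * mu_coeff \<tau> v 0 / - (2 * pi * \<i>)) (at 0)"
    by (intro tendsto_intros d) auto
  also have "exp (pi * \<i> * 0) * mu_coeff \<tau> v 0 / - (2 * pi * \<i>) = \<i> / (2 * pi * theta v \<tau>)"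
  proof -
    have "inverse (- (2 * pi * \<i>)) = \<i> / (2 * pi)"
      by (rule inverse_unique) (simp add: field_simps)
    thus ?thesis by (simp only: divide_inverse[of _ "- (2 * pi * \<i>)"]) (simp add: mu_coeff_exp)
  qed
  also have "(\<lambda>w. exp (pi * \<i> * w) * mu_coeff \<tau> v 0 / ((1 - exp (2 * pi * \<i> * w)) / w)) = (\<lambda>w. w * t 0 w)"
    by (rule ext) (simp add: t_def qpow_def)
  finally have t0: "((\<lambda>w. w * t 0 w) \<longlongrightarrow> \<i> / (2 * pi * theta v \<tau>)) (at 0)" .
  have tk: "((\<lambda>w. w * t k w) \<longlongrightarrow> 0 * (exp (pi * \<i> * 0) / (1 - exp (2 * pi * \<i> * 0) * qpow \<tau> (of_int k)) * mu_coeff \<tau> v k)) (at 0)" if "k \<noteq> 0" for k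
  proof -
    have "norm (qpow \<tau> (of_int k)) = exp (- (2 * pi * of_int k * Im \<tau>))" by (simp add: qpow_def)
    hence "norm (qpow \<tau> (of_int k)) \<noteq> 1" using that tau by simp
    hence "qpow \<tau> (of_int k) \<noteq> 1" by auto
    thus ?thesis unfolding t_def by (intro tendsto_intros) auto
  qed
  have lim: "((\<lambda>w. w * t 0 w + (\<Sum>k\<in>A - {0}. w * t k w) + w * g w) \<longlongrightarrow> \<i> / (2 * pi * theta v \<tau>) + (\<Sum>k\<in>A - {0}. 0) + 0 * g 0) (at 0)"
    using tk by (intro tendsto_intros t0 g) auto
  have "\<forall>\<^sub>F x :: complex in at 0. x \<in> ball 0 1"
    by (rule eventually_at_in_open') auto
  hence ev: "\<forall>\<^sub>F x in at 0. x * t 0 x + (\<Sum>k\<in>A - {0}. x * t k x) + x * g x = x * mu1 \<tau> x v"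
  proof eventually_elim
    case (elim x)
    hence "mu1 \<tau> x v = (\<Sum>k\<in>A. t k x) + g x" unfolding t_def by (rule A(4))
    also have "(\<Sum>k\<in>A. t k x) = t 0 x + (\<Sum>k\<in>A - {0}. t k x)"
      using A(1,2) by (rule sum.remove)
    finally show ?case by (simp add: ring_distribs sum_distrib_left)
  qed
  show ?thesis using Lim_transform_eventually[OF lim ev] by simp
qed

end

section \<open>Rigidity of quasi-periodic functions and the translation formula for \<mu>_1\<close>

lemma quasi_periodic_eq_0:
  fixes F :: "complex \<Rightarrow> complex"
  assumes tau: "Im \<tau> > 0"
    and mero: "F meromorphic_on UNIV"
    and lim: "\<And>p. \<exists>c. F \<midarrow>p\<rightarrow> c"
    and per1: "\<And>p. \<forall>\<^sub>F w in at p. F (w + 1) = - F w"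
    and per2: "\<And>p. \<forall>\<^sub>F w in at p. F (w + \<tau>) = - exp (2 * pi * \<i> * (w + v) + pi * \<i> * \<tau>) * F w"
  shows "remove_sings F w = 0"
proof -
  \<comment> \<open>The values of F at its removable singularities are arbitrary, so the functional
    equations are assumed only near each point; they pass to the entire function h by uniqueness of
    limits.\<close>
  define h where "h = remove_sings F"
  have hF: "F \<midarrow>p\<rightarrow> h p" for p
    using lim[of p] remove_sings_eqI unfolding h_def by blast
  have "h analytic_on {p}" for p
    unfolding h_def
  proof (rule remove_sings_analytic_at[OF _ hF])
    show "isolated_singularity_at F p"
      by (rule meromorphic_on_isolated_singularity, rule meromorphic_on_subset[OF mero]) auto
  qed
  hence "h analytic_on UNIV" using analytic_on_analytic_at by blast
  hence hol: "h holomorphic_on UNIV" by (rule analytic_imp_holomorphic)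
  have cont: "isCont h p" for p
    using holomorphic_on_imp_continuous_on[OF hol] by (simp add: continuous_on_eq_continuous_at)
  have h1: "h (p + 1) = - h p" for p
  proof (rule LIM_unique)
    show "(\<lambda>x. F (x + 1)) \<midarrow>p\<rightarrow> h (p + 1)"
      using LIM_offset[OF hF[of "p + 1"], of 1] by simp
    have ev: "\<forall>\<^sub>F x in at p. - F x = F (x + 1)" using per1[of p] by eventually_elim simp
    show "(\<lambda>x. F (x + 1)) \<midarrow>p\<rightarrow> - h p"
      by (rule Lim_transform_eventually[OF tendsto_minus[OF hF] ev])
  qed
  have h2: "h (p + \<tau>) = - exp (2 * pi * \<i> * (p + v) + pi * \<i> * \<tau>) * h p" for p
  proof (rule LIM_unique)
    show "(\<lambda>x. F (x + \<tau>)) \<midarrow>p\<rightarrow> h (p + \<tau>)"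
      using LIM_offset[OF hF[of "p + \<tau>"], of \<tau>] by simp
    have ev: "\<forall>\<^sub>F x in at p. - exp (2 * pi * \<i> * (x + v) + pi * \<i> * \<tau>) * F x = F (x + \<tau>)"
      using per2[of p] by eventually_elim simp
    show "(\<lambda>x. F (x + \<tau>)) \<midarrow>p\<rightarrow> - exp (2 * pi * \<i> * (p + v) + pi * \<i> * \<tau>) * h p"
      by (rule Lim_transform_eventually[OF _ ev]) (intro tendsto_intros hF)
  qed
  \<comment> \<open>The Gaussian weight compensates the growth of the multiplier, so \<open>\<phi>\<close> is doubly periodic
    and therefore bounded; it dominates \<open>norm h\<close>.\<close>
  define \<phi> where "\<phi> p = norm (h p) * exp (pi * (Im (p + v))\<^sup>2 / Im \<tau>)" for p
  have \<phi>1: "\<phi> (p + 1) = \<phi> p" for p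
    by (simp add: \<phi>_def h1)
  have \<phi>2: "\<phi> (p + \<tau>) = \<phi> p" for p
  proof -
    define Y where "Y = Im (p + v)"
    define X where "X = 2 * pi * Y + pi * Im \<tau>"
    have "norm (h (p + \<tau>)) = exp (- X) * norm (h p)"
      unfolding h2 norm_mult norm_minus_cancel norm_exp_eq_Re by (simp add: X_def Y_def algebra_simps)
    moreover have "Im (p + \<tau> + v) = Y + Im \<tau>" by (simp add: Y_def)
    moreover have "pi * (Y + Im \<tau>)\<^sup>2 / Im \<tau> = X + pi * Y\<^sup>2 / Im \<tau>"
      using tau by (simp add: X_def field_simps power2_eq_square)
    ultimately have "\<phi> (p + \<tau>) = (exp (- X) * exp X) * (norm (h p) * exp (pi * Y\<^sup>2 / Im \<tau>))"
      unfolding \<phi>_def by (simp only: exp_add mult_ac)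
    also have "exp (- X) * exp X = 1" by (simp flip: exp_add)
    finally show ?thesis by (simp add: \<phi>_def Y_def)
  qed
  define K where "K = (\<lambda>(s, t). of_real s + of_real t * \<tau>) ` ({0..1} \<times> {0..1::real})"
  have "compact K" unfolding K_def case_prod_unfold
    by (intro compact_continuous_image compact_Times compact_Icc continuous_intros)
  moreover have "continuous_on K \<phi>" unfolding \<phi>_def
    by (intro continuous_intros continuous_at_imp_continuous_on ballI cont) (use tau in auto)
  ultimately have "bounded (\<phi> ` K)"
    by (intro compact_imp_bounded compact_continuous_image)
  then obtain B where B: "\<And>p. p \<in> K \<Longrightarrow> norm (\<phi> p) \<le> B" by (auto simp: bounded_iff)
  have "norm (h p) \<le> B" for p
  proof -
    \<comment> \<open>Coordinates of p in the real basis 1, \<tau>; their fractional parts move p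
      into the closed fundamental parallelogram K.\<close>
    define y where "y = Im p / Im \<tau>"
    define x where "x = Re p - y * Re \<tau>"
    define p0 where "p0 = of_real (frac x) + of_real (frac y) * \<tau>"
    have p: "p = p0 + of_int \<lfloor>x\<rfloor> * 1 + of_int \<lfloor>y\<rfloor> * \<tau>"
      using tau by (simp add: complex_eq_iff p0_def frac_def x_def y_def algebra_simps)
    have "p0 \<in> K" unfolding K_def p0_def
      by (rule image_eqI[of _ _ "(frac x, frac y)"]) (auto simp: less_imp_le[OF frac_lt_1])
    hence "\<phi> p0 \<le> B" using B by fastforce
    moreover have "\<phi> p0 = \<phi> p0 \<longleftrightarrow> \<phi> (p0 + of_int \<lfloor>x\<rfloor> * 1) = \<phi> p0"
      by (rule int_shift_invariant) (simp add: \<phi>1)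
    hence "\<phi> (p0 + of_int \<lfloor>x\<rfloor> * 1) = \<phi> p0" by simp
    moreover have "\<phi> (p0 + of_int \<lfloor>x\<rfloor> * 1) = \<phi> p0 \<longleftrightarrow> \<phi> p = \<phi> p0"
      unfolding p by (rule int_shift_invariant) (simp add: \<phi>2)
    moreover have "norm (h p) * 1 \<le> \<phi> p"
      unfolding \<phi>_def by (intro mult_left_mono) (use tau in auto)
    ultimately show ?thesis by simp
  qed
  hence "bounded (range h)" by (auto simp: bounded_iff)
  from Liouville_theorem[OF hol this] obtain c where c: "\<And>p. h p = c"
    by (auto simp: constant_on_def)
  with h1[of 0] have "c = 0" by simp
  with c show ?thesis by (simp add: h_def)
qed

text \<open>A shift by 1 changes the sign in both arguments, and a shift by \<tau> is an index
  shift. This settles the translation formula for z in the lattice, where its right-hand side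
  vanishes.\<close>

lemma mu1_translate_lattice:
  assumes "z \<in> lattice \<tau>"
  shows "mu1 \<tau> (w - z) (v + z) = mu1 \<tau> w v"
proof -
  from assms obtain a b where z: "z = of_int a + of_int b * \<tau>" by (auto simp: lattice_def)
  have "mu1 \<tau> (w - p) (v + p) = mu1 \<tau> (w - (p + 1)) (v + (p + 1))" for p
    using mu1_add_1[of \<tau> "w - (p + 1)" "v + p"] mu1_add_1_right[of \<tau> "w - (p + 1)" "v + p"]
    by (simp add: algebra_simps)
  hence "mu1 \<tau> (w - 0) (v + 0) = mu1 \<tau> w v \<longleftrightarrow> mu1 \<tau> (w - (0 + of_int a * 1)) (v + (0 + of_int a * 1)) = mu1 \<tau> w v"
    by (intro int_shift_invariant) simp
  hence "mu1 \<tau> (w - of_int a) (v + of_int a) = mu1 \<tau> w v" by simp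
  thus ?thesis using mu1_shift_int_tau[of \<tau> "w - of_int a" b "v + of_int a"]
    by (simp add: z algebra_simps)
qed

text \<open>Riemann's theorem on removable singularities, phrased so that a cancellation of residues
  can be fed in directly.\<close>

lemma tendsto_exists_if_simple_pole_cancels:
  assumes "isolated_singularity_at F p" "((\<lambda>w. (w - p) * F w) \<longlongrightarrow> 0) (at p)"
  shows "\<exists>c. F \<midarrow>p\<rightarrow> c"
proof -
  from assms(1) obtain r where r: "r > 0" "F analytic_on ball p r - {p}"
    by (auto simp: isolated_singularity_at_def)
  hence "F holomorphic_on ball p r - {p}" by (simp add: analytic_imp_holomorphic)
  with assms(2) r obtain g where g: "g holomorphic_on ball p r" "\<And>w. w \<in> ball p r - {p} \<Longrightarrow> g w = F w"
    using holomorphic_on_extend_lim[of F "ball p r" p] by auto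
  have "isCont g p" using g(1) r
    by (meson centre_in_ball continuous_on_eq_continuous_at holomorphic_on_imp_continuous_on open_ball)
  hence "g \<midarrow>p\<rightarrow> g p" by (simp add: isCont_def)
  moreover have "\<forall>\<^sub>F w in at p. g w = F w"
    using eventually_at_in_open[of "ball p r" p] r by (auto elim!: eventually_mono simp: g(2))
  ultimately show ?thesis by (blast intro: Lim_transform_eventually)
qed

lemma eta_nonzero:
  assumes "Im \<tau> > 0"
  shows "eta \<tau> \<noteq> 0"
  using prodinf_qfact_nonzero[OF norm_qpow_1_less_1[OF assms]] by (simp add: eta_def)

lemma theta_pole_0:
  assumes tau: "Im \<tau> > 0"
  shows "((\<lambda>u. u / theta u \<tau>) \<longlongrightarrow> 1 / (- 2 * pi * eta \<tau> ^ 3)) (at 0)"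
proof -
  have "((\<lambda>u. inverse (theta u \<tau> / u)) \<longlongrightarrow> inverse (- 2 * pi * eta \<tau> ^ 3)) (at 0)"
    by (intro tendsto_inverse theta_over_arg_tendsto tau) (use eta_nonzero[OF tau] in auto)
  thus ?thesis by (simp add: inverse_eq_divide)
qed

lemma mu1_translate:
  assumes tau: "Im \<tau> > 0"
    and w: "w \<notin> lattice \<tau>" and v: "v \<notin> lattice \<tau>" and zw: "z - w \<notin> lattice \<tau>" and zv: "z + v \<notin> lattice \<tau>"
  shows "mu1 \<tau> (w - z) (v + z) - mu1 \<tau> w v
    = \<i> * eta \<tau> ^ 3 * theta z \<tau> * theta (z - w + v) \<tau> / (theta (z - w) \<tau> * theta (z + v) \<tau> * (theta w \<tau> * theta v \<tau>))"
proof (cases "z \<in> lattice \<tau>")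
  case True
  thus ?thesis by (simp add: mu1_translate_lattice theta_lattice)
next
  case z: False
  \<comment> \<open>Collects the factors free of w, which is the variable from here on; v and z stay
    fixed.\<close>
  define K where "K = \<i> * eta \<tau> ^ 3 * theta z \<tau> / (theta (z + v) \<tau> * theta v \<tau>)"
  define F where "F = (\<lambda>w. mu1 \<tau> (w - z) (v + z) - mu1 \<tau> w v - K * theta (z - w + v) \<tau> / (theta (z - w) \<tau> * theta w \<tau>))"
  have th: "theta v \<tau> \<noteq> 0" "theta (z + v) \<tau> \<noteq> 0" "theta z \<tau> \<noteq> 0"
    using v zv z by (simp_all add: theta_eq_0_iff[OF tau])
  have ana_theta: "(\<lambda>w. theta (f w) \<tau>) analytic_on {p}" if "f holomorphic_on UNIV" for f p
    using holomorphic_theta[OF tau that] holomorphic_on_imp_analytic_at by blast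
  have mero_theta: "(\<lambda>w. theta (f w) \<tau>) meromorphic_on UNIV" if "f holomorphic_on UNIV" for f
    by (rule analytic_on_imp_meromorphic_on)
       (use holomorphic_theta[OF tau that] in \<open>simp add: analytic_on_open\<close>)
  have "(\<lambda>w. mu1 \<tau> (w - z) (v + z)) meromorphic_on UNIV"
    unfolding meromorphic_on_def
  proof
    fix p
    from mu1_meromorphic[OF tau, of "v + z"] obtain L where
      "(\<lambda>x. mu1 \<tau> (p - z + x) (v + z)) has_laurent_expansion L"
      by (auto simp: meromorphic_on_def)
    thus "\<exists>L. (\<lambda>x. mu1 \<tau> (p + x - z) (v + z)) has_laurent_expansion L"
      by (auto simp: algebra_simps)
  qed
  hence mero: "F meromorphic_on UNIV"
    unfolding F_def by (intro meromorphic_intros mero_theta mu1_meromorphic tau holomorphic_intros)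
  have iso: "isolated_singularity_at F p" for p
    by (rule meromorphic_on_isolated_singularity, rule meromorphic_on_subset[OF mero]) auto
  have mu1_shift_analytic: "(\<lambda>w. mu1 \<tau> (w - z) (v + z)) analytic_on {p}" if "p - z \<notin> lattice \<tau>" for p
  proof -
    have "(\<lambda>w. w - z) analytic_on {p}" by (intro analytic_intros)
    from analytic_on_compose[OF this, of "\<lambda>w. mu1 \<tau> w (v + z)"] show ?thesis
      using mu1_analytic[OF tau that] by (simp add: o_def)
  qed
  have ana: "F analytic_on {p}" if "p \<notin> lattice \<tau>" "z - p \<notin> lattice \<tau>" for p
  proof -
    have "p - z \<notin> lattice \<tau>" using that(2) lattice_uminus[of "z - p" \<tau>] by simp
    thus ?thesis
      unfolding F_def using that
      by (intro analytic_intros mu1_shift_analytic mu1_analytic tau ana_theta holomorphic_intros)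
         (auto simp: theta_eq_0_iff[OF tau])
  qed
  have zp: "z - p \<in> lattice \<tau> \<longleftrightarrow> p - z \<in> lattice \<tau>" for p
    using lattice_uminus[of "z - p" \<tau>] by simp
  have ev: "\<forall>\<^sub>F x in at p. x \<notin> lattice \<tau> \<and> z - x \<notin> lattice \<tau>" for p
    using eventually_not_in_lattice[OF tau, of 0 p] eventually_not_in_lattice[OF tau, of z p]
    by eventually_elim (simp add: zp)
  have per1: "F (x + 1) = - F x" for x
  proof -
    have a: "mu1 \<tau> (x + 1 - z) (v + z) = - mu1 \<tau> (x - z) (v + z)"
      using mu1_add_1[of \<tau> "x - z" "v + z"] by (simp add: algebra_simps)
    have b: "theta (z - (x + 1)) \<tau> = - theta (z - x) \<tau>" "theta (z - (x + 1) + v) \<tau> = - theta (z - x + v) \<tau>"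
      using theta_add_1[of "z - (x + 1)" \<tau>] theta_add_1[of "z - (x + 1) + v" \<tau>] by (simp_all add: algebra_simps)
    show ?thesis unfolding F_def a b mu1_add_1 theta_add_1 by simp
  qed
  have per2: "F (x + \<tau>) = - exp (2 * pi * \<i> * (x + v) + pi * \<i> * \<tau>) * F x"
    if x: "x \<notin> lattice \<tau>" "z - x \<notin> lattice \<tau>" for x
  proof -
    define E where "E = exp (2 * pi * \<i> * (x + v) + pi * \<i> * \<tau>)"
    define C where "C = \<i> * exp (- pi * \<i> * (x + v)) * qpow \<tau> (- 1 / 8)"
    have vz: "v + z \<notin> lattice \<tau>" using zv by (simp add: add.commute)
    have 1: "mu1 \<tau> (x + \<tau>) v = - E * (mu1 \<tau> x v - C)"
      unfolding E_def C_def by (rule mu1_add_tau[OF tau x(1) v])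
    have 2: "mu1 \<tau> (x + \<tau> - z) (v + z) = - E * (mu1 \<tau> (x - z) (v + z) - C)"
      using mu1_add_tau[OF tau, of "x - z" "v + z"] x vz unfolding E_def C_def
      by (simp add: zp algebra_simps)
    define a b c where "a = theta (z - (x + \<tau>)) \<tau>" and "b = theta (z - (x + \<tau>) + v) \<tau>" and "c = theta x \<tau>"
    define ea eb ec where "ea = exp (- (pi * \<i> * \<tau>) - 2 * pi * \<i> * (z - (x + \<tau>)))"
      and "eb = exp (- (pi * \<i> * \<tau>) - 2 * pi * \<i> * (z - (x + \<tau>) + v))"
      and "ec = exp (- (pi * \<i> * \<tau>) - 2 * pi * \<i> * x)"
    have a: "theta (z - x) \<tau> = - ea * a" and b: "theta (z - x + v) \<tau> = - eb * b" and c: "theta (x + \<tau>) \<tau> = - ec * c"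
      using theta_add_tau[of "z - (x + \<tau>)" \<tau>] theta_add_tau[of "z - (x + \<tau>) + v" \<tau>] theta_add_tau[of x \<tau>]
      unfolding a_def b_def c_def ea_def eb_def ec_def by (simp_all add: algebra_simps)
    \<comment> \<open>The theta quotient thus has the multiplier -E of the homogeneous part of
      \<mu>_1. The constants C cancel in the difference since w + v is unchanged by the
      translation.\<close>
    have "ea = E * eb * ec" unfolding ea_def eb_def ec_def E_def exp_add [symmetric]
      by (rule arg_cong[of _ _ exp]) (simp add: algebra_simps)
    moreover have "ea \<noteq> 0" "eb \<noteq> 0" "ec \<noteq> 0" by (simp_all add: ea_def eb_def ec_def)
    ultimately have 3: "K * b / (a * (- ec * c)) = - E * (K * (- eb * b) / ((- ea * a) * c))"
      by (simp add: divide_simps)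
    show ?thesis
      unfolding F_def 1 2 E_def [symmetric] a b c a_def [symmetric] b_def [symmetric] c_def [symmetric] 3
      by (simp add: algebra_simps)
  qed
  have eta: "eta \<tau> \<noteq> 0" using eta_nonzero[OF tau] .
  have lim0: "\<exists>c. F \<midarrow>0\<rightarrow> c"
  proof (rule tendsto_exists_if_simple_pole_cancels[OF iso])
    have t: "isCont (\<lambda>w. theta (f w) \<tau>) 0" if "f holomorphic_on UNIV" for f
      using ana_theta[OF that] analytic_at_imp_isCont by blast
    have m: "isCont (\<lambda>w. mu1 \<tau> (w - z) (v + z)) 0"
      using mu1_shift_analytic[of 0] z analytic_at_imp_isCont by auto
    \<comment> \<open>For z outside the lattice the translated \<open>mu1\<close> is regular at 0;
      the residue i / (2 pi theta(v)) of the other one is cancelled by that of the theta quotient,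
      whose \<open>eta\<close> cube comes from the derivative of theta at 0.\<close>
    have "((\<lambda>w. w * mu1 \<tau> (w - z) (v + z) - w * mu1 \<tau> w v - K * theta (z - w + v) \<tau> / theta (z - w) \<tau> * (w / theta w \<tau>))
      \<longlongrightarrow> 0 * mu1 \<tau> (0 - z) (v + z) - \<i> / (2 * pi * theta v \<tau>) - K * theta (z - 0 + v) \<tau> / theta (z - 0) \<tau> * (1 / (- 2 * pi * eta \<tau> ^ 3))) (at 0)"
      by (intro tendsto_intros mu1_residue_0 theta_pole_0 tau isContD[OF m] isContD[OF t] holomorphic_intros)
         (use th in auto)
    also have "0 * mu1 \<tau> (0 - z) (v + z) - \<i> / (2 * pi * theta v \<tau>) - K * theta (z - 0 + v) \<tau> / theta (z - 0) \<tau> * (1 / (- 2 * pi * eta \<tau> ^ 3)) = 0"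
      using th eta by (simp add: K_def divide_simps)
    finally show "((\<lambda>w. (w - 0) * F w) \<longlongrightarrow> 0) (at 0)"
      by (simp add: F_def algebra_simps)
  qed
  have limz: "\<exists>c. F \<midarrow>z\<rightarrow> c"
  proof (rule tendsto_exists_if_simple_pole_cancels[OF iso])
    have t: "isCont (\<lambda>w. theta (f w) \<tau>) 0" if "f holomorphic_on UNIV" for f
      using ana_theta[OF that] analytic_at_imp_isCont by blast
    have "(\<lambda>w. mu1 \<tau> (z + w) v) analytic_on {0}"
    proof -
      have "(\<lambda>w. z + w) analytic_on {0}" by (intro analytic_intros)
      from analytic_on_compose[OF this, of "\<lambda>w. mu1 \<tau> w v"] show ?thesis
        using mu1_analytic[OF tau z] by (simp add: o_def)
    qed
    hence m: "isCont (\<lambda>w. mu1 \<tau> (z + w) v) 0"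
      using analytic_at_imp_isCont by auto
    \<comment> \<open>The bound variable is now the local coordinate at z. There the factor theta(z
      - w) of the quotient turns into theta(-h) = -theta(h), which accounts for the plus
      sign.\<close>
    have "((\<lambda>w. w * mu1 \<tau> w (v + z) - w * mu1 \<tau> (z + w) v + K * theta (v - w) \<tau> / theta (z + w) \<tau> * (w / theta w \<tau>))
      \<longlongrightarrow> \<i> / (2 * pi * theta (v + z) \<tau>) - 0 * mu1 \<tau> (z + 0) v + K * theta (v - 0) \<tau> / theta (z + 0) \<tau> * (1 / (- 2 * pi * eta \<tau> ^ 3))) (at 0)"
      by (intro tendsto_intros mu1_residue_0 theta_pole_0 tau isContD[OF m] isContD[OF t] holomorphic_intros)
         (use th in auto)
    also have "\<i> / (2 * pi * theta (v + z) \<tau>) - 0 * mu1 \<tau> (z + 0) v + K * theta (v - 0) \<tau> / theta (z + 0) \<tau> * (1 / (- 2 * pi * eta \<tau> ^ 3)) = 0"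
      using th eta by (simp add: K_def divide_simps add.commute)
    finally have "((\<lambda>h. (z + h - z) * F (z + h)) \<longlongrightarrow> 0) (at 0)"
      by (simp add: F_def theta_minus algebra_simps)
    thus "((\<lambda>w. (w - z) * F w) \<longlongrightarrow> 0) (at z)"
      by (rule LIM_offset_zero_cancel)
  qed
  \<comment> \<open>A continuous multiplier without zeros transports the existence of a limit in
    both directions, so the two computed points cover all translates.\<close>
  have T: "(\<exists>c. F \<midarrow>p\<rightarrow> c) \<longleftrightarrow> (\<exists>c. F \<midarrow>p + \<omega>\<rightarrow> c)"
    if m: "\<And>p. isCont m p" "\<And>p. m p \<noteq> 0" and F: "\<forall>\<^sub>F x in at p. F (x + \<omega>) = m x * F x" for m \<omega> p
  proof
    assume "\<exists>c. F \<midarrow>p\<rightarrow> c"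
    then obtain c where "F \<midarrow>p\<rightarrow> c" ..
    hence "(\<lambda>x. m x * F x) \<midarrow>p\<rightarrow> m p * c" by (intro tendsto_intros isContD m)
    hence "(\<lambda>x. F (x + \<omega>)) \<midarrow>p\<rightarrow> m p * c"
      by (rule Lim_transform_eventually) (use F in eventually_elim, simp)
    from LIM_offset[OF this, of "- \<omega>"] show "\<exists>c. F \<midarrow>p + \<omega>\<rightarrow> c" by auto
  next
    assume "\<exists>c. F \<midarrow>p + \<omega>\<rightarrow> c"
    then obtain c where "F \<midarrow>p + \<omega>\<rightarrow> c" ..
    from LIM_offset[OF this, of \<omega>] have "(\<lambda>x. F (x + \<omega>)) \<midarrow>p\<rightarrow> c" by simp
    hence "(\<lambda>x. F (x + \<omega>) / m x) \<midarrow>p\<rightarrow> c / m p" by (intro tendsto_intros isContD m)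
    hence "F \<midarrow>p\<rightarrow> c / m p"
      by (rule Lim_transform_eventually) (use F in eventually_elim, simp add: m)
    thus "\<exists>c. F \<midarrow>p\<rightarrow> c" ..
  qed
  have T1: "(\<exists>c. F \<midarrow>p\<rightarrow> c) \<longleftrightarrow> (\<exists>c. F \<midarrow>p + 1\<rightarrow> c)" for p
    by (rule T[where m = "\<lambda>_. - 1"]) (auto simp: per1)
  have T2: "(\<exists>c. F \<midarrow>p\<rightarrow> c) \<longleftrightarrow> (\<exists>c. F \<midarrow>p + \<tau>\<rightarrow> c)" for p
    by (rule T[where m = "\<lambda>x. - exp (2 * pi * \<i> * (x + v) + pi * \<i> * \<tau>)"])
       (use ev[of p] in \<open>auto intro!: continuous_intros elim!: eventually_mono simp: per2\<close>)
  have T3: "\<exists>c. F \<midarrow>p + l\<rightarrow> c" if "\<exists>c. F \<midarrow>p\<rightarrow> c" "l \<in> lattice \<tau>" for p l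
  proof -
    from that(2) obtain a b where l: "l = of_int a + of_int b * \<tau>" by (auto simp: lattice_def)
    have "\<exists>c. F \<midarrow>p + of_int a * 1\<rightarrow> c"
      using that(1) int_shift_invariant[of "\<lambda>p. \<exists>c. F \<midarrow>p\<rightarrow> c", OF T1] by blast
    hence "\<exists>c. F \<midarrow>p + of_int a * 1 + of_int b * \<tau>\<rightarrow> c"
      using int_shift_invariant[of "\<lambda>p. \<exists>c. F \<midarrow>p\<rightarrow> c", OF T2] by blast
    thus ?thesis by (simp add: l add.assoc)
  qed
  have lim: "\<exists>c. F \<midarrow>p\<rightarrow> c" for p
  proof -
    consider "p \<in> lattice \<tau>" | "p - z \<in> lattice \<tau>" | "p \<notin> lattice \<tau>" "z - p \<notin> lattice \<tau>"
      using zp by blast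
    thus ?thesis
    proof cases
      case 1 thus ?thesis using T3[OF lim0 1] by simp
    next
      case 2 thus ?thesis using T3[OF limz 2] by simp
    next
      case 3 thus ?thesis using ana[OF 3] analytic_at_imp_isCont isContD by blast
    qed
  qed
  have "remove_sings F w = 0"
  proof (rule quasi_periodic_eq_0[OF tau mero lim])
    show "\<forall>\<^sub>F x in at p. F (x + 1) = - F x" for p by (simp add: per1)
    show "\<forall>\<^sub>F x in at p. F (x + \<tau>) = - exp (2 * pi * \<i> * (x + v) + pi * \<i> * \<tau>) * F x" for p
      using ev[of p] by eventually_elim (simp add: per2)
  qed
  \<comment> \<open>F is analytic at the given point, so removing singularities leaves its value
    there unchanged.\<close>
  hence "F w = 0" using ana[OF w zw] by simp
  thus ?thesis by (simp add: F_def K_def mult_ac)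
qed

section \<open>Arbitrary \<open>N\<close>\<close>

text \<open>The power q^(-s/2) converts exp (pi i (\<open>u 0\<close> + s \<tau>)), which occurs in
  \<open>mu1\<close>, back into exp (pi i \<open>u 0\<close>). The form with \<open>has_sum\<close>
  lets two such expansions be subtracted term by term.\<close>

lemma has_sum_mu_slices:
  fixes N :: nat
  assumes tau: "Im \<tau> > 0" and u0: "u 0 \<notin> lattice \<tau>"
  defines "s \<equiv> (\<lambda>m. \<Sum>j=1..N. m j :: int)"
  shows "((\<lambda>m. qpow \<tau> (- of_int (s m) / 2) * mu1 \<tau> (u 0 + of_int (s m) * \<tau>) (u 1) *
      (\<Prod>j=1..N. mu_coeff \<tau> (u (Suc j)) (m j))) has_sum mu (Suc N) u \<tau>) (Zvec {1..N})"
proof -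
  define t where "t n = exp (pi * \<i> * u 0) / (1 - exp (2 * pi * \<i> * u 0) * qpow \<tau> (of_int (\<Sum>j=1..Suc N. n j)))
      * (\<Prod>j=1..Suc N. mu_coeff \<tau> (u j) (n j))" for n
  define P where "P m = (\<Prod>j=1..N. mu_coeff \<tau> (u (Suc j)) (m j))" for m
  have "(\<lambda>n. exp (pi * \<i> * u 0) * (1 / (1 - exp (2 * pi * \<i> * u 0) * qpow \<tau> (of_int (\<Sum>j=1..Suc N. n j)))
      * (\<Prod>j=1..Suc N. mu_coeff \<tau> (u j) (n j)))) summable_on Zvec {1..Suc N}"
    by (rule summable_on_cmult_right[OF summable_mu[OF tau u0]])
  hence "t summable_on Zvec {1..Suc N}"
    unfolding t_def[abs_def]
    by (simp only: times_divide_eq_right times_divide_eq_left mult_1_right mult_1_left)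
  hence sm: "(\<lambda>(a, m). t (Zcons a m)) summable_on (UNIV \<times> Zvec {1..N})"
    by (simp only: summable_on_Zcons)
  hence sm': "(\<lambda>(m, a). t (Zcons a m)) summable_on (Zvec {1..N} \<times> UNIV)"
    by (subst (asm) summable_on_swap) simp
  have slice: "(\<Sum>\<^sub>\<infinity>a. t (Zcons a m)) = qpow \<tau> (- of_int (s m) / 2) * mu1 \<tau> (u 0 + of_int (s m) * \<tau>) (u 1) * P m" for m
  proof -
    have "t (Zcons a m) = qpow \<tau> (- of_int (s m) / 2) * P m *
       (exp (pi * \<i> * (u 0 + of_int (s m) * \<tau>)) / (1 - exp (2 * pi * \<i> * (u 0 + of_int (s m) * \<tau>)) * qpow \<tau> (of_int a)) * mu_coeff \<tau> (u 1) a)" for a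
    proof -
      have 1: "exp (2 * pi * \<i> * (u 0 + of_int (s m) * \<tau>)) * qpow \<tau> (of_int a) = exp (2 * pi * \<i> * u 0) * qpow \<tau> (of_int (a + s m))"
        unfolding qpow_def exp_add [symmetric] by (rule arg_cong[of _ _ exp]) (simp add: algebra_simps)
      have 2: "exp (pi * \<i> * u 0) = qpow \<tau> (- of_int (s m) / 2) * exp (pi * \<i> * (u 0 + of_int (s m) * \<tau>))"
        unfolding qpow_def exp_add [symmetric] by (rule arg_cong[of _ _ exp]) (simp add: algebra_simps)
      have 3: "(\<Sum>j=1..Suc N. Zcons a m j) = a + s m" unfolding s_def by (rule sum_Zcons)
      have 4: "(\<Prod>j=1..Suc N. mu_coeff \<tau> (u j) (Zcons a m j)) = mu_coeff \<tau> (u 1) a * P m"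
        unfolding P_def by (rule prod_Zcons)
      show ?thesis unfolding t_def 1 3 4 by (subst 2) simp
    qed
    hence "(\<Sum>\<^sub>\<infinity>a. t (Zcons a m)) = qpow \<tau> (- of_int (s m) / 2) * P m * mu1 \<tau> (u 0 + of_int (s m) * \<tau>) (u 1)"
      unfolding mu1_def infsum_cmult_right' [symmetric] by presburger
    thus ?thesis by (simp only: mult_ac)
  qed
  have "mu (Suc N) u \<tau> = infsum t (Zvec {1..Suc N})" unfolding mu_altdef t_def ..
  also have "\<dots> = (\<Sum>\<^sub>\<infinity>a. \<Sum>\<^sub>\<infinity>m\<in>Zvec {1..N}. t (Zcons a m))"
    unfolding infsum_Zcons by (rule infsum_Sigma'_banach[OF sm, symmetric])
  also have "\<dots> = (\<Sum>\<^sub>\<infinity>m\<in>Zvec {1..N}. \<Sum>\<^sub>\<infinity>a. t (Zcons a m))"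
    by (rule infsum_swap_banach[OF sm])
  finally have "mu (Suc N) u \<tau> = (\<Sum>\<^sub>\<infinity>m\<in>Zvec {1..N}. \<Sum>\<^sub>\<infinity>a. t (Zcons a m))" .
  moreover have "(\<lambda>m. \<Sum>\<^sub>\<infinity>a. t (Zcons a m)) summable_on Zvec {1..N}"
    by (rule summable_on_Sigma_banach[OF sm'])
  ultimately show ?thesis unfolding slice P_def by (simp add: has_sum_iff)
qed

text \<open>The square of the sum plus the sum of squares is the quadratic form of the matrix 1 +
  \<delta>, so this is the entry k = 0 of (iii). The other entries result from moving
  \<open>u 0\<close> by k periods.\<close>

lemma mu_translate:
  assumes tau: "Im \<tau> > 0" and u: "u 0 \<notin> lattice \<tau>" "u 1 \<notin> lattice \<tau>"
    and z: "z - u 0 \<notin> lattice \<tau>" "z + u 1 \<notin> lattice \<tau>"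
    and u': "u' 0 = u 0 - z" "u' 1 = u 1 + z" "\<And>j. j \<in> {1..N} \<Longrightarrow> u' (Suc j) = u (Suc j)"
  shows "mu (Suc N) u' \<tau> - mu (Suc N) u \<tau>
    = \<i> * eta \<tau> ^ 3 * theta z \<tau> * theta (z - u 0 + u 1) \<tau>
     / (theta (z - u 0) \<tau> * theta (z + u 1) \<tau> * (\<Prod>j=0..Suc N. theta (u j) \<tau>)) *
     (\<Sum>\<^sub>\<infinity>m\<in>Zvec {1..N}. exp (pi * \<i> * ((\<Sum>j=1..N. of_int (m j))\<^sup>2 + (\<Sum>j=1..N. (of_int (m j))\<^sup>2)) * \<tau>
        + 2 * pi * \<i> * (\<Sum>j=1..N. (u 0 + u 1 - u (j + 1)) * of_int (m j))))"
proof -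
  define s where "s m = (\<Sum>j=1..N. m j :: int)" for m
  define P where "P m = (\<Prod>j=1..N. mu_coeff \<tau> (u (Suc j)) (m j))" for m
  define G where "G = \<i> * eta \<tau> ^ 3 * theta z \<tau> * theta (z - u 0 + u 1) \<tau>
     / (theta (z - u 0) \<tau> * theta (z + u 1) \<tau> * (\<Prod>j=0..Suc N. theta (u j) \<tau>))"
  define E where "E m = exp (pi * \<i> * ((\<Sum>j=1..N. of_int (m j))\<^sup>2 + (\<Sum>j=1..N. (of_int (m j))\<^sup>2)) * \<tau>
        + 2 * pi * \<i> * (\<Sum>j=1..N. (u 0 + u 1 - u (j + 1)) * of_int (m j)))" for m :: "nat \<Rightarrow> int"
  have u'0: "u' 0 \<notin> lattice \<tau>" using z(1) lattice_uminus[of "z - u 0" \<tau>] by (simp add: u')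
  have P': "(\<Prod>j=1..N. mu_coeff \<tau> (u' (Suc j)) (m j)) = P m" for m
    unfolding P_def by (rule prod.cong) (simp_all add: u')
  have 1: "((\<lambda>m. qpow \<tau> (- of_int (s m) / 2) * mu1 \<tau> (u 0 + of_int (s m) * \<tau>) (u 1) * P m) has_sum mu (Suc N) u \<tau>) (Zvec {1..N})"
    unfolding s_def P_def by (rule has_sum_mu_slices[where u = u, OF tau u(1)])
  have 2: "((\<lambda>m. qpow \<tau> (- of_int (s m) / 2) * mu1 \<tau> (u' 0 + of_int (s m) * \<tau>) (u' 1) * P m) has_sum mu (Suc N) u' \<tau>) (Zvec {1..N})"
    unfolding s_def P' [symmetric] by (rule has_sum_mu_slices[where u = u', OF tau u'0])
  have slice_diff: "qpow \<tau> (- of_int (s m) / 2) * mu1 \<tau> (u' 0 + of_int (s m) * \<tau>) (u' 1) * P m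
      - qpow \<tau> (- of_int (s m) / 2) * mu1 \<tau> (u 0 + of_int (s m) * \<tau>) (u 1) * P m = G * E m" for m
  proof -
    define S where "S = s m"
    have lat: "u 0 + of_int S * \<tau> \<notin> lattice \<tau>" "z - (u 0 + of_int S * \<tau>) \<notin> lattice \<tau>"
      using u(1) z(1) lattice_add_iff[of "of_int S * \<tau>" \<tau> "u 0"] lattice_add_iff[of "of_int (- S) * \<tau>" \<tau> "z - u 0"]
        int_tau_in_lattice(1)[of "- S" \<tau>]
      by (simp_all add: algebra_simps del: of_int_minus int_tau_in_lattice) (simp_all add: algebra_simps)
    \<comment> \<open>Exponents of the multipliers of the three theta functions that contain
      \<open>u 0\<close>, under a shift by S periods.\<close>
    define a1 a2 a3 where
      "a1 = - (pi * \<i> * of_int (- S)) - pi * \<i> * (of_int (- S))\<^sup>2 * \<tau> - 2 * pi * \<i> * of_int (- S) * (z - u 0 + u 1)"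
      and "a2 = - (pi * \<i> * of_int (- S)) - pi * \<i> * (of_int (- S))\<^sup>2 * \<tau> - 2 * pi * \<i> * of_int (- S) * (z - u 0)"
      and "a3 = - (pi * \<i> * of_int S) - pi * \<i> * (of_int S)\<^sup>2 * \<tau> - 2 * pi * \<i> * of_int S * u 0"
    have th: "theta (z - (u 0 + of_int S * \<tau>) + u 1) \<tau> = exp a1 * theta (z - u 0 + u 1) \<tau>"
      "theta (z - (u 0 + of_int S * \<tau>)) \<tau> = exp a2 * theta (z - u 0) \<tau>"
      "theta (u 0 + of_int S * \<tau>) \<tau> = exp a3 * theta (u 0) \<tau>"
      using theta_add_int_tau[of "z - u 0 + u 1" "- S" \<tau>] theta_add_int_tau[of "z - u 0" "- S" \<tau>] theta_add_int_tau[of "u 0" S \<tau>]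
      unfolding a1_def a2_def a3_def by (simp_all add: algebra_simps)
    define b where "b j = of_int (m j) * (of_real pi * \<i> - 2 * pi * \<i> * u (Suc j)) + of_int (m j) * (of_int (m j) + 1) / 2 * (2 * pi * \<i> * \<tau>)" for j
    have Pm: "P m = exp (\<Sum>j=1..N. b j) / (\<Prod>j=1..N. theta (u (Suc j)) \<tau>)"
      unfolding P_def mu_coeff_exp b_def by (simp add: prod_dividef exp_sum)
    define G' where "G' = \<i> * eta \<tau> ^ 3 * theta z \<tau> * theta (z - u 0 + u 1) \<tau>
     / (theta (z - u 0) \<tau> * theta (z + u 1) \<tau> * (theta (u 0) \<tau> * theta (u 1) \<tau>))"
    have G: "G = G' / (\<Prod>j=1..N. theta (u (Suc j)) \<tau>)"
    proof -
      have "(\<Prod>j=0..Suc N. theta (u j) \<tau>) = theta (u 0) \<tau> * (\<Prod>j=0..N. theta (u (Suc j)) \<tau>)"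
        by (simp only: prod.atLeast0_atMost_Suc_shift o_def)
      also have "(\<Prod>j=0..N. theta (u (Suc j)) \<tau>) = theta (u 1) \<tau> * (\<Prod>j=1..N. theta (u (Suc j)) \<tau>)"
        by (subst prod.atLeast_Suc_atMost) auto
      finally show ?thesis unfolding G_def G'_def by (simp add: mult_ac)
    qed
    have "mu1 \<tau> (u 0 + of_int S * \<tau> - z) (u 1 + z) - mu1 \<tau> (u 0 + of_int S * \<tau>) (u 1) = exp (a1 - a2 - a3) * G'"
      unfolding mu1_translate[OF tau lat(1) u(2) lat(2) z(2)] th G'_def exp_diff by (simp add: mult_ac)
    also have "u 0 + of_int S * \<tau> - z = u' 0 + of_int S * \<tau>" by (simp add: u')
    finally have d: "mu1 \<tau> (u' 0 + of_int S * \<tau>) (u' 1) - mu1 \<tau> (u 0 + of_int S * \<tau>) (u 1) = exp (a1 - a2 - a3) * G'"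
      by (simp only: u')
    define Q U where "Q = (\<Sum>j=1..N. (of_int (m j))\<^sup>2 :: complex)" and "U = (\<Sum>j=1..N. u (Suc j) * of_int (m j))"
    have mS: "(\<Sum>j=1..N. of_int (m j)) = (of_int S :: complex)" by (simp add: S_def s_def)
    have b: "(\<Sum>j=1..N. b j) = (of_real pi * \<i> + of_real pi * \<i> * \<tau>) * of_int S - 2 * pi * \<i> * U + pi * \<i> * \<tau> * Q"
      unfolding b_def mS [symmetric] Q_def U_def sum_distrib_left sum.distrib [symmetric] sum_subtractf [symmetric]
      by (rule sum.cong) (simp_all add: field_simps power2_eq_square)
    have V: "(\<Sum>j=1..N. (u 0 + u 1 - u (j + 1)) * of_int (m j)) = (u 0 + u 1) * of_int S - U"
      unfolding mS [symmetric] U_def sum_distrib_left sum_subtractf [symmetric] by (rule sum.cong) (simp_all add: algebra_simps)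
    \<comment> \<open>The linear terms in S \<tau> cancel between q^(-S/2) and the triangular
      exponents of the coefficients; what is left over is 2 pi i S, invisible to the
      exponential.\<close>
    have "2 * pi * \<i> * (- of_int S / 2) * \<tau> + (a1 - a2 - a3) + (\<Sum>j=1..N. b j)
      = (pi * \<i> * ((\<Sum>j=1..N. of_int (m j))\<^sup>2 + (\<Sum>j=1..N. (of_int (m j))\<^sup>2)) * \<tau>
        + 2 * pi * \<i> * (\<Sum>j=1..N. (u 0 + u 1 - u (j + 1)) * of_int (m j))) + 2 * of_real pi * \<i> * of_int S"
      unfolding b V mS Q_def [symmetric] a1_def a2_def a3_def by (simp add: field_simps power2_eq_square)
    hence "qpow \<tau> (- of_int S / 2) * exp (a1 - a2 - a3) * exp (\<Sum>j=1..N. b j) = E m"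
      unfolding qpow_def exp_add [symmetric] E_def by (simp only: exp_add exp_2pi_i_int mult_1_right)
    moreover have "qpow \<tau> (- of_int S / 2) * mu1 \<tau> (u' 0 + of_int S * \<tau>) (u' 1) * P m
      - qpow \<tau> (- of_int S / 2) * mu1 \<tau> (u 0 + of_int S * \<tau>) (u 1) * P m
      = qpow \<tau> (- of_int S / 2) * (mu1 \<tau> (u' 0 + of_int S * \<tau>) (u' 1) - mu1 \<tau> (u 0 + of_int S * \<tau>) (u 1)) * P m"
      by (simp only: right_diff_distrib left_diff_distrib)
    moreover have "\<dots> = G * (qpow \<tau> (- of_int S / 2) * exp (a1 - a2 - a3) * exp (\<Sum>j=1..N. b j))"
      unfolding d Pm G by simp
    ultimately show ?thesis by (simp only: S_def)
  qed
  have "((\<lambda>m. G * E m) has_sum (mu (Suc N) u' \<tau> - mu (Suc N) u \<tau>)) (Zvec {1..N})"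
    using has_sum_add[OF 2 has_sum_uminusI[OF 1]] unfolding add_uminus_conv_diff slice_diff .
  hence "mu (Suc N) u' \<tau> - mu (Suc N) u \<tau> = (\<Sum>\<^sub>\<infinity>m\<in>Zvec {1..N}. G * E m)"
    by (simp add: infsumI)
  thus ?thesis unfolding infsum_cmult_right' G_def E_def .
qed

text \<open>Removes the case distinction at dimension one: there the only vector is zero and the sum
  equals 1, in agreement with the convention for \<nu>.\<close>

lemma nuN_altdef:
  assumes "k < Suc N"
  defines "c \<equiv> of_nat k / of_nat (Suc N) :: complex"
  shows "nuN (Suc N) k u \<tau> = (\<Sum>\<^sub>\<infinity>m\<in>Zvec {1..N}.
     exp (pi * \<i> * ((\<Sum>j=1..N. of_int (m j) + c)\<^sup>2 + (\<Sum>j=1..N. (of_int (m j) + c)\<^sup>2)) * \<tau>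
        + 2 * pi * \<i> * (\<Sum>j=1..N. (u 0 + u 1 - u (j + 1)) * (of_int (m j) + c))))"
proof (cases "N = 0")
  case True
  hence "Zvec {1..N} = {\<lambda>_. 0}" using Zvec_0 by simp
  with True show ?thesis by (simp add: nuN_def)
next
  case False
  have "(\<Sum>j=1..N. \<Sum>l=1..N. (if j = l then 2 else 1) * n j * n l) = (\<Sum>j=1..N. n j)\<^sup>2 + (\<Sum>j=1..N. (n j)\<^sup>2)"
    for n :: "nat \<Rightarrow> complex"
  proof -
    have "(\<Sum>j=1..N. \<Sum>l=1..N. (if j = l then 2 else 1) * n j * n l)
      = (\<Sum>j=1..N. \<Sum>l=1..N. n j * n l + (if j = l then n j * n l else 0))"
      by (intro sum.cong) auto
    also have "\<dots> = (\<Sum>j=1..N. \<Sum>l=1..N. n j * n l) + (\<Sum>j=1..N. n j * n j)"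
      by (simp add: sum.distrib)
    finally show ?thesis by (simp add: power2_eq_square sum_product)
  qed
  thus ?thesis using False by (simp add: nuN_def c_def Let_def)
qed

section \<open>Translation and quasi-periodicity of the vector M_N\<close>

lemma sum_fun_upd:
  fixes f :: "'a \<Rightarrow> 'b::ab_group_add"
  assumes "finite A" "r \<in> A"
  shows "sum (f(r := x)) A = sum f A - f r + x"
proof -
  have "sum (f(r := x)) A = x + sum f (A - {r})"
    using assms by (subst sum.remove[of _ r]) (auto intro!: sum.cong)
  thus ?thesis using sum.remove[OF assms, of f] by simp
qed

text \<open>The formula for \<open>mu\<close> is applied to w, which is u with \<open>u 0\<close>
  moved by k periods. The phase p of \<open>MN\<close> and the multiplier r of the theta quotient
  supply precisely the terms that turn the exponent at m into the one at m + c, with c = k /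
  N.\<close>

lemma MN_translate:
  assumes tau: "Im \<tau> > 0" and u: "u 0 \<notin> lattice \<tau>" "u 1 \<notin> lattice \<tau>"
    and z: "z - u 0 \<notin> lattice \<tau>" "z + u 1 \<notin> lattice \<tau>" and N: "N \<ge> 1" and k: "k < N"
  shows "MN N (u(0 := u 0 - z, 1 := u 1 + z)) \<tau> k - MN N u \<tau> k = PhiN N u z \<tau> k"
proof -
  from N obtain L where L: "N = Suc L" by (cases N) auto
  define S where "S = (\<Sum>j=0..N. u j)"
  define c where "c = (of_nat k / of_nat N :: complex)"
  define w where "w = u(0 := u 0 + of_nat k * \<tau>)"
  define w' where "w' = u(0 := u 0 - z + of_nat k * \<tau>, 1 := u 1 + z)"
  define G where "G v = \<i> * eta \<tau> ^ 3 * theta z \<tau> * theta (z - v 0 + v 1) \<tau>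
     / (theta (z - v 0) \<tau> * theta (z + v 1) \<tau> * (\<Prod>j=0..N. theta (v j) \<tau>))" for v
  define E where "E v m = pi * \<i> * ((\<Sum>j=1..L. of_int (m j))\<^sup>2 + (\<Sum>j=1..L. (of_int (m j))\<^sup>2)) * \<tau>
        + 2 * pi * \<i> * (\<Sum>j=1..L. (v 0 + v 1 - v (j + 1)) * of_int (m j))" for v and m :: "nat \<Rightarrow> int"
  define p where "p = - 2 * pi * \<i> * of_nat k * S / of_nat N - pi * \<i> * of_nat k ^ 2 * \<tau> / of_nat N"
  have S': "(\<Sum>j=0..N. (u(0 := u 0 - z, 1 := u 1 + z)) j) = S"
    using N by (simp add: sum_fun_upd del: fun_upd_apply) (simp add: S_def)
  have M: "MN N u \<tau> k = (-1) ^ k * exp p * mu N w \<tau>"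
    by (simp add: MN_def p_def S_def w_def)
  have "u(0 := u 0 - z, 1 := u 1 + z, 0 := u 0 - z + of_nat k * \<tau>) = w'"
    by (auto simp: w'_def fun_eq_iff)
  hence M': "MN N (u(0 := u 0 - z, 1 := u 1 + z)) \<tau> k = (-1) ^ k * exp p * mu N w' \<tau>"
    unfolding MN_def S' by (simp add: p_def)
  have kl: "of_int (int k) * \<tau> \<in> lattice \<tau>" "of_int (- int k) * \<tau> \<in> lattice \<tau>"
    by (rule int_tau_in_lattice)+
  have mu: "mu N w' \<tau> - mu N w \<tau> = G w * (\<Sum>\<^sub>\<infinity>m\<in>Zvec {1..L}. exp (E w m))"
    unfolding L G_def E_def
  proof (rule mu_translate[OF tau])
    show "w 0 \<notin> lattice \<tau>" "z - w 0 \<notin> lattice \<tau>"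
      using u(1) z(1) lattice_add_iff[OF kl(1), of "u 0"] lattice_add_iff[OF kl(2), of "z - u 0"]
      by (simp_all add: w_def algebra_simps)
  qed (use u z in \<open>auto simp: w_def w'_def\<close>)
  have G: "G w = exp (pi * \<i> * of_nat k + pi * \<i> * of_nat k ^ 2 * \<tau> + 2 * pi * \<i> * of_nat k * (u 0 + u 1)) * G u"
  proof -
    define a1 a2 a3 where
      "a1 = - (pi * \<i> * of_int (- int k)) - pi * \<i> * (of_int (- int k))\<^sup>2 * \<tau> - 2 * pi * \<i> * of_int (- int k) * (z - u 0 + u 1)"
      and "a2 = - (pi * \<i> * of_int (- int k)) - pi * \<i> * (of_int (- int k))\<^sup>2 * \<tau> - 2 * pi * \<i> * of_int (- int k) * (z - u 0)"
      and "a3 = - (pi * \<i> * of_int (int k)) - pi * \<i> * (of_int (int k))\<^sup>2 * \<tau> - 2 * pi * \<i> * of_int (int k) * u 0"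
    have th: "theta (z - w 0 + u 1) \<tau> = exp a1 * theta (z - u 0 + u 1) \<tau>"
      "theta (z - w 0) \<tau> = exp a2 * theta (z - u 0) \<tau>"
      "theta (w 0) \<tau> = exp a3 * theta (u 0) \<tau>"
      using theta_add_int_tau[of "z - u 0 + u 1" "- int k" \<tau>] theta_add_int_tau[of "z - u 0" "- int k" \<tau>] theta_add_int_tau[of "u 0" "int k" \<tau>]
      unfolding a1_def a2_def a3_def by (simp_all add: w_def algebra_simps)
    have "(\<Prod>j=0..N. theta (w j) \<tau>) = theta (w 0) \<tau> * (\<Prod>j=1..N. theta (w j) \<tau>)"
      by (subst prod.atLeast_Suc_atMost) auto
    also have "(\<Prod>j=1..N. theta (w j) \<tau>) = (\<Prod>j=1..N. theta (u j) \<tau>)"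
      by (rule prod.cong) (auto simp: w_def)
    also have "theta (w 0) \<tau> * \<dots> = exp a3 * (\<Prod>j=0..N. theta (u j) \<tau>)"
      unfolding th by (subst (2) prod.atLeast_Suc_atMost) auto
    finally have pr: "(\<Prod>j=0..N. theta (w j) \<tau>) = exp a3 * (\<Prod>j=0..N. theta (u j) \<tau>)" .
    have w1: "w 1 = u 1" by (simp add: w_def)
    have "G w = exp (a1 - a2 - a3) * G u"
      unfolding G_def pr w1 th exp_diff by (simp add: mult_ac)
    also have "a1 - a2 - a3 = pi * \<i> * of_nat k + pi * \<i> * of_nat k ^ 2 * \<tau> + 2 * pi * \<i> * of_nat k * (u 0 + u 1)"
      unfolding a1_def a2_def a3_def by (simp add: algebra_simps)
    finally show ?thesis .
  qed
  define r where "r = pi * \<i> * of_nat k + pi * \<i> * of_nat k ^ 2 * \<tau> + 2 * pi * \<i> * of_nat k * (u 0 + u 1)"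
  have "MN N (u(0 := u 0 - z, 1 := u 1 + z)) \<tau> k - MN N u \<tau> k = (-1) ^ k * exp p * (mu N w' \<tau> - mu N w \<tau>)"
    unfolding M M' by (simp only: right_diff_distrib)
  also have "\<dots> = G u * (\<Sum>\<^sub>\<infinity>m\<in>Zvec {1..L}. (-1) ^ k * exp p * exp r * exp (E w m))"
    unfolding mu G infsum_cmult_right' r_def by simp
  also have "(\<Sum>\<^sub>\<infinity>m\<in>Zvec {1..L}. (-1) ^ k * exp p * exp r * exp (E w m)) = nuN (Suc L) k u \<tau>"
    unfolding nuN_altdef[OF k[unfolded L]] unfolding L [symmetric] c_def [symmetric]
  proof (rule infsum_cong)
    fix m
    define s q t where "s = (\<Sum>j=1..L. of_int (m j) :: complex)" and "q = (\<Sum>j=1..L. (of_int (m j))\<^sup>2 :: complex)"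
      and "t = (\<Sum>j=1..L. (u 0 + u 1 - u (j + 1)) * of_int (m j))"
    have "c * of_nat (Suc L) = of_nat k" by (simp add: c_def L del: of_nat_Suc)
    \<comment> \<open>Here N = L + 1 matters: moving each of the L entries by c moves their sum by k
      - c.\<close>
    hence cN: "c * of_nat L = of_nat k - c" by (simp add: algebra_simps)
    have 1: "(\<Sum>j=1..L. of_int (m j) + c) = s + (of_nat k - c)"
      unfolding cN [symmetric] by (simp add: sum.distrib s_def mult.commute)
    have 2: "(\<Sum>j=1..L. (of_int (m j) + c)\<^sup>2) = q + 2 * c * s + c * (of_nat k - c)"
    proof -
      have "(\<Sum>j=1..L. (of_int (m j) + c)\<^sup>2) = (\<Sum>j=1..L. (of_int (m j))\<^sup>2 + (2 * c * of_int (m j) + c * c))"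
        by (rule sum.cong) (simp_all add: power2_eq_square algebra_simps)
      also have "\<dots> = q + 2 * c * s + c * (c * of_nat L)"
        by (simp add: sum.distrib s_def q_def sum_distrib_left)
      finally show ?thesis unfolding cN .
    qed
    have Su: "S = u 0 + u 1 + (\<Sum>j=1..L. u (j + 1))"
    proof -
      have "S = u 0 + (\<Sum>j=0..L. u (Suc j))"
        unfolding S_def L by (simp only: sum.atLeast0_atMost_Suc_shift o_def)
      also have "(\<Sum>j=0..L. u (Suc j)) = u 1 + (\<Sum>j=1..L. u (Suc j))"
        by (subst sum.atLeast_Suc_atMost) auto
      finally show ?thesis by simp
    qed
    have 3: "(\<Sum>j=1..L. (u 0 + u 1 - u (j + 1)) * (of_int (m j) + c)) = t + (of_nat k * (u 0 + u 1) - c * S)"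
    proof -
      have "(\<Sum>j=1..L. (u 0 + u 1 - u (j + 1)) * (of_int (m j) + c)) = t + c * (\<Sum>j=1..L. (u 0 + u 1 - u (j + 1)))"
        unfolding t_def sum_distrib_left sum.distrib [symmetric] by (rule sum.cong) (simp_all add: algebra_simps)
      also have "(\<Sum>j=1..L. (u 0 + u 1 - u (j + 1))) = of_nat L * (u 0 + u 1) - (S - (u 0 + u 1))"
        by (simp add: sum_subtractf Su)
      also have "c * \<dots> = (c * of_nat L) * (u 0 + u 1) - c * (S - (u 0 + u 1))"
        by (simp add: algebra_simps)
      also have "\<dots> = of_nat k * (u 0 + u 1) - c * S"
        unfolding cN by (simp add: algebra_simps)
      finally show ?thesis .
    qed
    \<comment> \<open>The shift of \<open>u 0\<close> provides the cross term of the completed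
      square: 2s(k - c) + 2cs = 2ks.\<close>
    have 4: "(\<Sum>j=1..L. (w 0 + w 1 - w (j + 1)) * of_int (m j)) = t + of_nat k * \<tau> * s"
    proof -
      have "(\<Sum>j=1..L. (w 0 + w 1 - w (j + 1)) * of_int (m j)) = (\<Sum>j=1..L. (u 0 + u 1 - u (j + 1)) * of_int (m j) + of_nat k * \<tau> * of_int (m j))"
        by (rule sum.cong) (auto simp: w_def algebra_simps)
      thus ?thesis by (simp add: t_def s_def sum.distrib sum_distrib_left)
    qed
    have p: "p = - 2 * pi * \<i> * c * S - pi * \<i> * of_nat k * c * \<tau>"
      by (simp add: p_def c_def power2_eq_square)
    have "exp (of_nat k * (of_real pi * \<i>)) = (-1) ^ k" by (subst exp_of_nat_mult) simp
    hence "(-1) ^ k * exp p * exp r * exp (E w m) = exp (of_nat k * (of_real pi * \<i>) + p + r + E w m)"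
      by (simp only: exp_add)
    \<comment> \<open>The signs (-1)^k from \<open>MN\<close> and from the theta quotient together
      make the exponent 2 pi i k, which drops out.\<close>
    also have "of_nat k * (of_real pi * \<i>) + p + r + E w m =
       (pi * \<i> * ((s + (of_nat k - c))\<^sup>2 + (q + 2 * c * s + c * (of_nat k - c))) * \<tau>
        + 2 * pi * \<i> * (t + (of_nat k * (u 0 + u 1) - c * S))) + 2 * of_real pi * \<i> * of_int (int k)"
      unfolding p r_def E_def 4 s_def [symmetric] q_def [symmetric]
      by (simp add: algebra_simps power2_eq_square)
    finally show "(-1) ^ k * exp p * exp r * exp (E w m) = exp (pi * \<i> * ((\<Sum>j=1..L. of_int (m j) + c)\<^sup>2 + (\<Sum>j=1..L. (of_int (m j) + c)\<^sup>2)) * \<tau>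
        + 2 * pi * \<i> * (\<Sum>j=1..L. (u 0 + u 1 - u (j + 1)) * (of_int (m j) + c)))"
      unfolding 1 2 3 exp_add[of _ "2 * of_real pi * \<i> * of_int (int k)"] exp_2pi_i_int by simp
  qed
  finally show ?thesis unfolding PhiN_def G_def L .
qed

lemma MN_add_1:
  assumes "N \<ge> 1"
  shows "exp (2 * pi * \<i> * of_nat k / of_nat N) * MN N (u(0 := u 0 + 1)) \<tau> k = - MN N u \<tau> k"
proof -
  define S where "S = (\<Sum>j=0..N. u j)"
  have S: "(\<Sum>j=0..N. (u(0 := u 0 + 1)) j) = S + 1" by (simp add: sum_fun_upd S_def del: fun_upd_apply)
  have "mu N (u(0 := u 0 + 1, 0 := (u(0 := u 0 + 1)) 0 + of_nat k * \<tau>)) \<tau> = - mu N (u(0 := u 0 + of_nat k * \<tau>)) \<tau>"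
    by (rule mu_add_1) (auto simp: algebra_simps)
  moreover have "exp (2 * pi * \<i> * of_nat k / of_nat N) * exp (- 2 * pi * \<i> * of_nat k * (S + 1) / of_nat N - pi * \<i> * of_nat k ^ 2 * \<tau> / of_nat N)
    = exp (- 2 * pi * \<i> * of_nat k * S / of_nat N - pi * \<i> * of_nat k ^ 2 * \<tau> / of_nat N)"
    unfolding exp_add [symmetric] by (rule arg_cong[of _ _ exp]) (use assms in \<open>simp add: field_simps\<close>)
  ultimately show ?thesis unfolding MN_def S Let_def S_def [symmetric]
    by (simp add: mult.left_commute[of "exp (2 * pi * \<i> * of_nat k / of_nat N)"])
qed

text \<open>The prefactor completes k^2 to (k+1)^2 in the phase, and the power of -1 gives the sign.
  On the right \<open>Suc k\<close> may equal N, one beyond the last entry of the vector; that value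
  is needed for the wrap-around of the cyclic permutation.\<close>

lemma MN_add_tau_Suc:
  assumes "N \<ge> 1"
  shows "exp (- 2 * pi * \<i> * (\<Sum>j=0..N. u j) / of_nat N) * qpow \<tau> (- 1 / (2 * of_nat N)) *
    MN N (u(0 := u 0 + \<tau>)) \<tau> k = - MN N u \<tau> (Suc k)"
proof -
  define S where "S = (\<Sum>j=0..N. u j)"
  have S: "(\<Sum>j=0..N. (u(0 := u 0 + \<tau>)) j) = S + \<tau>" by (simp add: sum_fun_upd S_def del: fun_upd_apply)
  have u: "u(0 := u 0 + \<tau>, 0 := (u(0 := u 0 + \<tau>)) 0 + of_nat k * \<tau>) = u(0 := u 0 + of_nat (Suc k) * \<tau>)"
    by (simp add: algebra_simps)
  have "exp (- 2 * pi * \<i> * S / of_nat N) * qpow \<tau> (- 1 / (2 * of_nat N)) *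
      exp (- 2 * pi * \<i> * of_nat k * (S + \<tau>) / of_nat N - pi * \<i> * of_nat k ^ 2 * \<tau> / of_nat N)
    = exp (- 2 * pi * \<i> * of_nat (Suc k) * S / of_nat N - pi * \<i> * of_nat (Suc k) ^ 2 * \<tau> / of_nat N)"
    unfolding exp_add [symmetric] qpow_def
    by (rule arg_cong[of _ _ exp]) (use assms in \<open>simp add: field_simps power2_eq_square\<close>)
  thus ?thesis unfolding MN_def S Let_def u S_def [symmetric]
    by (simp add: mult.left_commute[of _ "(-1) ^ k"] flip: mult.assoc)
qed

text \<open>At k = N the phase and the sign cancel the multiplier of \<open>mu_add_nat_tau\<close>
  exactly, so only its inhomogeneous term separates this value from the entry 0.\<close>

lemma MN_N:
  assumes tau: "Im \<tau> > 0" and "N \<ge> 1" and u: "\<forall>j\<le>N. u j \<notin> lattice \<tau>"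
  defines "S \<equiv> \<Sum>j=0..N. u j"
  shows "MN N u \<tau> N = MN N u \<tau> 0 + (- \<i>) ^ N * exp (- pi * \<i> * S) * qpow \<tau> (- of_nat N / 8)"
proof -
  define X Y e where "X = qpow \<tau> (of_nat N / 2) * exp (2 * pi * \<i> * S)"
    and "Y = mu N u \<tau> + (- \<i>) ^ N * exp (- pi * \<i> * S) * qpow \<tau> (- of_nat N / 8)"
    and "e = exp (- 2 * pi * \<i> * of_nat N * S / of_nat N - pi * \<i> * of_nat N ^ 2 * \<tau> / of_nat N)"
  have "mu N (u(0 := u 0 + of_nat N * \<tau>)) \<tau> = (-1) ^ N * qpow \<tau> (of_nat N / 2) * exp (2 * pi * \<i> * S) * Y"
    unfolding S_def Y_def by (rule mu_add_nat_tau[OF tau]) (use u in \<open>auto simp: theta_eq_0_iff[OF tau]\<close>)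
  hence "MN N u \<tau> N = (-1) ^ N * e * ((-1) ^ N * X * Y)"
    unfolding MN_def Let_def S_def [symmetric] e_def [symmetric] X_def by (simp only: mult.assoc)
  also have "\<dots> = ((-1) ^ N * (-1) ^ N) * (e * X) * Y" by (simp only: mult_ac)
  also have "e * X = exp 0"
    unfolding exp_add [symmetric] qpow_def e_def X_def
    by (rule arg_cong[of _ _ exp]) (use assms(2) in \<open>simp add: field_simps power2_eq_square\<close>)
  also have "(-1) ^ N * (-1) ^ N = (1::complex)" by (simp flip: power_mult_distrib)
  finally show ?thesis by (simp add: MN_def Y_def)
qed

section \<open>Symmetry in the arguments\<close>

lemma mu_permutes:
  assumes p: "p permutes {1..N}"
  shows "mu N (u \<circ> p) \<tau> = mu N u \<tau>"
  unfolding mu_altdef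
proof (rule infsum_reindex_bij_witness[of _ "\<lambda>n. n \<circ> p" "\<lambda>n. n \<circ> inv p"])
  fix n :: "nat \<Rightarrow> int"
  show "n \<circ> inv p \<circ> p = n" "n \<circ> p \<circ> inv p = n"
    using permutes_inv_o[OF p] by (simp_all add: o_assoc [symmetric])
  show "n \<circ> inv p \<in> Zvec {1..N}" "n \<circ> p \<in> Zvec {1..N}" if "n \<in> Zvec {1..N}"
    using that permutes_not_in[OF p] permutes_not_in[OF permutes_inv[OF p]] unfolding Zvec_def by auto
  have "p 0 = 0" using permutes_not_in[OF p, of 0] by simp
  moreover have "(\<Sum>j=1..N. (n \<circ> inv p) j) = (\<Sum>j=1..N. n j)"
    by (rule sum.permute[OF permutes_inv[OF p], symmetric])
  moreover have "(\<Prod>j=1..N. mu_coeff \<tau> (u j) ((n \<circ> inv p) j)) = (\<Prod>j=1..N. mu_coeff \<tau> ((u \<circ> p) j) (n j))"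
    using prod.permute[OF p, of "\<lambda>j. mu_coeff \<tau> (u j) ((n \<circ> inv p) j)"] permutes_inverses[OF p] by (simp add: o_def)
  ultimately show "exp (pi * \<i> * u 0) / (1 - exp (2 * pi * \<i> * u 0) * qpow \<tau> (of_int (\<Sum>j=1..N. (n \<circ> inv p) j)))
      * (\<Prod>j=1..N. mu_coeff \<tau> (u j) ((n \<circ> inv p) j))
    = exp (pi * \<i> * (u \<circ> p) 0) / (1 - exp (2 * pi * \<i> * (u \<circ> p) 0) * qpow \<tau> (of_int (\<Sum>j=1..N. n j)))
      * (\<Prod>j=1..N. mu_coeff \<tau> ((u \<circ> p) j) (n j))"
    by simp
qed

lemma MN_permutes_pos:
  assumes p: "p permutes {1..N}"
  shows "MN N (u \<circ> p) \<tau> k = MN N u \<tau> k"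
proof -
  have p0: "p 0 = 0" using permutes_not_in[OF p, of 0] by simp
  have pj: "p j \<noteq> 0" if "j \<noteq> 0" for j
    using p0 that permutes_inj[OF p] by (metis injD)
  have upd: "(u \<circ> p)(0 := (u \<circ> p) 0 + of_nat k * \<tau>) = u(0 := u 0 + of_nat k * \<tau>) \<circ> p"
  proof
    fix j
    show "((u \<circ> p)(0 := (u \<circ> p) 0 + of_nat k * \<tau>)) j = (u(0 := u 0 + of_nat k * \<tau>) \<circ> p) j"
      using p0 pj[of j] by (cases "j = 0") simp_all
  qed
  have sum: "(\<Sum>j=0..N. (u \<circ> p) j) = (\<Sum>j=0..N. u j)"
    by (rule sum.permute[symmetric], rule permutes_subset[OF p]) auto
  show ?thesis unfolding MN_def upd sum mu_permutes[OF p] ..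
qed

lemma MN_swap_0_1:
  assumes "Im \<tau> > 0" "N \<ge> 1" "\<forall>j\<le>N. u j \<notin> lattice \<tau>" "k < N"
  shows "MN N (u \<circ> Transposition.transpose 0 1) \<tau> k = MN N u \<tau> k"
proof -
  have "PhiN N u (u 0 - u 1) \<tau> k = 0" by (simp add: PhiN_def)
  moreover have "u(0 := u 0 - (u 0 - u 1), 1 := u 1 + (u 0 - u 1)) = u \<circ> Transposition.transpose 0 1"
    by (auto simp: fun_eq_iff Transposition.transpose_def)
  \<comment> \<open>For this z one has z - \<open>u 0\<close> = - \<open>u 1\<close> and z +
    \<open>u 1\<close> = \<open>u 0\<close>, so the side conditions of the translation formula are
    those on u.\<close>
  ultimately show ?thesis
    using MN_translate[of \<tau> u "u 0 - u 1" N k] assms lattice_uminus[of "u 1" \<tau>] by auto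
qed

lemma transpose_forall_le:
  assumes "\<forall>j\<le>N. f j \<notin> A" "a \<le> N" "b \<le> (N::nat)"
  shows "\<forall>j\<le>N. (f \<circ> Transposition.transpose a b) j \<notin> A"
proof (intro allI impI)
  fix j assume "j \<le> N"
  hence "Transposition.transpose a b j \<le> N" using assms by (simp add: Transposition.transpose_def)
  thus "(f \<circ> Transposition.transpose a b) j \<notin> A" using assms by simp
qed

text \<open>Transpositions within 1..N permute the summation vector; one that involves 0 is
  conjugated to (0 1) by (1 b). The lattice condition has to be carried along because the exchange
  of 0 and 1 depends on it.\<close>

lemma MN_transpose:
  assumes "Im \<tau> > 0" "N \<ge> 1" and u: "\<forall>j\<le>N. u j \<notin> lattice \<tau>" and "k < N"
    and ab: "a \<le> N" "b \<le> N"
  shows "MN N (u \<circ> Transposition.transpose a b) \<tau> k = MN N u \<tau> k"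
proof -
  have pos: "MN N (v \<circ> Transposition.transpose a b) \<tau> k = MN N v \<tau> k" if "a \<in> {1..N}" "b \<in> {1..N}" for a b and v :: "nat \<Rightarrow> complex"
    by (rule MN_permutes_pos) (use that in \<open>rule permutes_swap_id\<close>)
  have zero: "MN N (u \<circ> Transposition.transpose 0 b) \<tau> k = MN N u \<tau> k" if b: "b \<in> {1..N}" for b
  proof (cases "b = 1")
    case True
    thus ?thesis using MN_swap_0_1 assms by blast
  next
    case False
    have conj: "u \<circ> Transposition.transpose 0 b = u \<circ> Transposition.transpose 1 b \<circ> Transposition.transpose 0 1 \<circ> Transposition.transpose 1 b"
      using b False by (auto simp: fun_eq_iff Transposition.transpose_def)
    have "MN N (u \<circ> Transposition.transpose 0 b) \<tau> k = MN N (u \<circ> Transposition.transpose 1 b \<circ> Transposition.transpose 0 1) \<tau> k"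
      unfolding conj by (rule pos) (use b in auto)
    also have "\<dots> = MN N (u \<circ> Transposition.transpose 1 b) \<tau> k"
    proof (rule MN_swap_0_1[OF assms(1,2) _ assms(4)])
      show "\<forall>j\<le>N. (u \<circ> Transposition.transpose 1 b) j \<notin> lattice \<tau>"
        by (rule transpose_forall_le[OF u]) (use b in simp_all)
    qed
    also have "\<dots> = MN N u \<tau> k"
      by (rule pos) (use b in auto)
    finally show ?thesis .
  qed
  consider "a = b" | "a \<in> {1..N}" "b \<in> {1..N}" | "a = 0" "b \<in> {1..N}" | "b = 0" "a \<in> {1..N}"
    using ab by (cases a; cases b) auto
  thus ?thesis
    by cases (use pos zero in \<open>auto simp: Transposition.transpose_commute[of _ 0]\<close>)
qed

lemma MN_permutes:
  assumes "Im \<tau> > 0" "N \<ge> 1" "\<forall>j\<le>N. u j \<notin> lattice \<tau>" "k < N" and p: "p permutes {0..N}"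
  shows "MN N (u \<circ> p) \<tau> k = MN N u \<tau> k"
  using p finite_atLeastAtMost assms(3)
proof (induction p arbitrary: u rule: permutes_induct)
  case id
  show ?case by simp
next
  case (swap a b p)
  have "\<forall>j\<le>N. (u \<circ> Transposition.transpose a b) j \<notin> lattice \<tau>"
    by (rule transpose_forall_le[OF swap.prems]) (use swap.hyps in simp_all)
  hence "MN N (u \<circ> Transposition.transpose a b \<circ> p) \<tau> k = MN N (u \<circ> Transposition.transpose a b) \<tau> k"
    by (rule swap.IH)
  also have "\<dots> = MN N u \<tau> k"
    by (rule MN_transpose[OF assms(1,2) swap.prems assms(4)]) (use swap.hyps in simp_all)
  finally show ?case by (simp only: o_assoc)
qed

lemma MN_shift_tau:
  assumes "r \<le> N" "s \<le> N" "r \<noteq> s"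
  shows "MN N (u(r := u r - \<tau>, s := u s + \<tau>)) \<tau> k = MN N u \<tau> k"
proof -
  let ?u' = "u(r := u r - \<tau>, s := u s + \<tau>)"
  \<comment> \<open>The summation vector moves by +1 at s and by -1 at r. Index 0 is no coordinate
    of it; if r or s is 0, the sum of the entries of d is nonzero and accounts for the shift of
    \<open>u 0\<close>.\<close>
  define d where "d = (\<lambda>j. if j \<in> {1..N} then (if j = s then 1 else 0) - (if j = r then 1 else 0) else 0 :: int)"
  have "(\<Sum>j=1..N. d j) = (\<Sum>j=1..N. (if j = s then 1 else 0) - (if j = r then 1 else 0))"
    by (rule sum.cong) (auto simp: d_def)
  hence d: "(\<Sum>j=1..N. d j) = (if s = 0 then 0 else 1) - (if r = 0 then 0 else 1)"
    using assms by (auto simp: sum_subtractf)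
  have "mu N (?u'(0 := ?u' 0 + of_nat k * \<tau>)) \<tau> = mu N (u(0 := u 0 + of_nat k * \<tau>)) \<tau>"
  proof (rule mu_shift[where d = d])
    show "d \<in> Zvec {1..N}" by (auto simp: Zvec_def d_def)
    show "(?u'(0 := ?u' 0 + of_nat k * \<tau>)) 0 = (u(0 := u 0 + of_nat k * \<tau>)) 0 - of_int (\<Sum>j=1..N. d j) * \<tau>"
      unfolding d using assms by auto
  qed (use assms in \<open>auto simp: d_def\<close>)
  moreover have "sum ?u' {0..N} = sum u {0..N}"
    using assms by (simp add: sum_fun_upd del: fun_upd_apply) simp
  ultimately show ?thesis by (simp only: MN_def)
qed

theorem theorem1p3:
  fixes N :: nat and u :: "nat \<Rightarrow> complex" and \<tau> :: complex
  assumes "N \<ge> 1" and "Im \<tau> > 0"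
    and "\<forall>j\<le>N. u j \<notin> lattice \<tau>"
  fixes S :: complex
  defines "S \<equiv> (\<Sum>j=0..N. u j)"
  shows
    "(\<forall>k<N. exp (2 * pi * \<i> * of_nat k / of_nat N) * MN N (u(0 := u 0 + 1)) \<tau> k
              = - MN N u \<tau> k)
     \<and> (\<forall>k<N. exp (- 2 * pi * \<i> * S / of_nat N) * qpow \<tau> (- 1 / (2 * of_nat N))
              * (if k = 0 then MN N (u(0 := u 0 + \<tau>)) \<tau> (N - 1)
                 else MN N (u(0 := u 0 + \<tau>)) \<tau> (k - 1))
            = - MN N u \<tau> k
              - (if k = 0 then (- \<i>) ^ N * exp (- pi * \<i> * S) * qpow \<tau> (- of_nat N / 8)
                 else 0))
     \<and> (\<forall>z. z - u 0 \<notin> lattice \<tau> \<longrightarrow> z + u 1 \<notin> lattice \<tau> \<longrightarrow>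
          (\<forall>k<N. MN N (u(0 := u 0 - z, 1 := u 1 + z)) \<tau> k - MN N u \<tau> k = PhiN N u z \<tau> k))
     \<and> (\<forall>\<sigma>. \<sigma> permutes {0..N} \<longrightarrow> (\<forall>k<N. MN N u \<tau> k = MN N (u \<circ> \<sigma>) \<tau> k))
     \<and> (\<forall>r s. r \<le> N \<longrightarrow> s \<le> N \<longrightarrow> r \<noteq> s \<longrightarrow>
          (\<forall>k<N. MN N (u(r := u r - \<tau>, s := u s + \<tau>)) \<tau> k = MN N u \<tau> k))"
proof (intro conjI allI impI)
  fix k assume "k < N"
  show "exp (2 * pi * \<i> * of_nat k / of_nat N) * MN N (u(0 := u 0 + 1)) \<tau> k = - MN N u \<tau> k"
    using assms(1) by (rule MN_add_1)
next
  fix k assume k: "k < N"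
  show "exp (- 2 * pi * \<i> * S / of_nat N) * qpow \<tau> (- 1 / (2 * of_nat N))
              * (if k = 0 then MN N (u(0 := u 0 + \<tau>)) \<tau> (N - 1)
                 else MN N (u(0 := u 0 + \<tau>)) \<tau> (k - 1))
            = - MN N u \<tau> k
              - (if k = 0 then (- \<i>) ^ N * exp (- pi * \<i> * S) * qpow \<tau> (- of_nat N / 8)
                 else 0)"
  proof (cases "k = 0")
    \<comment> \<open>Row 0 of the permuted vector is the entry N - 1; the step formula takes it to
      index N, and the wrap-around to 0 produces the inhomogeneous term.\<close>
    case True
    thus ?thesis
      using MN_add_tau_Suc[OF assms(1), of u \<tau> "N - 1"] MN_N[OF assms(2,1,3)] assms(1)
      unfolding S_def by simp
  next
    case False
    thus ?thesis
      using MN_add_tau_Suc[OF assms(1), of u \<tau> "k - 1"] unfolding S_def by simp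
  qed
next
  fix z k assume "z - u 0 \<notin> lattice \<tau>" "z + u 1 \<notin> lattice \<tau>" "k < N"
  thus "MN N (u(0 := u 0 - z, 1 := u 1 + z)) \<tau> k - MN N u \<tau> k = PhiN N u z \<tau> k"
    using assms by (intro MN_translate) auto
next
  fix \<sigma> k assume "\<sigma> permutes {0..N}" "k < N"
  thus "MN N u \<tau> k = MN N (u \<circ> \<sigma>) \<tau> k"
    using assms by (intro MN_permutes[symmetric]) auto
next
  fix r s k assume "r \<le> N" "s \<le> N" "r \<noteq> s" "k < N"
  thus "MN N (u(r := u r - \<tau>, s := u s + \<tau>)) \<tau> k = MN N u \<tau> k"
    by (intro MN_shift_tau)
qed

end
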